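(* Consider the Ising model on $\mathbb Z\times\mathbb Z$ at inverse temperature $\beta=1$ with formal Hamiltonian $$H(\sigma)=-\frac12\sum_{i\in\mathbb Z}\ \sum_{x\ne y\in\mathbb Z}J_\gamma(x,y)\sigma(x,i)\sigma(y,i)-\epsilon\sum_{x,i\in\mathbb Z}\sigma(x,i)\sigma(x,i+1),\qquad \sigma\in\{-1,+1\}^{\mathbb Z\times\mathbb Z}.$$ Given any $\epsilon>0$, for all $\gamma>0$ small enough (depending on $\epsilon$) one has $\mu^+_\gamma\neq\mu^-_\gamma$, where $\mu^{+}_\gamma$ and $\mu^-_\gamma$ are the plus and minus DLR measures, i.e. the thermodynamic limits of the finite-volume Gibbs measures with boundary conditions identically $+1$, respectively identically $-1$.
   Context: $J:\mathbb R\to[0,\infty)$ is a symmetric probability density with continuous derivative, support in $[-1,1]$ and $J(0)>0$. For $\gamma>0$ and $x\neq y\in\mathbb Z$, $J_\gamma(x,y)=c_\gamma\,\gamma\, J(\gamma(x-y))$, where the constant $c_\gamma$ is determined by $\sum_{y\ne x}J_\gamma(x,y)=1$. Finite-volume Gibbs measures have weights proportional to $e^{-H}$, since $\beta=1$. *)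

theory Defs
  imports "HOL-Probability.Probability"
begin

type_synonym config = "int \<times> int \<Rightarrow> real"

definition config_space :: "config measure" where
  "config_space = (\<Pi>\<^sub>M p\<in>UNIV. count_space {-1, 1})"

text \<open>The constant exists and is unique for all small \<open>\<gamma> > 0\<close> if \<open>J \<ge> 0\<close> is continuous with bounded
  support and \<open>J 0 > 0\<close>. For \<open>\<gamma>\<close> so large that \<open>J (\<gamma> z) = 0\<close> for every integer \<open>z \<noteq> 0\<close>, it is
  unspecified.\<close>

definition kac_const :: "(real \<Rightarrow> real) \<Rightarrow> real \<Rightarrow> real" where
  "kac_const J \<gamma> =
     (THE c. \<forall>x::int. ((\<lambda>y. c * \<gamma> * J (\<gamma> * of_int (x - y))) has_sum 1) {y. y \<noteq> x})"

definition kac :: "(real \<Rightarrow> real) \<Rightarrow> real \<Rightarrow> int \<Rightarrow> int \<Rightarrow> real" where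
  "kac J \<gamma> x y = kac_const J \<gamma> * \<gamma> * J (\<gamma> * of_int (x - y))"

text \<open>The terms of the formal Hamiltonian that involve at least one site of the finite volume
  \<open>\<Lambda>\<close>: bonds inside \<open>\<Lambda>\<close> and bonds between \<open>\<Lambda>\<close> and the boundary condition. Sites are pairs
  \<open>(x, i)\<close> with \<open>i\<close> the index of the horizontal line. The factor 1/2 compensates for horizontal
  bonds being summed over ordered pairs. When \<open>J\<close> has bounded support, only finitely many terms
  of each sum are nonzero.\<close>

definition hamiltonian ::
  "(real \<Rightarrow> real) \<Rightarrow> real \<Rightarrow> real \<Rightarrow> (int \<times> int) set \<Rightarrow> config \<Rightarrow> real" where
  "hamiltonian J \<epsilon> \<gamma> \<Lambda> \<sigma> =
     - (1/2) * (\<Sum>\<^sub>\<infinity>(i, x, y) | x \<noteq> y \<and> ((x, i) \<in> \<Lambda> \<or> (y, i) \<in> \<Lambda>).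
                  kac J \<gamma> x y * \<sigma> (x, i) * \<sigma> (y, i))
     - \<epsilon> * (\<Sum>\<^sub>\<infinity>(x, i) | (x, i) \<in> \<Lambda> \<or> (x, i + 1) \<in> \<Lambda>. \<sigma> (x, i) * \<sigma> (x, i + 1))"

definition configs_bc :: "(int \<times> int) set \<Rightarrow> config \<Rightarrow> config set" where
  "configs_bc \<Lambda> \<tau> = {\<sigma> \<in> space config_space. \<forall>p. p \<notin> \<Lambda> \<longrightarrow> \<sigma> p = \<tau> p}"

definition partition_fun ::
  "(real \<Rightarrow> real) \<Rightarrow> real \<Rightarrow> real \<Rightarrow> (int \<times> int) set \<Rightarrow> config \<Rightarrow> real" where
  "partition_fun J \<epsilon> \<gamma> \<Lambda> \<tau> = (\<Sum>\<sigma>\<in>configs_bc \<Lambda> \<tau>. exp (- hamiltonian J \<epsilon> \<gamma> \<Lambda> \<sigma>))"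

definition gibbs ::
  "(real \<Rightarrow> real) \<Rightarrow> real \<Rightarrow> real \<Rightarrow> (int \<times> int) set \<Rightarrow> config \<Rightarrow> config measure" where
  "gibbs J \<epsilon> \<gamma> \<Lambda> \<tau> =
     distr (point_measure (configs_bc \<Lambda> \<tau>)
              (\<lambda>\<sigma>. ennreal (exp (- hamiltonian J \<epsilon> \<gamma> \<Lambda> \<sigma>) / partition_fun J \<epsilon> \<gamma> \<Lambda> \<tau>)))
           config_space (\<lambda>\<sigma>. \<sigma>)"

definition local_fun :: "(config \<Rightarrow> real) \<Rightarrow> bool" where
  "local_fun f \<longleftrightarrow>
     (\<exists>\<Delta>. finite \<Delta> \<and>
        (\<forall>\<sigma>\<in>space config_space. \<forall>\<sigma>'\<in>space config_space. (\<forall>p\<in>\<Delta>. \<sigma> p = \<sigma>' p) \<longrightarrow> f \<sigma> = f \<sigma>'))"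

text \<open>Weak limit of the Gibbs measures with boundary condition \<open>\<tau>\<close> along the net of all finite
  volumes ordered by inclusion. Local functions determine a measure on \<open>config_space\<close>, so there
  is at most one such limit.\<close>

definition thermodynamic_limit ::
  "(real \<Rightarrow> real) \<Rightarrow> real \<Rightarrow> real \<Rightarrow> config \<Rightarrow> config measure \<Rightarrow> bool" where
  "thermodynamic_limit J \<epsilon> \<gamma> \<tau> \<mu> \<longleftrightarrow>
     prob_space \<mu> \<and> sets \<mu> = sets config_space \<and>
     (\<forall>f. local_fun f \<longrightarrow>
        ((\<lambda>\<Lambda>. integral\<^sup>L (gibbs J \<epsilon> \<gamma> \<Lambda> \<tau>) f) \<longlongrightarrow> integral\<^sup>L \<mu> f)
          (finite_subsets_at_top UNIV))"

end

theory Submission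
  imports Defs
begin

text \<open>The magnetization of an Ising model with plus boundary condition dominates the probability that
  the site is connected to the boundary in independent bond percolation with probabilities
  \<open>tanh J\<^sub>e\<close>: by the second Griffiths inequality correlations are concave in each \<open>tanh J\<^sub>e\<close>
  separately, and with every bond at coupling 0 or \<open>\<infinity>\<close> a spin connected to the boundary is fixed.
  For the layered Kac interaction this percolation model is locally a branching process whose
  horizontal mean offspring is 1, which the vertical bonds raise to a value greater than 1. Hence
  two rows of length of order \<open>1/\<gamma>\<close> contain, with probability bounded away from 0, a cluster of
  order \<open>1/\<gamma>\<close> sites. Stacking many such pairs of rows makes the probability of a large cluster close
  to 1, a small part of the couplings kept in reserve links the clusters of neighbouring blocks, and
  a hierarchical argument on \<open>3 \<times> 3\<close> blocks shows that the blocks percolate. So the magnetization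
  stays positive in the plus phase, and spin flip gives the opposite sign in the minus phase.\<close>

subsection \<open>Finite product Bernoulli expectations\<close>

text \<open>At \<beta> = 1 the interaction within a row is exactly critical: the kernel has total
  mass 1, and the end points of an interval, the exhaustion of columns and the inequality tanh x < x
  all push below 1. The whole margin comes from the vertical bonds, so every loss is arranged to be
  a fixed fraction of t = tanh \<epsilon> / 5, uniformly in \<gamma>. Two rows suffice because one
  vertical bond per column already raises the mean offspring to about 1 + t.

  The order of choice is essential. The number K of windows, the seed probability \<delta> and the
  number M of attempts depend only on t and on bounds for J; \<gamma> comes last. Thus a block can
  be made good with probability close to 1 by M attempts, and the resulting tiny factor t^(4KM) in
  the link probability is beaten by the number of trials, which is of order 1/\<gamma>.

  The theorem also asserts that both limits exist. The same Griffiths inequalities make the plus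
  correlations decrease with the volume, and Kolmogorov's extension theorem turns their limits into
  a measure.\<close>

definition bern_ex :: "'a set \<Rightarrow> ('a \<Rightarrow> real) \<Rightarrow> ('a set \<Rightarrow> real) \<Rightarrow> real" where
  "bern_ex E p f = (\<Sum>\<omega>\<in>Pow E. (\<Prod>e\<in>E. if e \<in> \<omega> then p e else 1 - p e) * f \<omega>)"

lemma bern_ex_empty [simp]: "bern_ex {} p f = f {}"
  by (simp add: bern_ex_def)

lemma bern_ex_cong:
  assumes "\<And>e. e \<in> E \<Longrightarrow> p e = p' e" "\<And>\<omega>. \<omega> \<subseteq> E \<Longrightarrow> f \<omega> = f' \<omega>"
  shows "bern_ex E p f = bern_ex E p' f'"
  unfolding bern_ex_def using assms by (intro sum.cong refl arg_cong2[where f="(*)"] prod.cong) auto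

text \<open>Conditioning on one coordinate. \<open>bern_ex\<close> is a polynomial in the
  \<open>p e\<close>, so this recursion holds for arbitrary real \<open>p\<close> and carries most
  inductions below; bounds on \<open>p\<close> enter with the inequalities, through
  \<open>is_prob\<close>.\<close>

lemma bern_ex_insert:
  assumes "finite E" "e \<notin> E"
  shows "bern_ex (insert e E) p f = p e * bern_ex E p (\<lambda>\<omega>. f (insert e \<omega>)) + (1 - p e) * bern_ex E p f"
proof -
  let ?w = "\<lambda>E \<omega>. (\<Prod>e\<in>E. if e \<in> \<omega> then p e else 1 - p e)"
  have inj: "inj_on (insert e) (Pow E)" using assms by (auto simp: inj_on_def)
  have d: "Pow E \<inter> insert e ` Pow E = {}" using assms by auto
  have w1: "?w (insert e E) \<omega> = (1 - p e) * ?w E \<omega>" if "\<omega> \<in> Pow E" for \<omega>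
    using that assms by (subst prod.insert) auto
  have w2: "?w (insert e E) (insert e \<omega>) = p e * ?w E \<omega>" if "\<omega> \<in> Pow E" for \<omega>
    using that assms by (subst prod.insert) (auto intro!: prod.cong)
  have "bern_ex (insert e E) p f = (\<Sum>\<omega>\<in>Pow E. ?w (insert e E) \<omega> * f \<omega>)
      + (\<Sum>\<omega>\<in>Pow E. ?w (insert e E) (insert e \<omega>) * f (insert e \<omega>))"
    unfolding bern_ex_def Pow_insert using assms d inj
    by (subst sum.union_disjoint) (auto simp: sum.reindex)
  also have "\<dots> = (\<Sum>\<omega>\<in>Pow E. (1 - p e) * (?w E \<omega> * f \<omega>))
      + (\<Sum>\<omega>\<in>Pow E. p e * (?w E \<omega> * f (insert e \<omega>)))"
    by (intro arg_cong2[where f="(+)"] sum.cong refl) (auto simp only: w1 w2 mult.assoc)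
  finally show ?thesis unfolding bern_ex_def by (simp add: sum_distrib_left)
qed

lemma bern_ex_const [simp]: "finite E \<Longrightarrow> bern_ex E p (\<lambda>_. c) = c"
  by (induction E rule: finite_induct) (auto simp: bern_ex_insert algebra_simps)

lemma bern_ex_add: "bern_ex E p (\<lambda>\<omega>. f \<omega> + g \<omega>) = bern_ex E p f + bern_ex E p g"
  by (simp add: bern_ex_def ring_distribs sum.distrib)

lemma bern_ex_diff: "bern_ex E p (\<lambda>\<omega>. f \<omega> - g \<omega>) = bern_ex E p f - bern_ex E p g"
  by (simp add: bern_ex_def ring_distribs sum_subtractf)

lemma bern_ex_cmult: "bern_ex E p (\<lambda>\<omega>. c * f \<omega>) = c * bern_ex E p f"
  unfolding bern_ex_def sum_distrib_left by (intro sum.cong refl) simp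

lemma bern_ex_multc: "bern_ex E p (\<lambda>\<omega>. f \<omega> * c) = bern_ex E p f * c"
  unfolding bern_ex_def sum_distrib_right by (intro sum.cong refl) simp

lemma bern_ex_sum: "bern_ex E p (\<lambda>\<omega>. \<Sum>i\<in>I. f i \<omega>) = (\<Sum>i\<in>I. bern_ex E p (f i))"
  unfolding bern_ex_def by (simp add: sum_distrib_left) (rule sum.swap)

definition is_prob :: "'a set \<Rightarrow> ('a \<Rightarrow> real) \<Rightarrow> bool" where
  "is_prob E p \<longleftrightarrow> (\<forall>e\<in>E. 0 \<le> p e \<and> p e \<le> 1)"

lemma is_prob_subset: "is_prob E p \<Longrightarrow> F \<subseteq> E \<Longrightarrow> is_prob F p"
  by (auto simp: is_prob_def)

lemma bern_ex_mono:
  assumes "is_prob E p" "\<And>\<omega>. \<omega> \<subseteq> E \<Longrightarrow> f \<omega> \<le> g \<omega>"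
  shows "bern_ex E p f \<le> bern_ex E p g"
  unfolding bern_ex_def using assms
  by (intro sum_mono mult_left_mono prod_nonneg) (auto simp: is_prob_def)

lemma bern_ex_le_const:
  assumes "finite E" "is_prob E p" "\<And>\<omega>. \<omega> \<subseteq> E \<Longrightarrow> f \<omega> \<le> c"
  shows "bern_ex E p f \<le> c"
  using bern_ex_mono[OF assms(2), of f "\<lambda>_. c"] assms by simp

lemma bern_ex_ge_const:
  assumes "finite E" "is_prob E p" "\<And>\<omega>. \<omega> \<subseteq> E \<Longrightarrow> c \<le> f \<omega>"
  shows "c \<le> bern_ex E p f"
  using bern_ex_mono[OF assms(2), of "\<lambda>_. c" f] assms by simp

text \<open>Fubini for independent coordinates. The exploration and the construction of seeds before
  links both reveal one set of bonds first and average over the rest.\<close>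

lemma bern_ex_Un:
  assumes "finite E" "finite F" "E \<inter> F = {}"
  shows "bern_ex (E \<union> F) p f = bern_ex E p (\<lambda>\<omega>. bern_ex F p (\<lambda>\<omega>'. f (\<omega> \<union> \<omega>')))"
  using assms
proof (induction E arbitrary: f rule: finite_induct)
  case (insert e E)
  then have "bern_ex (insert e E \<union> F) p f =
    p e * bern_ex (E \<union> F) p (\<lambda>\<omega>. f (insert e \<omega>)) + (1 - p e) * bern_ex (E \<union> F) p f"
    by (simp add: bern_ex_insert)
  with insert show ?case by (simp add: bern_ex_insert)
qed simp

text \<open>The coordinates outside F integrate out to 1. This lets all events live on one large
  bond set and still be evaluated on their own bonds.\<close>

lemma bern_ex_Int:
  assumes "finite E" "F \<subseteq> E"
  shows "bern_ex E p (\<lambda>\<omega>. f (\<omega> \<inter> F)) = bern_ex F p f"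
proof -
  have fin: "finite F" using assms finite_subset by auto
  have "bern_ex E p (\<lambda>\<omega>. f (\<omega> \<inter> F)) = bern_ex (F \<union> (E - F)) p (\<lambda>\<omega>. f (\<omega> \<inter> F))"
    using assms by (simp add: Un_absorb1)
  also have "\<dots> = bern_ex F p (\<lambda>\<omega>. bern_ex (E - F) p (\<lambda>\<omega>'. f ((\<omega> \<union> \<omega>') \<inter> F)))"
    using assms fin by (subst bern_ex_Un) auto
  also have "\<dots> = bern_ex F p (\<lambda>\<omega>. bern_ex (E - F) p (\<lambda>\<omega>'. f \<omega>))"
  proof (intro bern_ex_cong refl)
    fix \<omega> \<omega>' assume "\<omega> \<subseteq> F" "\<omega>' \<subseteq> E - F"
    then have "(\<omega> \<union> \<omega>') \<inter> F = \<omega>" by auto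
    then show "f ((\<omega> \<union> \<omega>') \<inter> F) = f \<omega>" by simp
  qed
  finally show ?thesis using assms by simp
qed

lemma bern_ex_reindex:
  assumes "finite E" "inj_on h E"
  shows "bern_ex (h ` E) p f = bern_ex E (\<lambda>e. p (h e)) (\<lambda>\<omega>. f (h ` \<omega>))"
  using assms
proof (induction E arbitrary: f rule: finite_induct)
  case (insert e E)
  then have "h e \<notin> h ` E" by auto
  with insert show ?case by (simp add: bern_ex_insert)
qed simp

text \<open>Independence in generating-function form. It is used with the weights of newly found
  vertices, and with values 0 and 1 for the events that all or no elements are open.\<close>

lemma bern_ex_prod:
  assumes "finite E"
  shows "bern_ex E p (\<lambda>\<omega>. \<Prod>e\<in>E. if e \<in> \<omega> then g e else k e) = (\<Prod>e\<in>E. p e * g e + (1 - p e) * k e)"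
  using assms
proof (induction E rule: finite_induct)
  case (insert e E)
  have 1: "bern_ex E p (\<lambda>\<omega>. \<Prod>e'\<in>insert e E. if e' \<in> insert e \<omega> then g e' else k e')
      = bern_ex E p (\<lambda>\<omega>. g e * (\<Prod>e\<in>E. if e \<in> \<omega> then g e else k e))"
    using insert.hyps by (intro bern_ex_cong) (auto intro!: prod.cong)
  have 2: "bern_ex E p (\<lambda>\<omega>. \<Prod>e'\<in>insert e E. if e' \<in> \<omega> then g e' else k e')
      = bern_ex E p (\<lambda>\<omega>. k e * (\<Prod>e\<in>E. if e \<in> \<omega> then g e else k e))"
    using insert.hyps by (intro bern_ex_cong) auto
  show ?case
    unfolding bern_ex_insert[OF insert.hyps] 1 2 bern_ex_cmult insert.IH
    using insert.hyps by (simp add: algebra_simps)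
qed simp

lemma bern_ex_indep_mult:
  assumes "finite E" "F \<subseteq> E" "G \<subseteq> E" "F \<inter> G = {}"
  shows "bern_ex E p (\<lambda>\<omega>. f (\<omega> \<inter> F) * g (\<omega> \<inter> G)) = bern_ex F p f * bern_ex G p g"
proof -
  have fin: "finite F" "finite G" using assms by (meson finite_subset)+
  have "bern_ex E p (\<lambda>\<omega>. f (\<omega> \<inter> F) * g (\<omega> \<inter> G)) = bern_ex (F \<union> G) p (\<lambda>\<omega>. f (\<omega> \<inter> F) * g (\<omega> \<inter> G))"
    using assms bern_ex_Int[of E "F \<union> G" p "\<lambda>\<omega>. f (\<omega> \<inter> F) * g (\<omega> \<inter> G)"] by (simp add: Int_assoc Int_absorb1)
  also have "\<dots> = bern_ex F p (\<lambda>\<omega>. bern_ex G p (\<lambda>\<omega>'. f ((\<omega> \<union> \<omega>') \<inter> F) * g ((\<omega> \<union> \<omega>') \<inter> G)))"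
    using assms fin by (subst bern_ex_Un) auto
  also have "\<dots> = bern_ex F p (\<lambda>\<omega>. bern_ex G p (\<lambda>\<omega>'. f \<omega> * g \<omega>'))"
  proof (intro bern_ex_cong refl)
    fix \<omega> \<omega>' assume "\<omega> \<subseteq> F" "\<omega>' \<subseteq> G"
    then have "(\<omega> \<union> \<omega>') \<inter> F = \<omega>" "(\<omega> \<union> \<omega>') \<inter> G = \<omega>'" using assms by auto
    then show "f ((\<omega> \<union> \<omega>') \<inter> F) * g ((\<omega> \<union> \<omega>') \<inter> G) = f \<omega> * g \<omega>'" by simp
  qed
  finally show ?thesis by (simp add: bern_ex_cmult bern_ex_multc)
qed

text \<open>Renormalization: disjoint families of coordinates are independent, so the set of indices
  whose event occurs is again a Bernoulli set, with the event probabilities as new densities. It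
  turns bond percolation into site percolation of blocks.\<close>

lemma bern_ex_indep_events:
  assumes "finite I" "\<And>z. z \<in> I \<Longrightarrow> finite (E z)" "disjoint_family_on E I"
  shows "bern_ex (\<Union>z\<in>I. E z) p (\<lambda>\<omega>. H {z\<in>I. X z (\<omega> \<inter> E z)})
       = bern_ex I (\<lambda>z. bern_ex (E z) p (\<lambda>\<omega>. of_bool (X z \<omega>))) H"
  using assms
proof (induction I arbitrary: H rule: finite_induct)
  case (insert z I)
  let ?E = "\<Union>z\<in>I. E z" and ?P = "\<lambda>z. bern_ex (E z) p (\<lambda>\<omega>. of_bool (X z \<omega>))"
  have disj: "E z \<inter> ?E = {}" "disjoint_family_on E I"
    using insert.prems(2) insert.hyps(2) disjoint_family_on_insert[of z I E] by auto
  have fin: "finite ?E" "finite (E z)" using insert by auto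
  have IH: "bern_ex ?E p (\<lambda>\<omega>. H {z\<in>I. X z (\<omega> \<inter> E z)}) = bern_ex I ?P H" for H
    using insert.IH[OF insert.prems(1) disj(2)] by auto
  have "bern_ex (\<Union>z\<in>insert z I. E z) p (\<lambda>\<omega>. H {y\<in>insert z I. X y (\<omega> \<inter> E y)})
     = bern_ex (E z) p (\<lambda>\<omega>. bern_ex ?E p (\<lambda>\<omega>'. H {y\<in>insert z I. X y ((\<omega> \<union> \<omega>') \<inter> E y)}))"
    using fin disj by (simp add: bern_ex_Un)
  also have "\<dots> = bern_ex (E z) p (\<lambda>\<omega>. bern_ex ?E p (\<lambda>\<omega>'. of_bool (X z \<omega>) * H (insert z {y\<in>I. X y (\<omega>' \<inter> E y)})
       + (1 - of_bool (X z \<omega>)) * H {y\<in>I. X y (\<omega>' \<inter> E y)}))"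
  proof (intro bern_ex_cong refl)
    fix \<omega> \<omega>' assume *: "\<omega> \<subseteq> E z" "\<omega>' \<subseteq> ?E"
    have a: "(\<omega> \<union> \<omega>') \<inter> E z = \<omega>" using * disj by auto
    have b: "(\<omega> \<union> \<omega>') \<inter> E y = \<omega>' \<inter> E y" if "y \<in> I" for y using * disj that by auto
    have "{y\<in>insert z I. X y ((\<omega> \<union> \<omega>') \<inter> E y)} = (if X z \<omega> then insert z {y\<in>I. X y (\<omega>' \<inter> E y)} else {y\<in>I. X y (\<omega>' \<inter> E y)})"
      using a b insert.hyps(2) by auto
    then show "H {y\<in>insert z I. X y ((\<omega> \<union> \<omega>') \<inter> E y)} = of_bool (X z \<omega>) * H (insert z {y\<in>I. X y (\<omega>' \<inter> E y)})
       + (1 - of_bool (X z \<omega>)) * H {y\<in>I. X y (\<omega>' \<inter> E y)}" by simp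
  qed
  also have "\<dots> = bern_ex (E z) p (\<lambda>\<omega>. of_bool (X z \<omega>) * bern_ex I ?P (\<lambda>G. H (insert z G))
       + (1 - of_bool (X z \<omega>)) * bern_ex I ?P H)"
    unfolding bern_ex_add bern_ex_cmult IH[of H] IH[of "\<lambda>G. H (insert z G)"] by simp
  also have "\<dots> = ?P z * bern_ex I ?P (\<lambda>G. H (insert z G)) + (1 - ?P z) * bern_ex I ?P H"
    using fin by (simp add: bern_ex_add bern_ex_multc bern_ex_diff)
  also have "\<dots> = bern_ex (insert z I) ?P H" using insert.hyps by (simp add: bern_ex_insert)
  finally show ?case .
qed simp

text \<open>Stochastic monotonicity in the densities. In the induction step a larger density of z
  shifts weight from the smaller value \<open>?b'\<close> to the larger value
  \<open>?a'\<close>.\<close>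

lemma bern_ex_mono_prob:
  assumes "finite I" "is_prob I p" "is_prob I p'" "\<And>z. z \<in> I \<Longrightarrow> p z \<le> p' z"
    and "\<And>G G'. G \<subseteq> G' \<Longrightarrow> G' \<subseteq> I \<Longrightarrow> H G \<le> (H G' :: real)"
  shows "bern_ex I p H \<le> bern_ex I p' H"
  using assms
proof (induction I arbitrary: H rule: finite_induct)
  case (insert z I)
  let ?a = "bern_ex I p (\<lambda>G. H (insert z G))" and ?b = "bern_ex I p H"
  let ?a' = "bern_ex I p' (\<lambda>G. H (insert z G))" and ?b' = "bern_ex I p' H"
  have pr: "is_prob I p" "is_prob I p'" "0 \<le> p z" "p' z \<le> 1" "p z \<le> p' z"
    using insert.prems by (auto simp: is_prob_def)
  have 1: "?a \<le> ?a'" by (rule insert.IH) (use insert.prems(1-3) pr in \<open>simp_all\<close>, intro insert.prems(4), auto)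
  have 2: "?b \<le> ?b'" by (rule insert.IH) (use insert.prems(1-3) pr in \<open>simp_all\<close>, intro insert.prems(4), auto)
  have 3: "?b' \<le> ?a'" by (rule bern_ex_mono) (use pr in simp, intro insert.prems(4), auto)
  have "p z * ?a + (1 - p z) * ?b \<le> p z * ?a' + (1 - p z) * ?b'"
    using 1 2 pr by (intro add_mono mult_left_mono) auto
  also have "\<dots> \<le> p' z * ?a' + (1 - p' z) * ?b'"
  proof -
    have "0 \<le> (p' z - p z) * (?a' - ?b')" using 3 pr by simp
    then show ?thesis by (simp add: algebra_simps)
  qed
  finally show ?case using insert.hyps by (simp add: bern_ex_insert)
qed simp

text \<open>The intersection of two independent Bernoulli sets is Bernoulli. This merges the
  goodness of a block and the success of its links into one site percolation.\<close>

lemma bern_ex_thin: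
  assumes "finite I"
  shows "bern_ex I p (\<lambda>G. bern_ex I p' (\<lambda>L. H (G \<inter> L))) = bern_ex I (\<lambda>z. p z * p' z) H"
  using assms
proof (induction I arbitrary: H rule: finite_induct)
  case (insert z I)
  have z: "insert z G \<inter> L = G \<inter> L" "G \<inter> insert z L = G \<inter> L"
      "insert z G \<inter> insert z L = insert z (G \<inter> L)" if "G \<subseteq> I" "L \<subseteq> I" for G L
    using that insert.hyps by auto
  have a: "bern_ex I p (\<lambda>G. bern_ex I p' (\<lambda>L. H (insert z G \<inter> L))) = bern_ex I p (\<lambda>G. bern_ex I p' (\<lambda>L. H (G \<inter> L)))"
    "bern_ex I p (\<lambda>G. bern_ex I p' (\<lambda>L. H (G \<inter> insert z L))) = bern_ex I p (\<lambda>G. bern_ex I p' (\<lambda>L. H (G \<inter> L)))"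
    "bern_ex I p (\<lambda>G. bern_ex I p' (\<lambda>L. H (insert z G \<inter> insert z L))) = bern_ex I p (\<lambda>G. bern_ex I p' (\<lambda>L. H (insert z (G \<inter> L))))"
    by (rule bern_ex_cong, rule refl, rule bern_ex_cong, rule refl, simp only: z)+
  have "bern_ex (insert z I) p (\<lambda>G. bern_ex (insert z I) p' (\<lambda>L. H (G \<inter> L)))
     = p z * p' z * bern_ex I p (\<lambda>G. bern_ex I p' (\<lambda>L. H (insert z (G \<inter> L))))
     + (1 - p z * p' z) * bern_ex I p (\<lambda>G. bern_ex I p' (\<lambda>L. H (G \<inter> L)))"
    using insert.hyps by (simp add: bern_ex_insert bern_ex_add bern_ex_cmult a) (simp add: algebra_simps)
  also have "\<dots> = bern_ex (insert z I) (\<lambda>z. p z * p' z) H"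
    using insert.hyps insert.IH[of H] insert.IH[of "\<lambda>G. H (insert z G)"] by (simp add: bern_ex_insert)
  finally show ?case .
qed simp

lemma bern_ex_none:
  assumes "finite I" "\<And>z. z \<in> I \<Longrightarrow> finite (E z)" "disjoint_family_on E I"
  shows "bern_ex (\<Union>z\<in>I. E z) p (\<lambda>\<omega>. of_bool (\<forall>z\<in>I. \<not> X z (\<omega> \<inter> E z)))
       = (\<Prod>z\<in>I. 1 - bern_ex (E z) p (\<lambda>\<omega>. of_bool (X z \<omega>)))"
proof -
  let ?P = "\<lambda>z. bern_ex (E z) p (\<lambda>\<omega>. of_bool (X z \<omega>))"
  have "bern_ex (\<Union>z\<in>I. E z) p (\<lambda>\<omega>. of_bool (\<forall>z\<in>I. \<not> X z (\<omega> \<inter> E z)))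
     = bern_ex (\<Union>z\<in>I. E z) p (\<lambda>\<omega>. of_bool ({z\<in>I. X z (\<omega> \<inter> E z)} = {}))"
    by (intro bern_ex_cong) auto
  also have "\<dots> = bern_ex I ?P (\<lambda>G. of_bool (G = {}))"
    using assms by (rule bern_ex_indep_events[where H = "\<lambda>G. of_bool (G = {})"])
  also have "\<dots> = bern_ex I ?P (\<lambda>G. \<Prod>z\<in>I. if z \<in> G then 0 else 1)"
    using assms(1) by (intro bern_ex_cong refl) (auto simp: prod_zero_iff)
  also have "\<dots> = (\<Prod>z\<in>I. 1 - ?P z)"
    using assms(1) by (simp add: bern_ex_prod)
  finally show ?thesis .
qed

lemma bern_ex_of_bool_not:
  "finite E \<Longrightarrow> bern_ex E p (\<lambda>\<omega>. of_bool (\<not> P \<omega>)) = 1 - bern_ex E p (\<lambda>\<omega>. of_bool (P \<omega>))"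
  by (simp add: of_bool_not_iff bern_ex_diff)

lemma bern_ex_of_bool_bounds:
  assumes "finite E" "is_prob E p"
  shows "0 \<le> bern_ex E p (\<lambda>\<omega>. of_bool (P \<omega>))" "bern_ex E p (\<lambda>\<omega>. of_bool (P \<omega>)) \<le> 1"
  using assms by (auto intro!: bern_ex_ge_const bern_ex_le_const)

subsection \<open>Griffiths inequalities and comparison with percolation\<close>

text \<open>The plus boundary condition is built in, so a bond that crosses the boundary acts as a
  field on its inner end without a separate term.\<close>

definition spins :: "'v set \<Rightarrow> ('v \<Rightarrow> real) set" where
  "spins \<Lambda> = {\<sigma>. (\<forall>p. \<sigma> p \<in> {-1, 1}) \<and> (\<forall>p. p \<notin> \<Lambda> \<longrightarrow> \<sigma> p = 1)}"

text \<open>The Walsh characters: the interaction term for a bond, the spin itself for a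
  singleton.\<close>

definition chi :: "'v set \<Rightarrow> ('v \<Rightarrow> real) \<Rightarrow> real" where
  "chi A \<sigma> = (\<Prod>p\<in>A. \<sigma> p)"

lemma chi_empty [simp]: "chi {} \<sigma> = 1"
  by (simp add: chi_def)

lemma spins_cases: "\<sigma> \<in> spins \<Lambda> \<Longrightarrow> \<sigma> p = 1 \<or> \<sigma> p = -1"
  by (auto simp: spins_def)

lemma one_in_spins [simp]: "(\<lambda>_. 1) \<in> spins \<Lambda>"
  by (simp add: spins_def)

lemma finite_spins [simp]: "finite \<Lambda> \<Longrightarrow> finite (spins \<Lambda>)"
  by (rule finite_subset[OF _ finite_set_of_finite_funs[of \<Lambda> "{-1, 1::real}" 1]]) (auto simp: spins_def)

lemma spins_mono: "\<Lambda> \<subseteq> \<Lambda>' \<Longrightarrow> spins \<Lambda> \<subseteq> spins \<Lambda>'"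
  by (auto simp: spins_def)

lemma spins_mult: "\<sigma> \<in> spins \<Lambda> \<Longrightarrow> \<tau> \<in> spins \<Lambda> \<Longrightarrow> (\<lambda>p. \<sigma> p * \<tau> p) \<in> spins \<Lambda>"
  unfolding spins_def mem_Collect_eq by (metis (no_types, lifting) insert_iff mult_1 mult_minus1 minus_minus empty_iff)

lemma spins_square: "\<sigma> \<in> spins \<Lambda> \<Longrightarrow> \<sigma> p * \<sigma> p = 1"
  using spins_cases[of \<sigma> \<Lambda> p] by auto

lemma chi_mult: "chi A (\<lambda>p. \<sigma> p * \<tau> p) = chi A \<sigma> * chi A \<tau>"
  by (simp add: chi_def prod.distrib)

lemma chi_square: "\<sigma> \<in> spins \<Lambda> \<Longrightarrow> chi A \<sigma> * chi A \<sigma> = 1"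
  unfolding chi_mult[symmetric] unfolding chi_def by (intro prod.neutral ballI) (rule spins_square)

lemma chi_cases: "\<sigma> \<in> spins \<Lambda> \<Longrightarrow> chi A \<sigma> = 1 \<or> chi A \<sigma> = -1"
  using chi_square[of \<sigma> \<Lambda> A] square_eq_1_iff by blast

lemma chi_sym_diff:
  assumes "\<sigma> \<in> spins \<Lambda>" "finite A" "finite B"
  shows "chi A \<sigma> * chi B \<sigma> = chi (sym_diff A B) \<sigma>"
proof -
  have A: "chi A \<sigma> = chi (A - B) \<sigma> * chi (A \<inter> B) \<sigma>"
    unfolding chi_def using assms by (subst prod.union_disjoint[symmetric]) (auto intro!: arg_cong2[where f = prod])
  have B: "chi B \<sigma> = chi (B - A) \<sigma> * chi (A \<inter> B) \<sigma>"
    unfolding chi_def using assms by (subst prod.union_disjoint[symmetric]) (auto intro!: arg_cong2[where f = prod])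
  have AB: "chi (sym_diff A B) \<sigma> = chi (A - B) \<sigma> * chi (B - A) \<sigma>"
    unfolding chi_def using assms by (subst prod.union_disjoint[symmetric]) auto
  show ?thesis unfolding A B AB using chi_square[OF assms(1), of "A \<inter> B"] by algebra
qed

text \<open>If A meets the volume, flipping one spin of A pairs off terms of opposite sign;
  otherwise every term is 1.\<close>

lemma sum_chi_nonneg:
  assumes "finite A" "finite \<Lambda>"
  shows "0 \<le> (\<Sum>\<sigma>\<in>spins \<Lambda>. chi A \<sigma>)"
proof (cases "A \<inter> \<Lambda> = {}")
  case True
  then have "chi A \<sigma> = 1" if "\<sigma> \<in> spins \<Lambda>" for \<sigma>
    using that unfolding chi_def by (intro prod.neutral) (auto simp: spins_def)
  then show ?thesis by (simp add: sum_nonneg)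
next
  case False
  then obtain p where p: "p \<in> A" "p \<in> \<Lambda>" by auto
  let ?f = "\<lambda>\<sigma>. \<sigma>(p := - \<sigma> p)"
  have bij: "bij_betw ?f (spins \<Lambda>) (spins \<Lambda>)"
    by (rule bij_betw_byWitness[where f' = ?f]) (use p in \<open>fastforce simp: spins_def\<close>)+
  have flip: "chi A (?f \<sigma>) = - chi A \<sigma>" for \<sigma> :: "'a \<Rightarrow> real"
  proof -
    have "(\<Prod>q\<in>A - {p}. (?f \<sigma>) q) = (\<Prod>q\<in>A - {p}. \<sigma> q)" by (intro prod.cong) auto
    then show ?thesis unfolding chi_def using p assms by (simp add: prod.remove)
  qed
  have "(\<Sum>\<sigma>\<in>spins \<Lambda>. chi A \<sigma>) = (\<Sum>\<sigma>\<in>spins \<Lambda>. chi A (?f \<sigma>))"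
    using bij by (rule sum.reindex_bij_betw[symmetric])
  also have "\<dots> = - (\<Sum>\<sigma>\<in>spins \<Lambda>. chi A \<sigma>)" unfolding flip sum_negf ..
  finally show ?thesis by simp
qed

text \<open>Expanding the product bond by bond leaves characters of symmetric differences with
  nonnegative coefficients. The factors \<open>a e + b e * chi e \<sigma>\<close> are more general
  than Boltzmann factors because the doubled system of the second inequality produces them.\<close>

lemma griffiths_first:
  assumes "finite E" "\<And>e. e \<in> E \<Longrightarrow> finite e" "finite A" "finite \<Lambda>"
    "\<And>e. e \<in> E \<Longrightarrow> 0 \<le> a e" "\<And>e. e \<in> E \<Longrightarrow> 0 \<le> b e"
  shows "0 \<le> (\<Sum>\<sigma>\<in>spins \<Lambda>. chi A \<sigma> * (\<Prod>e\<in>E. a e + b e * chi e \<sigma>))"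
  using assms
proof (induction E arbitrary: A rule: finite_induct)
  case empty
  then show ?case using sum_chi_nonneg by simp
next
  case (insert e E)
  let ?W = "\<lambda>\<sigma>. (\<Prod>e\<in>E. a e + b e * chi e \<sigma>)"
  have 1: "0 \<le> (\<Sum>\<sigma>\<in>spins \<Lambda>. chi A \<sigma> * ?W \<sigma>)" by (rule insert.IH) (use insert.prems in auto)
  have 2: "0 \<le> (\<Sum>\<sigma>\<in>spins \<Lambda>. chi (sym_diff A e) \<sigma> * ?W \<sigma>)" by (rule insert.IH) (use insert.prems in auto)
  have "(\<Sum>\<sigma>\<in>spins \<Lambda>. chi A \<sigma> * (\<Prod>e\<in>insert e E. a e + b e * chi e \<sigma>))
     = (\<Sum>\<sigma>\<in>spins \<Lambda>. a e * (chi A \<sigma> * ?W \<sigma>) + b e * (chi (sym_diff A e) \<sigma> * ?W \<sigma>))"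
  proof (intro sum.cong refl)
    fix \<sigma> :: "'a \<Rightarrow> real" assume "\<sigma> \<in> spins \<Lambda>"
    then have "chi A \<sigma> * chi e \<sigma> = chi (sym_diff A e) \<sigma>" using insert.prems by (intro chi_sym_diff) auto
    then show "chi A \<sigma> * (\<Prod>e\<in>insert e E. a e + b e * chi e \<sigma>)
      = a e * (chi A \<sigma> * ?W \<sigma>) + b e * (chi (sym_diff A e) \<sigma> * ?W \<sigma>)"
      using insert.hyps by (simp flip: \<open>chi A \<sigma> * chi e \<sigma> = _\<close> add: algebra_simps)
  qed
  also have "\<dots> = a e * (\<Sum>\<sigma>\<in>spins \<Lambda>. chi A \<sigma> * ?W \<sigma>) + b e * (\<Sum>\<sigma>\<in>spins \<Lambda>. chi (sym_diff A e) \<sigma> * ?W \<sigma>)"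
    by (simp add: sum.distrib sum_distrib_left)
  also have "0 \<le> \<dots>" using 1 2 insert.prems by auto
  finally show ?case .
qed

text \<open>High-temperature form of the Boltzmann weight: exp (s J) = cosh J (1 + s tanh J) for s =
  1 or s = -1, with t = tanh J. The factors cosh J cancel in \<open>corr\<close>.\<close>

definition weight :: "'v set set \<Rightarrow> ('v set \<Rightarrow> real) \<Rightarrow> ('v \<Rightarrow> real) \<Rightarrow> real" where
  "weight E t \<sigma> = (\<Prod>e\<in>E. 1 + t e * chi e \<sigma>)"

definition isum :: "'v set \<Rightarrow> 'v set set \<Rightarrow> ('v set \<Rightarrow> real) \<Rightarrow> (('v \<Rightarrow> real) \<Rightarrow> real) \<Rightarrow> real" where
  "isum \<Lambda> E t f = (\<Sum>\<sigma>\<in>spins \<Lambda>. f \<sigma> * weight E t \<sigma>)"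

definition corr :: "'v set \<Rightarrow> 'v set set \<Rightarrow> ('v set \<Rightarrow> real) \<Rightarrow> 'v set \<Rightarrow> real" where
  "corr \<Lambda> E t A = isum \<Lambda> E t (chi A) / isum \<Lambda> E t (\<lambda>_. 1)"

text \<open>Duplicate variables: with \<open>\<sigma>' = \<sigma> \<tau>\<close> the factor of a bond in the doubled system is
  \<open>(1 + t\<^sup>2 \<chi>(\<tau>)) + t (1 + \<chi>(\<tau>)) \<chi>(\<sigma>)\<close>, whose coefficients are nonnegative for fixed \<open>\<tau>\<close>.\<close>

lemma griffiths_second:
  assumes "finite E" "\<And>e. e \<in> E \<Longrightarrow> finite e" "finite A" "finite B" "finite \<Lambda>" "is_prob E t"
  shows "isum \<Lambda> E t (chi A) * isum \<Lambda> E t (chi B) \<le> isum \<Lambda> E t (\<lambda>\<sigma>. chi A \<sigma> * chi B \<sigma>) * isum \<Lambda> E t (\<lambda>_. 1)"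
proof -
  let ?S = "spins \<Lambda>"
  \<comment> \<open>Configurations form a group under the pointwise product, so \<tau> = \<sigma>
    \<sigma>' may replace \<sigma>' as summation variable.\<close>
  have bij: "bij_betw (\<lambda>\<tau> p. \<sigma> p * \<tau> p) ?S ?S" if "\<sigma> \<in> ?S" for \<sigma>
    by (rule bij_betw_byWitness[where f' = "\<lambda>\<tau> p. \<sigma> p * \<tau> p"])
      (use that spins_mult spins_square[OF that] in \<open>auto simp flip: mult.assoc\<close>)
  have "isum \<Lambda> E t (\<lambda>\<sigma>. chi A \<sigma> * chi B \<sigma>) * isum \<Lambda> E t (\<lambda>_. 1) - isum \<Lambda> E t (chi A) * isum \<Lambda> E t (chi B)
     = (\<Sum>\<sigma>\<in>?S. \<Sum>\<sigma>'\<in>?S. chi A \<sigma> * (chi B \<sigma> - chi B \<sigma>') * weight E t \<sigma> * weight E t \<sigma>')"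
    unfolding isum_def sum_product sum_subtractf[symmetric] by (intro sum.cong refl) (simp add: algebra_simps)
  also have "\<dots> = (\<Sum>\<sigma>\<in>?S. \<Sum>\<tau>\<in>?S. chi A \<sigma> * (chi B \<sigma> - chi B (\<lambda>p. \<sigma> p * \<tau> p)) * weight E t \<sigma> * weight E t (\<lambda>p. \<sigma> p * \<tau> p))"
    by (intro sum.cong refl sum.reindex_bij_betw[symmetric] bij)
  also have "\<dots> = (\<Sum>\<sigma>\<in>?S. \<Sum>\<tau>\<in>?S. (1 - chi B \<tau>) * (chi (sym_diff A B) \<sigma> *
      (\<Prod>e\<in>E. (1 + (t e)\<^sup>2 * chi e \<tau>) + t e * (1 + chi e \<tau>) * chi e \<sigma>)))"
  proof (intro sum.cong refl)
    fix \<sigma> \<tau> assume *: "\<sigma> \<in> ?S" "\<tau> \<in> ?S"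
    have "(1 + t e * chi e \<sigma>) * (1 + t e * (chi e \<sigma> * chi e \<tau>))
       = (1 + (t e)\<^sup>2 * chi e \<tau>) + t e * (1 + chi e \<tau>) * chi e \<sigma>" for e
      using chi_square[OF *(1), of e] unfolding power2_eq_square by algebra
    then have "weight E t \<sigma> * weight E t (\<lambda>p. \<sigma> p * \<tau> p) = (\<Prod>e\<in>E. (1 + (t e)\<^sup>2 * chi e \<tau>) + t e * (1 + chi e \<tau>) * chi e \<sigma>)"
      unfolding weight_def prod.distrib[symmetric] chi_mult by simp
    moreover have "chi A \<sigma> * chi B \<sigma> = chi (sym_diff A B) \<sigma>" using * assms by (intro chi_sym_diff) auto
    ultimately have W: "weight E t \<sigma> * weight E t (\<lambda>p. \<sigma> p * \<tau> p) = (\<Prod>e\<in>E. (1 + (t e)\<^sup>2 * chi e \<tau>) + t e * (1 + chi e \<tau>) * chi e \<sigma>)"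
      and AB: "chi (sym_diff A B) \<sigma> = chi A \<sigma> * chi B \<sigma>" by simp_all
    show "chi A \<sigma> * (chi B \<sigma> - chi B (\<lambda>p. \<sigma> p * \<tau> p)) * weight E t \<sigma> * weight E t (\<lambda>p. \<sigma> p * \<tau> p)
      = (1 - chi B \<tau>) * (chi (sym_diff A B) \<sigma> *
      (\<Prod>e\<in>E. (1 + (t e)\<^sup>2 * chi e \<tau>) + t e * (1 + chi e \<tau>) * chi e \<sigma>))"
      unfolding W[symmetric] AB chi_mult by (simp add: algebra_simps)
  qed
  also have "\<dots> = (\<Sum>\<tau>\<in>?S. (1 - chi B \<tau>) * (\<Sum>\<sigma>\<in>?S. chi (sym_diff A B) \<sigma> *
      (\<Prod>e\<in>E. (1 + (t e)\<^sup>2 * chi e \<tau>) + t e * (1 + chi e \<tau>) * chi e \<sigma>)))"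
    unfolding sum_distrib_left by (rule sum.swap)
  also have "0 \<le> \<dots>"
  proof (rule sum_nonneg, rule mult_nonneg_nonneg)
    fix \<tau> assume \<tau>: "\<tau> \<in> ?S"
    have c: "chi X \<tau> = 1 \<or> chi X \<tau> = -1" for X using chi_cases[OF \<tau>] .
    show "0 \<le> 1 - chi B \<tau>" using c[of B] by auto
    have "0 \<le> 1 + (t e)\<^sup>2 * chi e \<tau>" "0 \<le> t e * (1 + chi e \<tau>)" if "e \<in> E" for e
    proof -
      have t: "0 \<le> t e" "t e \<le> 1" using that assms by (auto simp: is_prob_def)
      then have "(t e)\<^sup>2 \<le> 1" by (simp add: power_le_one)
      then show "0 \<le> 1 + (t e)\<^sup>2 * chi e \<tau>" using c[of e] by auto
      show "0 \<le> t e * (1 + chi e \<tau>)" using t c[of e] by auto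
    qed
    then show "0 \<le> (\<Sum>\<sigma>\<in>?S. chi (sym_diff A B) \<sigma> *
      (\<Prod>e\<in>E. (1 + (t e)\<^sup>2 * chi e \<tau>) + t e * (1 + chi e \<tau>) * chi e \<sigma>))"
      using assms by (intro griffiths_first) auto
  qed
  finally show ?thesis by simp
qed

lemma weight_nonneg:
  assumes "is_prob E t" "\<sigma> \<in> spins \<Lambda>" shows "0 \<le> weight E t \<sigma>"
  unfolding weight_def
proof (rule prod_nonneg)
  fix e assume "e \<in> E"
  with assms show "0 \<le> 1 + t e * chi e \<sigma>" using chi_cases[OF assms(2), of e] by (auto simp: is_prob_def)
qed

lemma isum_one_pos:
  assumes "finite \<Lambda>" "is_prob E t" "finite E"
  shows "0 < isum \<Lambda> E t (\<lambda>_. 1)"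
proof -
  have "0 < weight E t (\<lambda>_. 1)" unfolding weight_def chi_def
    using assms by (intro prod_pos) (auto simp: is_prob_def add_pos_nonneg)
  then show ?thesis unfolding isum_def
    using assms weight_nonneg[OF assms(2)] by (intro sum_pos2[where i = "\<lambda>_. 1"]) auto
qed

section \<open>Correlations as functions of single bond strengths\<close>

lemma isum_insert:
  assumes "finite E" "e \<notin> E"
  shows "isum \<Lambda> (insert e E) t f = isum \<Lambda> E t f + t e * isum \<Lambda> E t (\<lambda>\<sigma>. f \<sigma> * chi e \<sigma>)"
  using assms unfolding isum_def weight_def
  by (simp add: sum.distrib[symmetric] sum_distrib_left algebra_simps)

lemma weight_cong: "(\<And>e. e \<in> E \<Longrightarrow> t e = t' e) \<Longrightarrow> weight E t = weight E t'"
  unfolding weight_def by (intro ext prod.cong) auto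

lemma corr_cong: "(\<And>e. e \<in> E \<Longrightarrow> t e = t' e) \<Longrightarrow> corr \<Lambda> E t A = corr \<Lambda> E t' A"
  unfolding corr_def isum_def by (simp cong: weight_cong)

text \<open>The derivative of the quotient in t has the sign of b Z - a c, which the second
  Griffiths inequality makes nonnegative.\<close>

lemma frac_mono:
  fixes a b c Z t t' :: real
  assumes "a * c \<le> b * Z" "t \<le> t'" "0 < Z + t * c" "0 < Z + t' * c"
  shows "(a + t * b) / (Z + t * c) \<le> (a + t' * b) / (Z + t' * c)"
proof -
  have "0 \<le> (t' - t) * (b * Z - a * c)" using assms by simp
  then have "(a + t * b) * (Z + t' * c) \<le> (a + t' * b) * (Z + t * c)" by (simp add: algebra_simps)
  then show ?thesis using assms by (simp add: divide_simps mult.commute)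
qed

text \<open>The graph lies above its chord on [0, 1]: the increments from 0 to t and from 0 to 1
  have the numerators t d and d with d = b Z - a c, and c \<ge> 0 makes the denominator at t at most
  the one at 1.\<close>

lemma frac_concave:
  fixes a b c Z t :: real
  assumes "a * c \<le> b * Z" "0 \<le> t" "t \<le> 1" "0 < Z" "0 \<le> c"
  shows "(1 - t) * (a / Z) + t * ((a + b) / (Z + c)) \<le> (a + t * b) / (Z + t * c)"
proof -
  define d where "d = b * Z - a * c"
  have d: "0 \<le> d" using assms by (simp add: d_def)
  have p: "0 < Z + c" "0 < Z + t * c" using assms by (auto simp: add_pos_nonneg)
  have "(a + b) / (Z + c) - a / Z = d / (Z * (Z + c))"
    unfolding d_def using p assms(4) by (simp add: divide_simps) (simp add: algebra_simps)
  moreover have "(a + t * b) / (Z + t * c) - a / Z = t * d / (Z * (Z + t * c))"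
    unfolding d_def using p assms(4) by (simp add: divide_simps) (simp add: algebra_simps)
  moreover have "t * (d / (Z * (Z + c))) \<le> t * d / (Z * (Z + t * c))"
  proof -
    have "t * c \<le> c" using assms by (simp add: mult_left_le_one_le)
    then have "t * d / (Z * (Z + c)) \<le> t * d / (Z * (Z + t * c))"
      using d assms p by (intro divide_left_mono) auto
    then show ?thesis by simp
  qed
  moreover have "(1 - t) * (a / Z) + t * ((a + b) / (Z + c)) = a / Z + t * ((a + b) / (Z + c) - a / Z)"
    by algebra
  ultimately show ?thesis by simp
qed

locale ferromagnet =
  fixes \<Lambda> :: "'v set" and E :: "'v set set"
  assumes fin_vol: "finite \<Lambda>" and fin_edges: "finite E" and fin_edge: "\<And>e. e \<in> E \<Longrightarrow> finite e"
begin

text \<open>A correlation is a Moebius function of one bond strength, because the weight is affine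
  in it. In the proof a, b, Z, c are the unnormalized sums of chi A, chi A chi e, 1 and chi e in the
  system without e, and the three inequalities are the second Griffiths inequality, positivity of
  the partition sum and the first Griffiths inequality.\<close>

lemma corr_split:
  assumes "e \<in> E" "finite A" "is_prob E t"
  obtains a b c Z where "a * c \<le> b * Z" "0 < Z" "0 \<le> c"
    "\<And>x. corr \<Lambda> E (t(e := x)) A = (a + x * b) / (Z + x * c)"
proof -
  let ?E = "E - {e}"
  have fin: "finite ?E" "\<And>e. e \<in> ?E \<Longrightarrow> finite e" "is_prob ?E t" "finite e"
    using fin_edges fin_edge assms by (auto simp: is_prob_def)
  have E: "E = insert e ?E" using assms by auto
  have eq: "isum \<Lambda> E (t(e := x)) f = isum \<Lambda> ?E t f + x * isum \<Lambda> ?E t (\<lambda>\<sigma>. f \<sigma> * chi e \<sigma>)" for x f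
  proof -
    have "weight ?E (t(e := x)) = weight ?E t" by (rule weight_cong) auto
    then have "isum \<Lambda> ?E (t(e := x)) = isum \<Lambda> ?E t" unfolding isum_def by auto
    then show ?thesis by (subst E, subst isum_insert) (use fin in auto)
  qed
  show ?thesis
  proof
    show "isum \<Lambda> ?E t (chi A) * isum \<Lambda> ?E t (chi e) \<le> isum \<Lambda> ?E t (\<lambda>\<sigma>. chi A \<sigma> * chi e \<sigma>) * isum \<Lambda> ?E t (\<lambda>_. 1)"
      using fin fin_vol assms by (intro griffiths_second) auto
    show "0 < isum \<Lambda> ?E t (\<lambda>_. 1)" using fin fin_vol by (intro isum_one_pos) auto
    show "0 \<le> isum \<Lambda> ?E t (chi e)"
      unfolding isum_def weight_def using fin fin_vol by (intro griffiths_first) (auto simp: is_prob_def)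
    show "corr \<Lambda> E (t(e := x)) A = (isum \<Lambda> ?E t (chi A) + x * isum \<Lambda> ?E t (\<lambda>\<sigma>. chi A \<sigma> * chi e \<sigma>)) /
       (isum \<Lambda> ?E t (\<lambda>_. 1) + x * isum \<Lambda> ?E t (chi e))" for x
      unfolding corr_def eq by simp
  qed
qed

text \<open>The strengths are changed one bond at a time, which reduces to \<open>frac_mono\<close>;
  F is the set of bonds already changed.\<close>

lemma corr_mono:
  assumes "finite A" "is_prob E t" "is_prob E t'" "\<And>e. e \<in> E \<Longrightarrow> t e \<le> t' e"
  shows "corr \<Lambda> E t A \<le> corr \<Lambda> E t' A"
proof -
  have "corr \<Lambda> E t A \<le> corr \<Lambda> E (\<lambda>e. if e \<in> F then t' e else t e) A" if "finite F" "F \<subseteq> E" for F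
    using that
  proof (induction F rule: finite_induct)
    case (insert e F)
    define s where "s = (\<lambda>e. if e \<in> F then t' e else t e)"
    have s: "is_prob E s" "s = s(e := t e)" "(\<lambda>e'. if e' \<in> insert e F then t' e' else t e') = s(e := t' e)"
      using assms insert.hyps by (auto simp: s_def is_prob_def fun_eq_iff)
    have eE: "e \<in> E" using insert.prems by auto
    obtain a b c Z where *: "a * c \<le> b * Z" "0 < Z" "0 \<le> c"
      "\<And>x. corr \<Lambda> E (s(e := x)) A = (a + x * b) / (Z + x * c)"
      using corr_split[OF eE assms(1) s(1)] by metis
    have te: "0 \<le> t e" "t e \<le> t' e" "0 \<le> t' e" using assms eE by (auto simp: is_prob_def)
    have "corr \<Lambda> E t A \<le> corr \<Lambda> E s A" using insert by (simp add: s_def)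
    also have "\<dots> = corr \<Lambda> E (s(e := t e)) A" using s(2) by simp
    also have "\<dots> \<le> corr \<Lambda> E (s(e := t' e)) A"
      unfolding *(4) using * te by (intro frac_mono) (auto simp: add_pos_nonneg)
    finally show ?case unfolding s(3) .
  qed simp
  from this[OF fin_edges order_refl] show ?thesis using corr_cong[of E "\<lambda>e. if e \<in> E then t' e else t e" t'] by simp
qed

text \<open>By concavity in each strength separately, the value at \<open>t e\<close> is at least
  the average of the values at 0 and 1 with weights \<open>1 - t e\<close> and \<open>t e\<close>.
  Repeating this over F turns the averages into a Bernoulli expectation.\<close>

lemma corr_ge_bern_ex:
  assumes "finite A" "is_prob E t" "F \<subseteq> E"
  shows "bern_ex F t (\<lambda>\<omega>. corr \<Lambda> E (\<lambda>e. if e \<in> F then of_bool (e \<in> \<omega>) else t e) A) \<le> corr \<Lambda> E t A"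
proof -
  have "finite F" using assms fin_edges finite_subset by auto
  then show ?thesis using assms(2,3)
  proof (induction F arbitrary: t rule: finite_induct)
    case (insert e F)
    have eE: "e \<in> E" using insert.prems by auto
    obtain a b c Z where *: "a * c \<le> b * Z" "0 < Z" "0 \<le> c"
      "\<And>x. corr \<Lambda> E (t(e := x)) A = (a + x * b) / (Z + x * c)"
      using corr_split[OF eE assms(1) insert.prems(1)] by metis
    have te: "0 \<le> t e" "t e \<le> 1" using insert.prems by (auto simp: is_prob_def)
    have pr: "is_prob E (t(e := 0))" "is_prob E (t(e := 1))" using insert.prems by (auto simp: is_prob_def)
    have IH: "bern_ex F t (\<lambda>\<omega>. corr \<Lambda> E (\<lambda>e'. if e' \<in> F then of_bool (e' \<in> \<omega>) else (t(e := x)) e') A) \<le> corr \<Lambda> E (t(e := x)) A"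
      if "is_prob E (t(e := x))" for x
    proof -
      have "bern_ex F (t(e := x)) = bern_ex F t"
        by (intro ext bern_ex_cong) (use insert.hyps in auto)
      with insert.IH[OF that] insert.prems show ?thesis by (simp del: fun_upd_apply)
    qed
    have 1: "bern_ex F t (\<lambda>\<omega>. corr \<Lambda> E (\<lambda>e'. if e' \<in> insert e F then of_bool (e' \<in> insert e \<omega>) else t e') A) \<le> corr \<Lambda> E (t(e := 1)) A"
      using insert.hyps by (intro order.trans[OF _ IH[OF pr(2)]] eq_refl bern_ex_cong refl corr_cong) auto
    have 0: "bern_ex F t (\<lambda>\<omega>. corr \<Lambda> E (\<lambda>e'. if e' \<in> insert e F then of_bool (e' \<in> \<omega>) else t e') A) \<le> corr \<Lambda> E (t(e := 0)) A"
      using insert.hyps by (intro order.trans[OF _ IH[OF pr(1)]] eq_refl bern_ex_cong refl corr_cong) auto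
    have "bern_ex (insert e F) t (\<lambda>\<omega>. corr \<Lambda> E (\<lambda>e'. if e' \<in> insert e F then of_bool (e' \<in> \<omega>) else t e') A)
      \<le> t e * corr \<Lambda> E (t(e := 1)) A + (1 - t e) * corr \<Lambda> E (t(e := 0)) A"
      unfolding bern_ex_insert[OF insert.hyps] using 0 1 te by (intro add_mono mult_left_mono) auto
    also have "\<dots> = (1 - t e) * (a / Z) + t e * ((a + b) / (Z + c))" unfolding *(4) by simp
    also have "\<dots> \<le> (a + t e * b) / (Z + t e * c)" using * te by (intro frac_concave) auto
    also have "\<dots> = corr \<Lambda> E t A" unfolding *(4)[symmetric] by simp
    finally show ?case .
  qed simp
qed

lemma corr_nonneg:
  assumes "finite A" "is_prob E t" shows "0 \<le> corr \<Lambda> E t A"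
  unfolding corr_def
proof (rule divide_nonneg_pos)
  show "0 \<le> isum \<Lambda> E t (chi A)" unfolding isum_def weight_def
    using assms fin_vol fin_edges fin_edge by (intro griffiths_first) (auto simp: is_prob_def)
qed (use isum_one_pos fin_vol fin_edges assms in blast)

text \<open>At coupling 0 or \<open>\<infinity>\<close> on each bond, the measure is uniform on the configurations that
  satisfy all open bonds.\<close>

lemma corr_ge_percolation:
  assumes "finite A" "is_prob E t"
  shows "bern_ex E t (\<lambda>\<omega>. of_bool (\<forall>\<sigma>\<in>spins \<Lambda>. (\<forall>e\<in>\<omega>. chi e \<sigma> = 1) \<longrightarrow> chi A \<sigma> = 1)) \<le> corr \<Lambda> E t A"
proof (rule order.trans[OF _ corr_ge_bern_ex[OF assms order_refl]], rule bern_ex_mono)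
  fix \<omega> assume \<omega>: "\<omega> \<subseteq> E"
  let ?t = "\<lambda>e. if e \<in> E then of_bool (e \<in> \<omega>) else t e"
  have pr: "is_prob E ?t" by (simp add: is_prob_def)
  show "of_bool (\<forall>\<sigma>\<in>spins \<Lambda>. (\<forall>e\<in>\<omega>. chi e \<sigma> = 1) \<longrightarrow> chi A \<sigma> = 1) \<le> corr \<Lambda> E ?t A"
  proof (cases "\<forall>\<sigma>\<in>spins \<Lambda>. (\<forall>e\<in>\<omega>. chi e \<sigma> = 1) \<longrightarrow> chi A \<sigma> = 1")
    case True
    have "chi A \<sigma> * weight E ?t \<sigma> = 1 * weight E ?t \<sigma>" if \<sigma>: "\<sigma> \<in> spins \<Lambda>" for \<sigma>
    proof (cases "\<forall>e\<in>\<omega>. chi e \<sigma> = 1")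
      case False
      then obtain e where e: "e \<in> \<omega>" "chi e \<sigma> = -1" using chi_cases[OF \<sigma>] by blast
      \<comment> \<open>An open bond that \<sigma> violates contributes the factor 1 - 1 =
        0.\<close>
      then have "weight E ?t \<sigma> = 0" unfolding weight_def using \<omega> fin_edges by (intro prod_zero bexI[of _ e]) auto
      then show ?thesis by simp
    qed (use True \<sigma> in simp)
    then have "isum \<Lambda> E ?t (chi A) = isum \<Lambda> E ?t (\<lambda>_. 1)" unfolding isum_def by (intro sum.cong) auto
    then have "corr \<Lambda> E ?t A = 1" unfolding corr_def using isum_one_pos[OF fin_vol pr fin_edges] by simp
    then show ?thesis by simp
  next
    \<comment> \<open>The indicator vanishes here, so the first Griffiths inequality is
      enough.\<close>
    case False
    then have "of_bool (\<forall>\<sigma>\<in>spins \<Lambda>. (\<forall>e\<in>\<omega>. chi e \<sigma> = 1) \<longrightarrow> chi A \<sigma> = 1) = (0::real)" by (simp only: of_bool_eq)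
    then show ?thesis using corr_nonneg[OF assms(1) pr] by linarith
  qed
qed (use assms in auto)

end

text \<open>An additional bond either joins frozen plus spins or has strength 0. In both cases it
  contributes the constant 1 + t e, which cancels in the quotient.\<close>

lemma corr_irrelevant_bonds:
  assumes "finite \<Lambda>" "finite E'" "E \<subseteq> E'" "is_prob E' t"
    and "\<And>e. e \<in> E' - E \<Longrightarrow> e \<inter> \<Lambda> = {} \<or> t e = 0"
  shows "corr \<Lambda> E' t A = corr \<Lambda> E t A"
proof -
  define C where "C = (\<Prod>e\<in>E' - E. 1 + t e)"
  have w: "weight E' t \<sigma> = C * weight E t \<sigma>" if in_spins: "\<sigma> \<in> spins \<Lambda>" for \<sigma>
  proof -
    have "weight E' t \<sigma> = (\<Prod>e\<in>E' - E. 1 + t e * chi e \<sigma>) * weight E t \<sigma>"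
      unfolding weight_def using assms by (subst prod.subset_diff) auto
    also have "(\<Prod>e\<in>E' - E. 1 + t e * chi e \<sigma>) = C" unfolding C_def
    proof (intro prod.cong refl)
      fix e assume e: "e \<in> E' - E"
      have "chi e \<sigma> = 1" if "e \<inter> \<Lambda> = {}"
        unfolding chi_def using in_spins that by (intro prod.neutral) (auto simp: spins_def)
      then show "1 + t e * chi e \<sigma> = 1 + t e" using assms(5)[OF e] by auto
    qed
    finally show ?thesis .
  qed
  have "0 < C" unfolding C_def using assms by (intro prod_pos) (auto simp: is_prob_def add_pos_nonneg)
  have "isum \<Lambda> E' t f = C * isum \<Lambda> E t f" for f
    unfolding isum_def sum_distrib_left by (intro sum.cong refl) (auto simp: w)
  then show ?thesis unfolding corr_def using \<open>0 < C\<close> by simp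
qed

text \<open>Passing to the smaller volume freezes the spins of \<open>\<Lambda>' - \<Lambda>\<close>
  at plus. This is an infinite field, encoded by singleton bonds whose strength is raised from 0 to
  1, so \<open>corr_mono\<close> applies. Bonds of size two cannot coincide with these
  singletons.\<close>

lemma corr_antimono_volume:
  assumes fin: "finite \<Lambda>'" "\<Lambda> \<subseteq> \<Lambda>'" "finite E" "\<And>e. e \<in> E \<Longrightarrow> finite e \<and> card e = 2"
    and "is_prob E t" "finite A"
  shows "corr \<Lambda>' E t A \<le> corr \<Lambda> E t A"
proof -
  define S where "S = (\<lambda>p. {p}) ` (\<Lambda>' - \<Lambda>)"
  define t0 where "t0 = (\<lambda>e. if e \<in> S then 0 else t e)"
  define t1 where "t1 = (\<lambda>e. if e \<in> S then 1 else t e)"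
  have S: "finite S" "E \<inter> S = {}" using assms by (force simp: S_def)+
  interpret ferromagnet \<Lambda>' "E \<union> S" by unfold_locales (use assms S in \<open>auto simp: S_def\<close>)
  have w0: "weight (E \<union> S) t0 = weight E t"
    unfolding weight_def using S fin by (intro ext, subst prod.union_disjoint) (auto simp: t0_def intro!: prod.cong)
  \<comment> \<open>Each frozen spin contributes the factor 1 + 1 = 2.\<close>
  define K where "K = (2::real) ^ card (\<Lambda>' - \<Lambda>)"
  have w1: "weight (E \<union> S) t1 \<sigma> = (if \<sigma> \<in> spins \<Lambda> then K * weight E t \<sigma> else 0)" if in_spins: "\<sigma> \<in> spins \<Lambda>'" for \<sigma>
  proof -
    have "weight (E \<union> S) t1 \<sigma> = weight E t \<sigma> * (\<Prod>e\<in>S. 1 + chi e \<sigma>)"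
      unfolding weight_def using S fin by (subst prod.union_disjoint) (auto simp: t1_def intro!: prod.cong arg_cong2[where f="(*)"])
    also have "(\<Prod>e\<in>S. 1 + chi e \<sigma>) = (\<Prod>p\<in>\<Lambda>' - \<Lambda>. 1 + \<sigma> p)"
      unfolding S_def by (subst prod.reindex) (auto simp: chi_def inj_on_def)
    also have "\<dots> = (if \<sigma> \<in> spins \<Lambda> then K else 0)"
    proof (cases "\<sigma> \<in> spins \<Lambda>")
      case True
      then have "\<And>p. p \<in> \<Lambda>' - \<Lambda> \<Longrightarrow> 1 + \<sigma> p = 2" by (auto simp: spins_def)
      then show ?thesis using True by (simp add: K_def)
    next
      case False
      then obtain p where "p \<notin> \<Lambda>" "\<sigma> p \<noteq> 1" using in_spins False unfolding spins_def by blast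
      then have "p \<in> \<Lambda>' - \<Lambda>" "1 + \<sigma> p = 0" using in_spins spins_cases[OF in_spins, of p] by (auto simp: spins_def)
      then have "(\<Prod>p\<in>\<Lambda>' - \<Lambda>. 1 + \<sigma> p) = 0" using fin by (intro prod_zero bexI[of _ p]) auto
      then show ?thesis using False by simp
    qed
    finally show ?thesis by simp
  qed
  have i1: "isum \<Lambda>' (E \<union> S) t1 f = K * isum \<Lambda> E t f" for f
  proof -
    have "isum \<Lambda>' (E \<union> S) t1 f = (\<Sum>\<sigma>\<in>spins \<Lambda>'. if \<sigma> \<in> spins \<Lambda> then K * (f \<sigma> * weight E t \<sigma>) else 0)"
      unfolding isum_def by (intro sum.cong refl) (auto simp: w1)
    also have "\<dots> = (\<Sum>\<sigma>\<in>spins \<Lambda>. K * (f \<sigma> * weight E t \<sigma>))"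
      using fin spins_mono[OF fin(2)] by (subst sum.inter_restrict[symmetric]) (auto simp: Int_absorb1)
    finally show ?thesis by (simp add: isum_def sum_distrib_left)
  qed
  have "corr \<Lambda>' E t A = corr \<Lambda>' (E \<union> S) t0 A" unfolding corr_def isum_def w0 ..
  also have "\<dots> \<le> corr \<Lambda>' (E \<union> S) t1 A"
    using assms by (intro corr_mono) (auto simp: t0_def t1_def is_prob_def)
  also have "\<dots> = corr \<Lambda> E t A" unfolding corr_def i1 by (simp add: K_def)
  finally show ?thesis .
qed

subsection \<open>Hierarchical site percolation on the square lattice\<close>

type_synonym site = "int \<times> int"

definition grid3 :: "site set" where
  "grid3 = {0..2} \<times> {0..2}"

definition child :: "site \<Rightarrow> site \<Rightarrow> site" where
  "child z d = (3 * fst z + fst d, 3 * snd z + snd d)"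

text \<open>One bad child out of nine is tolerated. A bad box therefore needs two bad children in
  disjoint sub-boxes, which roughly squares the failure probability from level to level.\<close>

fun goodbox :: "nat \<Rightarrow> site \<Rightarrow> site set \<Rightarrow> bool" where
  "goodbox 0 z Z \<longleftrightarrow> z \<in> Z"
| "goodbox (Suc n) z Z \<longleftrightarrow> (\<exists>d0\<in>grid3. \<forall>d\<in>grid3 - {d0}. goodbox n (child z d) Z)"

text \<open>Meant for good boxes. All good children enter, also the exceptional one if it happens to
  be good; this is how the corner site can be kept in the core.\<close>

fun core :: "nat \<Rightarrow> site \<Rightarrow> site set \<Rightarrow> site set" where
  "core 0 z Z = {z}"
| "core (Suc n) z Z = (\<Union>d\<in>{d\<in>grid3. goodbox n (child z d) Z}. core n (child z d) Z)"

definition boxsites :: "nat \<Rightarrow> site \<Rightarrow> site set" where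
  "boxsites n z = {w. fst w div 3 ^ n = fst z \<and> snd w div 3 ^ n = snd z}"

lemma boxsites_0 [simp]: "boxsites 0 z = {z}"
  by (auto simp: boxsites_def prod_eq_iff)

lemma child_div: "d \<in> grid3 \<Longrightarrow> fst (child z d) div 3 = fst z \<and> snd (child z d) div 3 = snd z"
  by (auto simp: grid3_def child_def)

lemma child_inj: "d \<in> grid3 \<Longrightarrow> d' \<in> grid3 \<Longrightarrow> child z d = child z' d' \<Longrightarrow> d = d' \<and> z = z'"
  unfolding grid3_def child_def by (auto simp: prod_eq_iff) presburger+

lemma boxsites_child:
  assumes "d \<in> grid3" shows "boxsites n (child z d) \<subseteq> boxsites (Suc n) z"
proof
  fix w assume "w \<in> boxsites n (child z d)"
  then have "fst w div 3 ^ n div 3 = fst z" "snd w div 3 ^ n div 3 = snd z"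
    using child_div[OF assms, of z] by (auto simp: boxsites_def)
  then show "w \<in> boxsites (Suc n) z"
    by (simp add: boxsites_def zdiv_zmult2_eq[symmetric] mult.commute)
qed

lemma boxsites_disjoint: "z \<noteq> z' \<Longrightarrow> boxsites n z \<inter> boxsites n z' = {}"
  by (auto simp: boxsites_def prod_eq_iff)

lemma finite_boxsites [simp]: "finite (boxsites n z)"
proof (rule finite_subset)
  show "boxsites n z \<subseteq> {3 ^ n * fst z .. 3 ^ n * fst z + 3 ^ n} \<times> {3 ^ n * snd z .. 3 ^ n * snd z + 3 ^ n}"
  proof
    fix w assume "w \<in> boxsites n z"
    then have *: "fst w div 3 ^ n = fst z" "snd w div 3 ^ n = snd z" by (auto simp: boxsites_def)
    have "fst w = 3 ^ n * fst z + fst w mod 3 ^ n" "snd w = 3 ^ n * snd z + snd w mod 3 ^ n"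
      unfolding *[symmetric] by simp_all
    moreover have "0 \<le> a mod 3 ^ n" "a mod 3 ^ n \<le> 3 ^ n" for a :: int
      by (simp_all add: less_imp_le)
    ultimately show "w \<in> {3 ^ n * fst z .. 3 ^ n * fst z + 3 ^ n} \<times> {3 ^ n * snd z .. 3 ^ n * snd z + 3 ^ n}"
      by (cases w) (smt (verit) atLeastAtMost_iff fst_conv snd_conv mem_Sigma_iff)
  qed
qed simp

text \<open>Locality: distinct boxes of one level depend on disjoint sets of sites, hence are
  independent.\<close>

lemma goodbox_local: "goodbox n z (Z \<inter> boxsites n z) = goodbox n z Z"
proof (induction n arbitrary: z Z)
  case (Suc n)
  have "goodbox n (child z d) (Z \<inter> boxsites (Suc n) z) = goodbox n (child z d) Z" if "d \<in> grid3" for d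
  proof -
    have "Z \<inter> boxsites (Suc n) z \<inter> boxsites n (child z d) = Z \<inter> boxsites n (child z d)"
      using boxsites_child[OF that, of n z] by auto
    then show ?thesis using Suc.IH[of "child z d" "Z \<inter> boxsites (Suc n) z"] Suc.IH[of "child z d" Z] by simp
  qed
  then show ?case by auto
qed simp

lemma core_subset: "goodbox n z Z \<Longrightarrow> core n z Z \<subseteq> Z \<inter> boxsites n z"
proof (induction n arbitrary: z)
  case (Suc n)
  show ?case
  proof
    fix u assume "u \<in> core (Suc n) z Z"
    then obtain d where "d \<in> grid3" "goodbox n (child z d) Z" "u \<in> core n (child z d) Z" by auto
    then show "u \<in> Z \<inter> boxsites (Suc n) z" using Suc.IH[of "child z d"] boxsites_child[of d n z] by auto
  qed
qed simp

lemma finite_grid3 [simp]: "finite grid3" and card_grid3: "card grid3 = 9"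
  by (simp_all add: grid3_def card_cartesian_product)

text \<open>Eight good children have disjoint cores, so the size grows at least by the factor 8 per
  level.\<close>

lemma card_core: "goodbox n z Z \<Longrightarrow> 8 ^ n \<le> card (core n z Z)"
proof (induction n arbitrary: z)
  case (Suc n)
  then obtain d0 where d0: "d0 \<in> grid3" "\<forall>d\<in>grid3 - {d0}. goodbox n (child z d) Z" by auto
  have fin: "finite (core n (child z d) Z)" if "goodbox n (child z d) Z" for d
    using core_subset[OF that] finite_boxsites finite_subset by (meson le_inf_iff)
  have "(8::nat) ^ Suc n = (\<Sum>d\<in>grid3 - {d0}. 8 ^ n)" using d0 by (simp add: card_grid3)
  also have "\<dots> \<le> (\<Sum>d\<in>grid3 - {d0}. card (core n (child z d) Z))"
    using Suc.IH d0 by (intro sum_mono) auto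
  also have "\<dots> = card (\<Union>d\<in>grid3 - {d0}. core n (child z d) Z)"
  proof (rule card_UN_disjoint[symmetric])
    show "\<forall>d\<in>grid3 - {d0}. \<forall>d'\<in>grid3 - {d0}. d \<noteq> d' \<longrightarrow> core n (child z d) Z \<inter> core n (child z d') Z = {}"
    proof (intro ballI impI)
      fix d d' assume *: "d \<in> grid3 - {d0}" "d' \<in> grid3 - {d0}" "d \<noteq> d'"
      then have "child z d \<noteq> child z d'" using child_inj by blast
      with boxsites_disjoint[OF this, of n] core_subset[of n "child z d" Z] core_subset[of n "child z d'" Z] d0(2) *
      show "core n (child z d) Z \<inter> core n (child z d') Z = {}" by blast
    qed
  qed (use d0 fin in auto)
  also have "\<dots> \<le> card (core (Suc n) z Z)"
  proof (rule card_mono)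
    show "finite (core (Suc n) z Z)" using fin by auto
  qed (use d0 in auto)
  finally show ?case .
qed simp

lemma grid3_eq: "grid3 = {(0,0),(0,1),(0,2),(1,0),(1,1),(1,2),(2,0),(2,1),(2,2)}"
proof -
  have "{0..2::int} = {0,1,2}" by auto
  then show ?thesis by (simp add: grid3_def insert_commute)
qed

text \<open>A 3 x 3 grid stays connected after the removal of one cell, phrased for a labelling that
  agrees on adjacent cells. Choose a row r and a column k that avoid d0. Every cell other than d0
  lies in a row or a column that avoids d0, and so carries the label of (k, r).\<close>

lemma grid3_connected:
  assumes "d0 \<in> grid3" "\<And>d. d \<in> grid3 \<Longrightarrow> d \<noteq> d0 \<Longrightarrow> g d"
    and h: "\<And>i j. g (i, j) \<Longrightarrow> g (i + 1, j) \<Longrightarrow> (i, j) \<in> grid3 \<Longrightarrow> (i + 1, j) \<in> grid3 \<Longrightarrow> f (i, j) = f (i + 1, j)"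
    and v: "\<And>i j. g (i, j) \<Longrightarrow> g (i, j + 1) \<Longrightarrow> (i, j) \<in> grid3 \<Longrightarrow> (i, j + 1) \<in> grid3 \<Longrightarrow> f (i, j) = f (i, j + 1)"
    and "d \<in> grid3" "d' \<in> grid3" "g d" "g d'"
  shows "f d = (f d' :: 'b)"
proof -
  have H: "g (0,j) \<Longrightarrow> g (1,j) \<Longrightarrow> f (0,j) = f (1,j)" "g (1,j) \<Longrightarrow> g (2,j) \<Longrightarrow> f (1,j) = f (2,j)"
     if "j \<in> {0,1,2}" for j using h[of 0 j] h[of 1 j] that by (auto simp: grid3_eq)
  have V: "g (j,0) \<Longrightarrow> g (j,1) \<Longrightarrow> f (j,0) = f (j,1)" "g (j,1) \<Longrightarrow> g (j,2) \<Longrightarrow> f (j,1) = f (j,2)"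
     if "j \<in> {0,1,2}" for j using v[of j 0] v[of j 1] that by (auto simp: grid3_eq)
  have G: "g (i, j)" if "(i, j) \<noteq> d0" "i \<in> {0,1,2}" "j \<in> {0,1,2}" for i j
    using assms(2)[of "(i, j)"] that by (auto simp: grid3_eq)
  have row: "f (i, j) = f (i', j)" if j: "j \<in> {0,1,2}" "j \<noteq> snd d0" and i: "i \<in> {0,1,2}" "i' \<in> {0,1,2}" for i i' j
  proof -
    have "(x, j) \<noteq> d0" for x using j by auto
    then have "g (0, j)" "g (1, j)" "g (2, j)" using G j by blast+
    then have "f (0, j) = f (1, j)" "f (1, j) = f (2, j)" using H[OF j(1)] by blast+
    then show ?thesis using i by auto
  qed
  have col: "f (i, j) = f (i, j')" if i: "i \<in> {0,1,2}" "i \<noteq> fst d0" and j: "j \<in> {0,1,2}" "j' \<in> {0,1,2}" for i j j'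
  proof -
    have "(i, x) \<noteq> d0" for x using i by auto
    then have "g (i, 0)" "g (i, 1)" "g (i, 2)" using G i by blast+
    then have "f (i, 0) = f (i, 1)" "f (i, 1) = f (i, 2)" using V[OF i(1)] by blast+
    then show ?thesis using j by auto
  qed
  obtain r where r: "r \<in> {0,1,2}" "r \<noteq> snd d0" by (metis insertI1 insertI2 zero_neq_one)
  obtain k where k: "k \<in> {0,1,2}" "k \<noteq> fst d0" by (metis insertI1 insertI2 zero_neq_one)
  have away: "f (i, j) = f (k, r)" if "(i, j) \<noteq> d0" and ij: "i \<in> {0,1,2}" "j \<in> {0,1,2}" for i j
  proof (cases "j = snd d0")
    case True
    then have "i \<noteq> fst d0" using that(1) by (metis prod.collapse)
    then have "f (i, j) = f (i, r)" using col ij r by blast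
    also have "\<dots> = f (k, r)" using row r ij k by blast
    finally show ?thesis .
  next
    case False
    then have "f (i, j) = f (k, j)" using row ij k by blast
    also have "\<dots> = f (k, r)" using col r ij k by blast
    finally show ?thesis .
  qed
  \<comment> \<open>The cell d0 may satisfy g as well; a horizontal neighbour, which differs from
    d0, then passes the label on.\<close>
  have "f (i, j) = f (k, r)" if "g (i, j)" and ij: "i \<in> {0,1,2}" "j \<in> {0,1,2}" for i j
  proof (cases "(i, j) = d0")
    case True
    show ?thesis
    proof (cases "i = 1")
      case i: True
      have "(0, j) \<noteq> d0" using True i by auto
      then have "g (0, j)" "f (0, j) = f (k, r)" using G away ij by blast+
      then have "f (0, j) = f (1, j)" "f (0, j) = f (k, r)" using H(1)[OF ij(2)] that i by simp_all
      then show ?thesis using i by simp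
    next
      case False
      then have "(1, j) \<noteq> d0" using True by auto
      then have "g (1, j)" "f (1, j) = f (k, r)" using G away ij by blast+
      then have "f (i, j) = f (1, j)" "f (1, j) = f (k, r)" using H[OF ij(2)] ij that False by auto
      then show ?thesis by simp
    qed
  qed (use away ij in blast)
  from this[of "fst d" "snd d"] this[of "fst d'" "snd d'"] show ?thesis
    using assms(5-8) by (auto simp: grid3_eq)
qed

text \<open>Simultaneous induction: connectedness of a box of the next level uses neighbouring
  children, hence the two statements on adjacent boxes of this level. Two adjacent good boxes face
  each other along three pairs of children, and each box spoils at most one pair.\<close>

lemma core_related:
  assumes "equivp c"
    and h: "\<And>i j. (i, j) \<in> Z \<Longrightarrow> (i + 1, j) \<in> Z \<Longrightarrow> c (i, j) (i + 1, j)"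
    and v: "\<And>i j. (i, j) \<in> Z \<Longrightarrow> (i, j + 1) \<in> Z \<Longrightarrow> c (i, j) (i, j + 1)"
  shows "goodbox n z Z \<Longrightarrow> u \<in> core n z Z \<Longrightarrow> u' \<in> core n z Z \<Longrightarrow> c u u'"
    and "goodbox n (i, j) Z \<Longrightarrow> goodbox n (i + 1, j) Z \<Longrightarrow> u \<in> core n (i, j) Z \<Longrightarrow> u' \<in> core n (i + 1, j) Z \<Longrightarrow> c u u'"
    and "goodbox n (i, j) Z \<Longrightarrow> goodbox n (i, j + 1) Z \<Longrightarrow> u \<in> core n (i, j) Z \<Longrightarrow> u' \<in> core n (i, j + 1) Z \<Longrightarrow> c u u'"
proof (induction n arbitrary: z i j u u')
  case 0
  { case 1 then show ?case using assms(1) by (auto simp: equivp_reflp) }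
  { case 2 then show ?case using h by auto }
  { case 3 then show ?case using v by auto }
next
  case (Suc n)
  have sym: "c a b \<Longrightarrow> c b a" and trans: "c a b \<Longrightarrow> c b d \<Longrightarrow> c a d" for a b d
    using assms(1) equivp_symp equivp_transp by metis+
  \<comment> \<open>The class of the core as a set, so that relatedness of cores becomes the
    equality of labels that \<open>grid3_connected\<close> handles.\<close>
  define f where "f z = {w. \<exists>u\<in>core n z Z. c u w}" for z
  have f_eq: "f z = {w. c u w}" if "goodbox n z Z" "u \<in> core n z Z" for z u
    unfolding f_def using Suc.IH(1)[OF that] that trans by blast
  have f_cong: "f z = f z'" if "goodbox n z Z" "goodbox n z' Z" "u \<in> core n z Z" "u' \<in> core n z' Z" "c u u'" for z z' u u'
    using f_eq[of z u] f_eq[of z' u'] that sym trans by blast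
  have f_rel: "c u u'" if "goodbox n z Z" "goodbox n z' Z" "u \<in> core n z Z" "u' \<in> core n z' Z" "f z = f z'" for z z' u u'
    using f_eq[of z u] f_eq[of z' u'] that equivp_reflp[OF assms(1)] by blast
  have ne: "core n z Z \<noteq> {}" if "goodbox n z Z" for z
    using card_core[OF that] by (auto simp: leD)
  have fh: "f (i, j) = f (i + 1, j)" if *: "goodbox n (i, j) Z" "goodbox n (i + 1, j) Z" for i j
    using ne[OF *(1)] ne[OF *(2)] f_cong[OF *] Suc.IH(2)[OF *] by blast
  have fv: "f (i, j) = f (i, j + 1)" if *: "goodbox n (i, j) Z" "goodbox n (i, j + 1) Z" for i j
    using ne[OF *(1)] ne[OF *(2)] f_cong[OF *] Suc.IH(3)[OF *] by blast
  have same: "f (child z d) = f (child z d')"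
    if g: "goodbox (Suc n) z Z" and d: "d \<in> grid3" "d' \<in> grid3" "goodbox n (child z d) Z" "goodbox n (child z d') Z" for z d d'
  proof -
    obtain d0 where d0: "d0 \<in> grid3" "\<forall>d\<in>grid3 - {d0}. goodbox n (child z d) Z" using g by auto
    show ?thesis
    proof (rule grid3_connected[where g = "\<lambda>d. goodbox n (child z d) Z" and f = "\<lambda>d. f (child z d)"])
      fix i j
      show "goodbox n (child z (i, j)) Z \<Longrightarrow> goodbox n (child z (i + 1, j)) Z \<Longrightarrow> f (child z (i, j)) = f (child z (i + 1, j))"
        using fh[of "3 * fst z + i" "3 * snd z + j"] by (simp add: child_def add_ac)
      show "goodbox n (child z (i, j)) Z \<Longrightarrow> goodbox n (child z (i, j + 1)) Z \<Longrightarrow> f (child z (i, j)) = f (child z (i, j + 1))"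
        using fv[of "3 * fst z + i" "3 * snd z + j"] by (simp add: child_def add_ac)
    qed (use d0 d in auto)
  qed
  {
    case 1
    then obtain d d' where *: "d \<in> grid3" "goodbox n (child z d) Z" "u \<in> core n (child z d) Z"
      "d' \<in> grid3" "goodbox n (child z d') Z" "u' \<in> core n (child z d') Z" by auto
    show ?case by (rule f_rel[OF *(2,5,3,6) same[OF 1(1) *(1,4,2,5)]])
  next
    case 2
    obtain d d' where *: "d \<in> grid3" "goodbox n (child (i, j) d) Z" "u \<in> core n (child (i, j) d) Z"
      "d' \<in> grid3" "goodbox n (child (i + 1, j) d') Z" "u' \<in> core n (child (i + 1, j) d') Z" using 2(3,4) by auto
    obtain d0 d1 where d0: "\<forall>d\<in>grid3 - {d0}. goodbox n (child (i, j) d) Z" "\<forall>d\<in>grid3 - {d1}. goodbox n (child (i + 1, j) d) Z"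
      using 2(1,2) by auto
    \<comment> \<open>Of the three rows at most two contain an exceptional child.\<close>
    obtain k where k: "k \<in> {0,1,2}" "k \<noteq> snd d0" "k \<noteq> snd d1"
      by (metis insertI1 insertI2 zero_neq_one numeral_eq_one_iff zero_neq_numeral num.distinct(1))
    have g: "goodbox n (child (i, j) (2, k)) Z" "goodbox n (child (i + 1, j) (0, k)) Z" "(2, k) \<in> grid3" "(0, k) \<in> grid3"
      using d0 k by (auto simp: grid3_eq)
    have "f (child (i, j) (2, k)) = f (child (i + 1, j) (0, k))"
      using fh[of "3 * i + 2" "3 * j + k"] g by (simp add: child_def algebra_simps)
    then have "f (child (i, j) d) = f (child (i + 1, j) d')"
      using same[OF 2(1) *(1) g(3) *(2) g(1)] same[OF 2(2) *(4) g(4) *(5) g(2)] by simp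
    then show ?case by (rule f_rel[OF *(2,5,3,6)])
  next
    case 3
    obtain d d' where *: "d \<in> grid3" "goodbox n (child (i, j) d) Z" "u \<in> core n (child (i, j) d) Z"
      "d' \<in> grid3" "goodbox n (child (i, j + 1) d') Z" "u' \<in> core n (child (i, j + 1) d') Z" using 3(3,4) by auto
    obtain d0 d1 where d0: "\<forall>d\<in>grid3 - {d0}. goodbox n (child (i, j) d) Z" "\<forall>d\<in>grid3 - {d1}. goodbox n (child (i, j + 1) d) Z"
      using 3(1,2) by auto
    obtain k where k: "k \<in> {0,1,2}" "k \<noteq> fst d0" "k \<noteq> fst d1"
      by (metis insertI1 insertI2 zero_neq_one numeral_eq_one_iff zero_neq_numeral num.distinct(1))
    have g: "goodbox n (child (i, j) (k, 2)) Z" "goodbox n (child (i, j + 1) (k, 0)) Z" "(k, 2) \<in> grid3" "(k, 0) \<in> grid3"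
      using d0 k by (auto simp: grid3_eq)
    have "f (child (i, j) (k, 2)) = f (child (i, j + 1) (k, 0))"
      using fv[of "3 * i + k" "3 * j + 2"] g by (simp add: child_def algebra_simps)
    then have "f (child (i, j) d) = f (child (i, j + 1) d')"
      using same[OF 3(1) *(1) g(3) *(2) g(1)] same[OF 3(2) *(4) g(4) *(5) g(2)] by simp
    then show ?case by (rule f_rel[OF *(2,5,3,6)])
  }
qed

text \<open>Union bound over ordered pairs of distinct bad children, of which there are at most 81,
  with independence within each pair. Since 81/1000 < 1/2, squaring the bound leaves room for one
  more factor 1/2.\<close>

lemma bad_box_prob:
  assumes p: "\<And>z. 999/1000 \<le> p z \<and> p z \<le> 1"
  shows "bern_ex (boxsites n z) p (\<lambda>\<omega>. of_bool (\<not> goodbox n z \<omega>)) \<le> 1 / 1000 / 2 ^ n"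
proof (induction n arbitrary: z)
  case 0
  have "bern_ex {z} p (\<lambda>\<omega>. of_bool (z \<notin> \<omega>)) = 1 - p z"
    using bern_ex_insert[of "{}" z p "\<lambda>\<omega>. of_bool (z \<notin> \<omega>)"] by simp
  then show ?case using p[of z] by simp
next
  case (Suc n)
  let ?B = "\<lambda>d \<omega>. of_bool (\<not> goodbox n (child z d) \<omega>) :: real"
  let ?S = "{(d, d'). d \<in> grid3 \<and> d' \<in> grid3 \<and> d \<noteq> d'}"
  have S: "finite ?S" "card ?S \<le> 81"
  proof -
    have s: "?S \<subseteq> grid3 \<times> grid3" by auto
    show "finite ?S" by (rule finite_subset[OF s]) simp
    show "card ?S \<le> 81" using card_mono[OF _ s] by (simp add: card_cartesian_product card_grid3)
  qed
  have pr: "is_prob A p" for A using p by (auto simp: is_prob_def intro: order_trans[of _ "999/1000"])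
  have "bern_ex (boxsites (Suc n) z) p (\<lambda>\<omega>. of_bool (\<not> goodbox (Suc n) z \<omega>))
     \<le> bern_ex (boxsites (Suc n) z) p (\<lambda>\<omega>. \<Sum>(d, d')\<in>?S. ?B d \<omega> * ?B d' \<omega>)"
  proof (rule bern_ex_mono[OF pr])
    fix \<omega>
    show "of_bool (\<not> goodbox (Suc n) z \<omega>) \<le> (\<Sum>(d, d')\<in>?S. ?B d \<omega> * ?B d' \<omega>)"
    proof (cases "goodbox (Suc n) z \<omega>")
      case False
      then have bad: "\<exists>d\<in>grid3 - {d0}. \<not> goodbox n (child z d) \<omega>" if "d0 \<in> grid3" for d0 using that by auto
      \<comment> \<open>Trying (0, 0) as the exceptional child exposes one bad child; trying that
        one exposes a second.\<close>
      have "(0, 0) \<in> grid3" by (simp add: grid3_def)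
      from bad[OF this] obtain d where d: "d \<in> grid3" "\<not> goodbox n (child z d) \<omega>" by blast
      from bad[OF d(1)] obtain d' where d': "d' \<in> grid3" "d' \<noteq> d" "\<not> goodbox n (child z d') \<omega>" by blast
      have "(case (d, d') of (d, d') \<Rightarrow> ?B d \<omega> * ?B d' \<omega>) \<le> (\<Sum>(d, d')\<in>?S. ?B d \<omega> * ?B d' \<omega>)"
        using S d d' by (intro member_le_sum) auto
      then show ?thesis using d d' False by simp
    qed (auto intro!: sum_nonneg)
  qed
  also have "\<dots> = (\<Sum>(d, d')\<in>?S. bern_ex (boxsites (Suc n) z) p (\<lambda>\<omega>. ?B d \<omega> * ?B d' \<omega>))"
    by (simp add: bern_ex_sum case_prod_unfold)
  also have "\<dots> \<le> (\<Sum>(d, d')\<in>?S. (1 / 1000 / 2 ^ n) * (1 / 1000 / 2 ^ n))"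
  proof (rule sum_mono)
    fix s assume "s \<in> ?S"
    then obtain d1 d2 where s: "s = (d1, d2)" and d: "d1 \<in> grid3" "d2 \<in> grid3" "d1 \<noteq> d2" by auto
    let ?d = d1 and ?d' = d2
    have "bern_ex (boxsites (Suc n) z) p (\<lambda>\<omega>. ?B ?d \<omega> * ?B ?d' \<omega>)
      = bern_ex (boxsites (Suc n) z) p (\<lambda>\<omega>. ?B ?d (\<omega> \<inter> boxsites n (child z ?d)) * ?B ?d' (\<omega> \<inter> boxsites n (child z ?d')))"
      by (simp add: goodbox_local)
    also have "\<dots> = bern_ex (boxsites n (child z ?d)) p (?B ?d) * bern_ex (boxsites n (child z ?d')) p (?B ?d')"
    proof (rule bern_ex_indep_mult)
      have "child z ?d \<noteq> child z ?d'" using child_inj d by blast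
      then show "boxsites n (child z ?d) \<inter> boxsites n (child z ?d') = {}" by (rule boxsites_disjoint)
    qed (use d boxsites_child in auto)
    also have "\<dots> \<le> (1 / 1000 / 2 ^ n) * (1 / 1000 / 2 ^ n)"
      by (intro mult_mono Suc.IH bern_ex_of_bool_bounds pr) auto
    finally show "(case s of (d, d') \<Rightarrow> bern_ex (boxsites (Suc n) z) p (\<lambda>\<omega>. ?B d \<omega> * ?B d' \<omega>))
      \<le> (case s of (d, d') \<Rightarrow> (1 / 1000 / 2 ^ n) * (1 / 1000 / 2 ^ n))" unfolding s by simp
  qed
  also have "\<dots> \<le> 81 * ((1 / 1000 / 2 ^ n) * (1 / 1000 / 2 ^ n))"
    using S by (simp add: case_prod_unfold divide_right_mono)
  also have "\<dots> \<le> 1 / 1000 / 2 ^ Suc n"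
  proof -
    have "(81::real) \<le> 500 * 2 ^ n" using two_realpow_ge_one[of n] by linarith
    then show ?thesis by (simp add: divide_simps)
  qed
  finally show ?case .
qed

text \<open>The failure probabilities of the levels sum to at most 1/500. Goodness is required at
  all levels at once because the corner site has to survive in each of the nested cores.\<close>

lemma all_boxes_good_prob:
  assumes p: "\<And>z. 999/1000 \<le> p z \<and> p z \<le> 1"
  shows "1 / 2 \<le> bern_ex (boxsites n (0, 0)) p (\<lambda>\<omega>. of_bool (\<forall>m\<le>n. goodbox m (0, 0) \<omega>))"
proof -
  let ?E = "\<lambda>m. boxsites m (0, 0)"
  have pr: "is_prob A p" for A using p by (auto simp: is_prob_def intro: order_trans[of _ "999/1000"])
  have sub: "?E m \<subseteq> ?E n" if "m \<le> n" for m
    using that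
  proof (induction rule: dec_induct)
    case (step k)
    have "?E k \<subseteq> ?E (Suc k)" using boxsites_child[of "(0,0)" k "(0,0)"] by (simp add: child_def grid3_eq)
    then show ?case using step by auto
  qed simp
  have "bern_ex (?E n) p (\<lambda>\<omega>. of_bool (\<not> (\<forall>m\<le>n. goodbox m (0, 0) \<omega>)))
    \<le> bern_ex (?E n) p (\<lambda>\<omega>. \<Sum>m\<le>n. of_bool (\<not> goodbox m (0, 0) \<omega>))"
  proof (rule bern_ex_mono[OF pr])
    fix \<omega>
    show "of_bool (\<not> (\<forall>m\<le>n. goodbox m (0, 0) \<omega>)) \<le> (\<Sum>m\<le>n. of_bool (\<not> goodbox m (0, 0) \<omega>) :: real)"
    proof (cases "\<forall>m\<le>n. goodbox m (0, 0) \<omega>")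
      case False
      then obtain m where "m \<le> n" "\<not> goodbox m (0, 0) \<omega>" by auto
      then show ?thesis
        using member_le_sum[of m "{..n}" "\<lambda>m. of_bool (\<not> goodbox m (0, 0) \<omega>) :: real"] by (simp add: False)
    qed (simp add: sum_nonneg)
  qed
  also have "\<dots> = (\<Sum>m\<le>n. bern_ex (?E n) p (\<lambda>\<omega>. of_bool (\<not> goodbox m (0, 0) (\<omega> \<inter> ?E m))))"
    unfolding bern_ex_sum goodbox_local ..
  also have "\<dots> = (\<Sum>m\<le>n. bern_ex (?E m) p (\<lambda>\<omega>. of_bool (\<not> goodbox m (0, 0) \<omega>)))"
    by (intro sum.cong refl bern_ex_Int) (auto simp: sub)
  also have "\<dots> \<le> (\<Sum>m\<le>n. 1 / 1000 / 2 ^ m)" using bad_box_prob[OF p] by (intro sum_mono)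
  also have "\<dots> = (1 / 1000) * (\<Sum>m\<le>n. (1 / 2) ^ m)" by (simp add: sum_distrib_left power_one_over field_simps)
  also have "\<dots> \<le> (1 / 1000) * 2" by (intro mult_left_mono) (simp_all add: sum_gp0)
  finally have "1 - bern_ex (?E n) p (\<lambda>\<omega>. of_bool (\<forall>m\<le>n. goodbox m (0, 0) \<omega>)) \<le> 1 / 500"
    by (subst (asm) bern_ex_of_bool_not) auto
  then show ?thesis by simp
qed

text \<open>Goodness at every level keeps (0, 0) in the core. The size bound n is a weakening of
  \<open>8 ^ n\<close>, since only unboundedness matters. The relation c is abstract; it will be
  connection between representatives of blocks.\<close>

lemma hierarchical_cluster:
  assumes "equivp c"
    and "\<And>i j. (i, j) \<in> Z \<Longrightarrow> (i + 1, j) \<in> Z \<Longrightarrow> c (i, j) (i + 1, j)"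
    and "\<And>i j. (i, j) \<in> Z \<Longrightarrow> (i, j + 1) \<in> Z \<Longrightarrow> c (i, j) (i, j + 1)"
    and good: "\<forall>m\<le>n. goodbox m (0, 0) Z"
  obtains C where "(0, 0) \<in> C" "C \<subseteq> Z" "finite C" "n \<le> card C" "\<And>u. u \<in> C \<Longrightarrow> c (0, 0) u"
proof
  have g: "goodbox n (0, 0) Z" using good by simp
  have "(0, 0) \<in> core m (0, 0) Z" if "m \<le> n" for m
    using that
  proof (induction m)
    case (Suc m)
    have *: "child (0, 0) (0, 0) = (0, 0)" "(0, 0) \<in> grid3" by (simp_all add: child_def grid3_def)
    have "goodbox m (child (0, 0) (0, 0)) Z" "(0, 0) \<in> core m (child (0, 0) (0, 0)) Z"
      using Suc good unfolding *(1) by auto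
    then show ?case using *(2) unfolding core.simps by blast
  qed simp
  then show 0: "(0, 0) \<in> core n (0, 0) Z" by simp
  show "core n (0, 0) Z \<subseteq> Z" using core_subset[OF g] by auto
  show "finite (core n (0, 0) Z)" using core_subset[OF g] finite_boxsites finite_subset by (meson le_inf_iff)
  have "n \<le> 8 ^ n" using less_exp[of n] power_mono[of 2 "8::nat" n] by linarith
  then show "n \<le> card (core n (0, 0) Z)" using card_core[OF g] by linarith
  show "c (0, 0) u" if "u \<in> core n (0, 0) Z" for u
    using core_related(1)[OF assms(1-3) g 0 that] .
qed

subsection \<open>Exploration of clusters in a strip of two rows\<close>

definition reach :: "'v set set \<Rightarrow> 'v \<Rightarrow> 'v \<Rightarrow> bool" where
  "reach \<omega> u v \<longleftrightarrow> (u, v) \<in> {(a, b). {a, b} \<in> \<omega>}\<^sup>*"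

lemma reach_refl [simp]: "reach \<omega> u u"
  by (simp add: reach_def)

lemma reach_trans: "reach \<omega> u v \<Longrightarrow> reach \<omega> v w \<Longrightarrow> reach \<omega> u w"
  unfolding reach_def by (rule rtrancl_trans)

lemma reach_edge: "{u, v} \<in> \<omega> \<Longrightarrow> reach \<omega> u v"
  unfolding reach_def by (rule r_into_rtrancl) simp

lemma reach_mono: "reach \<omega> u v \<Longrightarrow> \<omega> \<subseteq> \<omega>' \<Longrightarrow> reach \<omega>' u v"
  unfolding reach_def using rtrancl_mono[of "{(a, b). {a, b} \<in> \<omega>}" "{(a, b). {a, b} \<in> \<omega>'}"] by blast

lemma reach_sym: "reach \<omega> u v \<Longrightarrow> reach \<omega> v u"
  unfolding reach_def
proof (rule symD[OF sym_rtrancl])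
  have "{a, b} = {b, a}" for a b :: 'a by blast
  then show "sym {(a, b). {a, b} \<in> \<omega>}" unfolding sym_def by simp
qed

text \<open>State of an exploration: A holds the active vertices, found but not yet explored, and U
  the columns not hit so far. These are the unrevealed bonds that the exploration may still use;
  bonds between two active vertices cannot enlarge the cluster and are left out.\<close>

definition strip_edges :: "int \<Rightarrow> int \<Rightarrow> (int \<times> int) set \<Rightarrow> int set \<Rightarrow> (int \<times> int) set set" where
  "strip_edges j j' A U =
     {{(x, i), (y, i)} | x y i. i \<in> {j, j'} \<and> y \<in> U \<and> ((x, i) \<in> A \<or> x \<in> U \<and> x \<noteq> y)}
     \<union> (\<lambda>y. {(y, j), (y, j')}) ` U"

lemma strip_edges_cases [consumes 1, case_names hor vert]:
  assumes "e \<in> strip_edges j j' A U"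
  obtains x y i where "e = {(x, i), (y, i)}" "i \<in> {j, j'}" "y \<in> U" "(x, i) \<in> A \<or> x \<in> U \<and> x \<noteq> y"
    | y where "e = {(y, j), (y, j')}" "y \<in> U"
  using assms unfolding strip_edges_def by blast

lemma strip_edges_subset: "e \<in> strip_edges j j' A U \<Longrightarrow> e \<subseteq> A \<union> U \<times> {j, j'}"
  by (erule strip_edges_cases) auto

text \<open>The clusters of all active vertices count together, so that the predicate fits every
  intermediate state of the exploration.\<close>

definition big_cluster :: "int \<Rightarrow> int \<Rightarrow> (int \<times> int) set \<Rightarrow> int set \<Rightarrow> nat \<Rightarrow> (int \<times> int) set set \<Rightarrow> bool" where
  "big_cluster j j' A U n \<omega> \<longleftrightarrow>
     (\<exists>C. C \<subseteq> A \<union> U \<times> {j, j'} \<and> finite C \<and> n \<le> card C \<and> (\<forall>v\<in>C. \<exists>a\<in>A. reach \<omega> a v))"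

lemma big_cluster_mono: "big_cluster j j' A U n \<omega> \<Longrightarrow> \<omega> \<subseteq> \<omega>' \<Longrightarrow> big_cluster j j' A U n \<omega>'"
  unfolding big_cluster_def by (meson reach_mono)

lemma finite_strip_edges [simp]:
  assumes "finite A" "finite U" shows "finite (strip_edges j j' A U)"
proof (rule finite_subset)
  show "strip_edges j j' A U \<subseteq> Pow (A \<union> U \<times> {j, j'})" using strip_edges_subset by blast
qed (use assms in simp)

text \<open>Weights below play the role of \<open>exp (- \<lambda> h)\<close>. The cluster is explored one vertex at a time;
  a column hit for the first time immediately reveals its vertical bond.\<close>

locale strip =
  fixes j j' :: int and B :: "int set" and pr :: "(int \<times> int) set \<Rightarrow> real"
    and q :: "int \<Rightarrow> int \<Rightarrow> real" and t :: real and w :: "int \<Rightarrow> real" and s :: nat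
  assumes rows: "j \<noteq> j'" and finB: "finite B"
    and pr_hor: "\<And>x y i. i \<in> {j, j'} \<Longrightarrow> x \<in> B \<Longrightarrow> y \<in> B \<Longrightarrow> x \<noteq> y \<Longrightarrow> pr {(x, i), (y, i)} = q x y"
    and pr_vert: "\<And>y. y \<in> B \<Longrightarrow> pr {(y, j), (y, j')} = t"
    and q01: "\<And>x y. x \<in> B \<Longrightarrow> y \<in> B \<Longrightarrow> x \<noteq> y \<Longrightarrow> 0 \<le> q x y \<and> q x y \<le> 1"
    and t01: "0 \<le> t" "t \<le> 1"
    and w_nonneg: "\<And>x. x \<in> B \<Longrightarrow> 0 \<le> w x"
    and growth: "\<And>x U. x \<in> B \<Longrightarrow> U \<subseteq> B \<Longrightarrow> x \<notin> U \<Longrightarrow> card (B - U) \<le> s \<Longrightarrow>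
      (\<Prod>y\<in>U. q x y * (w y * (1 - t + t * w y)) + (1 - q x y)) \<le> w x"
begin

lemma strip_is_prob:
  assumes "A \<subseteq> B \<times> {j, j'}" "U \<subseteq> B" "fst ` A \<inter> U = {}"
  shows "is_prob (strip_edges j j' A U) pr"
  unfolding is_prob_def
proof
  fix e assume "e \<in> strip_edges j j' A U"
  then show "0 \<le> pr e \<and> pr e \<le> 1"
  proof (cases rule: strip_edges_cases)
    case (hor x y i)
    have "x \<in> B" using hor(4) assms(1,2) by blast
    moreover have "y \<in> B" using hor(3) assms(2) by blast
    moreover have "x \<noteq> y" using hor(3,4) assms(3) by force
    ultimately show ?thesis unfolding hor(1) using pr_hor[OF hor(2)] q01[of x y] by simp
  next
    case (vert y)
    then show ?thesis using assms(2) pr_vert[of y] t01 by auto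
  qed
qed

text \<open>The product of w over the active set is a supermartingale: exploring (x, i) replaces the
  factor w x by the weights of the newly active vertices, whose expected product is at most w x by
  \<open>growth\<close>. An exploration that dies out ends with the empty product 1, so its
  probability is at most the initial product. The last hypothesis is a budget. A step uses up
  \<open>card W\<close> columns and changes the number of active vertices by at least
  \<open>card W - 1\<close>, so the budget persists with n lowered by one; and while fewer vertices
  are active than wanted, it keeps the number of used columns within s.\<close>

lemma explore:
  assumes "A \<subseteq> B \<times> {j, j'}" "U \<subseteq> B" "fst ` A \<inter> U = {}" "card (B - U) + n \<le> s + card A"
  shows "bern_ex (strip_edges j j' A U) pr (\<lambda>\<omega>. of_bool (\<not> big_cluster j j' A U n \<omega>)) \<le> (\<Prod>a\<in>A. w (fst a))"
  using assms
proof (induction n arbitrary: A U)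
  case 0
  have "big_cluster j j' A U 0 \<omega>" for \<omega> unfolding big_cluster_def by (rule exI[of _ "{}"]) auto
  then show ?case using 0 w_nonneg finB by (auto simp: bern_ex_def intro!: prod_nonneg)
next
  case (Suc n)
  note A = Suc.prems(1) and U = Suc.prems(2) and AU = Suc.prems(3)
  have fin: "finite A" "finite U" using A U finB finite_subset[OF A] by (auto intro: finite_subset)
  note finE = finite_strip_edges[OF fin, of j j']
  consider "A = {}" | "Suc n \<le> card A" | "A \<noteq> {}" "card A \<le> n" by linarith
  then show ?case
  proof cases
    case 1
    then show ?thesis using bern_ex_of_bool_bounds(2)[OF finE strip_is_prob[OF A U AU]] by simp
  next
    case 2
    then have "big_cluster j j' A U (Suc n) \<omega>" for \<omega>
      unfolding big_cluster_def using fin by (intro exI[of _ A]) (auto intro: reach_refl)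
    then show ?thesis using A w_nonneg by (auto simp: bern_ex_def intro!: prod_nonneg)
  next
    case 3
    then obtain x i where u: "(x, i) \<in> A" by auto
    have xi: "x \<in> B" "i \<in> {j, j'}" "x \<notin> U" using u A AU by force+
    define i' where "i' = j + j' - i"
    have i': "{i, i'} = {j, j'}" "i \<noteq> i'" using xi rows by (auto simp: i'_def)
    have i'_row: "i' \<in> {j, j'}" using i'(1) by blast
    have vert_eq: "{(y, j), (y, j')} = {(y, i), (y, i')}" for y using i' by (auto simp: doubleton_eq_iff)
    define hb where "hb y = {(x, i), (y, i)}" for y :: int
    define vb where "vb y = {(y, j), (y, j')}" for y :: int
    have inj_hb: "inj_on hb X" and inj_vb: "inj_on vb X" for X
      by (auto simp: inj_on_def hb_def vb_def doubleton_eq_iff)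
    define E where "E = strip_edges j j' A U"
    define F where "F = E - hb ` U"
    let ?f = "\<lambda>\<omega>. of_bool (\<not> big_cluster j j' A U (Suc n) \<omega>) :: real"
    let ?PA = "\<Prod>a\<in>A - {(x, i)}. w (fst a)"
    have PA: "0 \<le> ?PA" using A w_nonneg by (auto intro!: prod_nonneg)
    have hbE: "hb ` U \<subseteq> E" using u xi by (auto simp: E_def strip_edges_def hb_def)
    have vbF: "vb ` W \<subseteq> F" if "W \<subseteq> U" for W
    proof
      fix e assume "e \<in> vb ` W"
      then obtain y where y: "y \<in> U" "e = {(y, j), (y, j')}" using \<open>W \<subseteq> U\<close> by (auto simp: vb_def)
      then show "e \<in> F" using rows by (auto simp: F_def E_def strip_edges_def hb_def doubleton_eq_iff)
    qed
    have finF: "finite F" and finE': "finite E" using finE by (auto simp: F_def E_def)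
    have prE: "is_prob E pr" using strip_is_prob[OF A U AU] by (simp add: E_def)
    \<comment> \<open>W is the set of fresh columns that (x, i) reaches in its own row; the bonds of
      F are still unrevealed.\<close>
    have step: "bern_ex F pr (\<lambda>\<omega>'. ?f (hb ` W \<union> \<omega>')) \<le> ?PA * (\<Prod>y\<in>W. w y * (1 - t + t * w y))"
      if W: "W \<subseteq> U" for W
    proof -
      define F' where "F' = F - vb ` W"
      have finW: "finite W" using W fin finite_subset by auto
      have inner: "bern_ex F' pr (\<lambda>\<omega>3. ?f (hb ` W \<union> (vb ` P \<union> \<omega>3))) \<le> ?PA * (\<Prod>y\<in>W. w y) * (\<Prod>y\<in>P. w y)"
        if P: "P \<subseteq> W" for P
      proof -
        \<comment> \<open>P collects the hit columns whose vertical bond is open. Where it is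
          closed, the vertex of the other row is given up, which only loses cluster size.\<close>
        define A' where "A' = (A - {(x, i)}) \<union> (W \<times> {i} \<union> P \<times> {i'})"
        define U' where "U' = U - W"
        have finP: "finite P" using P finW finite_subset by auto
        have A': "A' \<subseteq> B \<times> {j, j'}" using A W P U i' by (auto simp: A'_def)
        have U': "U' \<subseteq> B" using U by (auto simp: U'_def)
        have AU': "fst ` A' \<inter> U' = {}" using AU P by (force simp: A'_def U'_def)
        have disj: "(A - {(x, i)}) \<inter> (W \<times> {i} \<union> P \<times> {i'}) = {}" using AU W P by force
        have disj2: "W \<times> {i} \<inter> P \<times> {i'} = {}" using i' by auto
        have cA': "card A' = card A - 1 + (card W + card P)"
          unfolding A'_def using fin finW finP u disj disj2
          by (subst card_Un_disjoint, simp_all, subst card_Un_disjoint) (simp_all add: card_cartesian_product)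
        have "card (B - U') = card ((B - U) \<union> W)" using W U by (intro arg_cong[where f = card]) (auto simp: U'_def)
        also have "\<dots> = card (B - U) + card W" using W finW finB by (intro card_Un_disjoint) auto
        finally have card: "card (B - U') + n \<le> s + card A'"
          using Suc.prems(4) cA' fin u card_gt_0_iff[of A] by auto
        define E' where "E' = strip_edges j j' A' U'"
        have E'_hb: "e \<notin> hb ` U" if "e \<in> E'" for e
        proof
          assume "e \<in> hb ` U"
          then have "(x, i) \<in> e" by (auto simp: hb_def)
          then have "(x, i) \<in> A' \<union> U' \<times> {j, j'}" using strip_edges_subset \<open>e \<in> E'\<close> unfolding E'_def by blast
          then show False using xi W P by (auto simp: A'_def U'_def)
        qed
        have E'_vb: "e \<notin> vb ` W" if "e \<in> E'" for e
          using that unfolding E'_def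
        proof (cases rule: strip_edges_cases)
          case (hor x0 y k)
          then show ?thesis using rows by (auto simp: vb_def doubleton_eq_iff)
        next
          case (vert y)
          then show ?thesis using rows by (auto simp: vb_def doubleton_eq_iff U'_def)
        qed        have E'_E: "E' \<subseteq> E"
        proof
          fix e assume "e \<in> E'"
          then show "e \<in> E" unfolding E'_def
          proof (cases rule: strip_edges_cases)
            case (hor x0 y k)
            have yU: "y \<in> U" "y \<notin> W" using hor by (auto simp: U'_def)
            have "(x0, k) \<in> A \<or> x0 \<in> U \<and> x0 \<noteq> y" using hor(4) W P yU by (auto simp: A'_def U'_def)
            then show ?thesis using hor yU unfolding E_def strip_edges_def by blast
          qed (auto simp: E_def strip_edges_def U'_def)
        qed
        \<comment> \<open>The bonds used later are disjoint from all revealed ones, hence still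
          independent of them.\<close>
        have sub: "E' \<subseteq> F'" using E'_hb E'_vb E'_E by (auto simp: F'_def F_def)
        have "bern_ex F' pr (\<lambda>\<omega>3. ?f (hb ` W \<union> (vb ` P \<union> \<omega>3)))
          \<le> bern_ex F' pr (\<lambda>\<omega>3. of_bool (\<not> big_cluster j j' A' U' n (\<omega>3 \<inter> E')))"
        proof (rule bern_ex_mono)
          show "is_prob F' pr" using prE by (rule is_prob_subset) (auto simp: F'_def F_def)
          fix \<omega>3
          let ?\<omega> = "hb ` W \<union> (vb ` P \<union> \<omega>3)"
          have "big_cluster j j' A U (Suc n) ?\<omega>" if big: "big_cluster j j' A' U' n (\<omega>3 \<inter> E')"
          proof -
            from big have "big_cluster j j' A' U' n ?\<omega>" by (rule big_cluster_mono) auto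
            then obtain C where C: "C \<subseteq> A' \<union> U' \<times> {j, j'}" "finite C" "n \<le> card C" "\<forall>v\<in>C. \<exists>a\<in>A'. reach ?\<omega> a v"
              unfolding big_cluster_def by auto
            \<comment> \<open>The explored vertex lies neither in the new active set nor in a fresh
              column, so it raises the size from n to n + 1.\<close>
            have new: "(x, i) \<notin> C" using C(1) xi W P by (auto simp: A'_def U'_def)
            have "\<exists>b\<in>A. reach ?\<omega> b a" if aA': "a \<in> A'" for a
            proof -
              have W_reach: "reach ?\<omega> (x, i) (y, i)" if "y \<in> W" for y
                using that by (intro reach_edge) (auto simp: hb_def)
              have P_reach: "reach ?\<omega> (y, i) (y, i')" if "y \<in> P" for y
                using that by (intro reach_edge) (auto simp: vb_def vert_eq)
              consider "a \<in> A" | y where "a = (y, i)" "y \<in> W" | y where "a = (y, i')" "y \<in> P"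
                using aA' by (auto simp: A'_def)
              then show ?thesis
              proof cases
                case 1 then show ?thesis by (intro bexI[of _ a]) auto
              next
                case 2 then show ?thesis using W_reach u by blast
              next
                case (3 y)
                then have "reach ?\<omega> (x, i) (y, i)" "reach ?\<omega> (y, i) (y, i')" using W_reach P_reach P by auto
                then have "reach ?\<omega> (x, i) a" unfolding 3(1) by (rule reach_trans)
                with u show ?thesis by (rule bexI[rotated])
              qed
            qed
            then have "\<forall>v\<in>C. \<exists>a\<in>A. reach ?\<omega> a v" using C(4) by (meson reach_trans)
            then have "\<forall>v\<in>insert (x, i) C. \<exists>a\<in>A. reach ?\<omega> a v" using u by (auto intro!: bexI[of _ "(x, i)"])
            moreover have "insert (x, i) C \<subseteq> A \<union> U \<times> {j, j'}"
            proof -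
              have "A' \<subseteq> A \<union> U \<times> {j, j'}" "U' \<subseteq> U" using W P i'_row xi(2) unfolding A'_def U'_def by blast+
              then show ?thesis using C(1) u by blast
            qed
            ultimately show ?thesis unfolding big_cluster_def
              using C(2,3) new by (intro exI[of _ "insert (x, i) C"]) auto
          qed
          then show "?f ?\<omega> \<le> of_bool (\<not> big_cluster j j' A' U' n (\<omega>3 \<inter> E'))" by auto
        qed
        also have "\<dots> = bern_ex E' pr (\<lambda>\<omega>. of_bool (\<not> big_cluster j j' A' U' n \<omega>))"
          by (rule bern_ex_Int) (use finF sub in \<open>auto simp: F'_def\<close>)
        also have "\<dots> \<le> (\<Prod>a\<in>A'. w (fst a))"
          unfolding E'_def by (rule Suc.IH[OF A' U' AU' card])
        also have "\<dots> = ?PA * ((\<Prod>a\<in>W \<times> {i}. w (fst a)) * (\<Prod>a\<in>P \<times> {i'}. w (fst a)))"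
          unfolding A'_def using fin finW finP disj disj2
          by (subst prod.union_disjoint, simp_all, subst prod.union_disjoint) simp_all
        also have "\<dots> = ?PA * (\<Prod>y\<in>W. w y) * (\<Prod>y\<in>P. w y)"
        proof -
          have "(\<Prod>a\<in>X \<times> {k}. w (fst a)) = prod w X" for X :: "int set" and k :: int
            by (rule prod.reindex_bij_witness[of _ "\<lambda>y. (y, k)" fst]) auto
          then show ?thesis by simp
        qed
        finally show ?thesis .
      qed
      have "bern_ex F pr (\<lambda>\<omega>'. ?f (hb ` W \<union> \<omega>')) = bern_ex (vb ` W \<union> F') pr (\<lambda>\<omega>'. ?f (hb ` W \<union> \<omega>'))"
        using vbF[OF W] by (simp add: F'_def Un_absorb1)
      also have "\<dots> = bern_ex (vb ` W) pr (\<lambda>\<omega>2. bern_ex F' pr (\<lambda>\<omega>3. ?f (hb ` W \<union> (\<omega>2 \<union> \<omega>3))))"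
        using finW finF by (subst bern_ex_Un) (auto simp: F'_def)
      also have "\<dots> = bern_ex W (\<lambda>y. pr (vb y)) (\<lambda>P. bern_ex F' pr (\<lambda>\<omega>3. ?f (hb ` W \<union> (vb ` P \<union> \<omega>3))))"
        using finW inj_vb by (subst bern_ex_reindex) auto
      also have "\<dots> = bern_ex W (\<lambda>y. t) (\<lambda>P. bern_ex F' pr (\<lambda>\<omega>3. ?f (hb ` W \<union> (vb ` P \<union> \<omega>3))))"
        using W U pr_vert by (intro bern_ex_cong refl) (auto simp: vb_def)
      also have "\<dots> \<le> bern_ex W (\<lambda>y. t) (\<lambda>P. ?PA * (\<Prod>y\<in>W. w y) * (\<Prod>y\<in>W. if y \<in> P then w y else 1))"
      proof (rule bern_ex_mono)
        show "is_prob W (\<lambda>y. t)" using t01 by (simp add: is_prob_def)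
        fix P assume P: "P \<subseteq> W"
        then have "(\<Prod>y\<in>P. w y) = (\<Prod>y\<in>W. if y \<in> P then w y else 1)"
          using finW by (simp add: prod.inter_restrict[symmetric] Int_absorb1)
        then show "bern_ex F' pr (\<lambda>\<omega>3. ?f (hb ` W \<union> (vb ` P \<union> \<omega>3)))
          \<le> ?PA * (\<Prod>y\<in>W. w y) * (\<Prod>y\<in>W. if y \<in> P then w y else 1)" using inner[OF P] by simp
      qed
      also have "\<dots> = ?PA * (\<Prod>y\<in>W. w y) * (\<Prod>y\<in>W. t * w y + (1 - t) * 1)"
        using finW by (simp add: bern_ex_cmult bern_ex_prod)
      also have "\<dots> = ?PA * (\<Prod>y\<in>W. w y * (1 - t + t * w y))"
        by (simp add: prod.distrib add_ac)
      finally show ?thesis .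
    qed
    have "bern_ex E pr ?f = bern_ex (hb ` U \<union> F) pr ?f"
      using hbE by (simp add: F_def Un_absorb1)
    also have "\<dots> = bern_ex (hb ` U) pr (\<lambda>\<omega>. bern_ex F pr (\<lambda>\<omega>'. ?f (\<omega> \<union> \<omega>')))"
      using fin finF by (subst bern_ex_Un) (auto simp: F_def)
    also have "\<dots> = bern_ex U (\<lambda>y. pr (hb y)) (\<lambda>W. bern_ex F pr (\<lambda>\<omega>'. ?f (hb ` W \<union> \<omega>')))"
      using fin inj_hb by (subst bern_ex_reindex) auto
    also have "\<dots> = bern_ex U (q x) (\<lambda>W. bern_ex F pr (\<lambda>\<omega>'. ?f (hb ` W \<union> \<omega>')))"
      using xi U by (intro bern_ex_cong refl) (auto simp: hb_def intro!: pr_hor)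
    \<comment> \<open>The average over W factorizes over the columns of U, and its factors are those
      of \<open>growth\<close>.\<close>
    also have "\<dots> \<le> bern_ex U (q x) (\<lambda>W. ?PA * (\<Prod>y\<in>U. if y \<in> W then w y * (1 - t + t * w y) else 1))"
    proof (rule bern_ex_mono)
      show "is_prob U (q x)" using q01 xi U by (auto simp: is_prob_def)
      fix W assume W: "W \<subseteq> U"
      then have "(\<Prod>y\<in>W. w y * (1 - t + t * w y)) = (\<Prod>y\<in>U. if y \<in> W then w y * (1 - t + t * w y) else 1)"
        using fin by (simp add: prod.inter_restrict[symmetric] Int_absorb1)
      then show "bern_ex F pr (\<lambda>\<omega>'. ?f (hb ` W \<union> \<omega>')) \<le> ?PA * (\<Prod>y\<in>U. if y \<in> W then w y * (1 - t + t * w y) else 1)"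
        using step[OF W] by simp
    qed
    also have "\<dots> = ?PA * (\<Prod>y\<in>U. q x y * (w y * (1 - t + t * w y)) + (1 - q x y))"
      using fin by (simp add: bern_ex_cmult bern_ex_prod)
    also have "\<dots> \<le> ?PA * w x"
      using 3 Suc.prems(4) xi U by (intro mult_left_mono PA growth) auto
    also have "\<dots> = (\<Prod>a\<in>A. w (fst a))"
      using u fin by (simp add: prod.remove[of A "(x, i)"])
    finally show ?thesis unfolding E_def .
  qed
qed

end

subsection \<open>Kac kernels\<close>

lemma cos_ge: "1 - x\<^sup>2 / 2 \<le> cos (x::real)"
proof -
  have "(sin (x / 2))\<^sup>2 \<le> (x / 2)\<^sup>2" using abs_sin_x_le_abs_x[of "x / 2"] by (simp only: abs_le_square_iff)
  then show ?thesis using cos_double_sin[of "x / 2"] by (simp add: power_divide)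
qed

text \<open>Only these properties of the normalized kernel enter the percolation part. C, c and r
  are separate parameters, so that the threshold for \<gamma> can be chosen from them alone.\<close>

locale kernel =
  fixes \<kappa> :: "int \<Rightarrow> real" and \<gamma> C c r :: real
  assumes \<gamma>_pos: "0 < \<gamma>" and r_pos: "0 < r" and r_le: "r \<le> 1" and c_pos: "0 < c" and C_pos: "0 < C"
    and even: "\<kappa> (- z) = \<kappa> z" and nonneg: "0 \<le> \<kappa> z"
    and range: "1 < \<gamma> * \<bar>of_int z\<bar> \<Longrightarrow> \<kappa> z = 0"
    and total: "(\<Sum>z\<in>{-\<lfloor>1/\<gamma>\<rfloor>..\<lfloor>1/\<gamma>\<rfloor>}. \<kappa> z) = 1"
    and upper: "\<kappa> z \<le> C * \<gamma>"
    and lower: "z \<noteq> 0 \<Longrightarrow> \<gamma> * \<bar>of_int z\<bar> \<le> r \<Longrightarrow> c * \<gamma> \<le> \<kappa> z"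
begin

lemma sum_kernel_le_1:
  assumes "finite B" shows "(\<Sum>y\<in>B. \<kappa> (x - y)) \<le> 1"
proof -
  let ?N = "\<lfloor>1/\<gamma>\<rfloor>"
  have z: "\<kappa> z = 0" if "z \<notin> {-?N..?N}" for z
  proof (rule range)
    have "?N < \<bar>z\<bar>" using that by auto
    then have "1 / \<gamma> < of_int \<bar>z\<bar>" by linarith
    then show "1 < \<gamma> * \<bar>of_int z\<bar>" using \<gamma>_pos by (simp add: field_simps)
  qed
  have "(\<Sum>y\<in>B. \<kappa> (x - y)) = (\<Sum>z\<in>(\<lambda>y. x - y) ` B. \<kappa> z)"
    by (subst sum.reindex) (auto simp: inj_on_def)
  also have "\<dots> = (\<Sum>z\<in>(\<lambda>y. x - y) ` B \<inter> {-?N..?N}. \<kappa> z)"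
    using assms z by (intro sum.mono_neutral_right) auto
  also have "\<dots> \<le> (\<Sum>z\<in>{-?N..?N}. \<kappa> z)" by (rule sum_mono2) (auto simp: nonneg)
  finally show ?thesis using total by simp
qed

text \<open>The Dirichlet problem on a long interval: applying the kernel once to the truncated cosine
  gives an approximate eigenfunction that stays bounded below up to the end points.\<close>

lemma eigenfunction:
  assumes th: "0 < \<theta>" "\<theta> \<le> 1" and small: "\<gamma> \<le> 1/2" "\<gamma> \<le> r / 4"
  defines "L \<equiv> \<lfloor>pi / (2 * \<theta> * \<gamma>)\<rfloor>"
  obtains h :: "int \<Rightarrow> real" where
    "\<And>x. x \<in> {-L..L} \<Longrightarrow> sin (\<theta> * r / 2) * c * r / 4 \<le> h x"
    "\<And>x. x \<in> {-L..L} \<Longrightarrow> h x \<le> 1"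
    "\<And>x. x \<in> {-L..L} \<Longrightarrow> (1 - \<theta>\<^sup>2 / 2) * h x \<le> (\<Sum>y\<in>{-L..L}. \<kappa> (x - y) * h y)"
proof
  define N where "N = \<lfloor>1/\<gamma>\<rfloor>"
  define a where "a = \<theta> * \<gamma>"
  define h where "h x = (\<Sum>y\<in>{-L..L}. \<kappa> (x - y) * cos (a * of_int y))" for x :: int
  have a: "0 < a" using th \<gamma>_pos by (simp add: a_def)
  have L: "of_int L \<le> pi / (2 * a)" "pi / (2 * a) < of_int L + 1"
    unfolding L_def a_def by (simp_all add: mult.assoc)
  \<comment> \<open>L is the last integer before the first zero of the cosine, so the cosine is
    nonnegative on the interval and changes sign just outside.\<close>
  have aL: "a * of_int L \<le> pi / 2" "pi / 2 < a * (of_int L + 1)"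
    using L a by (simp_all add: field_simps)
  have N: "of_int N \<le> 1 / \<gamma>" "0 \<le> N" unfolding N_def using \<gamma>_pos by (simp_all add: le_floor_iff)
  have aN: "a * of_int N \<le> \<theta>"
    using mult_left_mono[OF N(1), of a] a \<gamma>_pos by (simp add: a_def)
  have zero: "\<kappa> z = 0" if "z \<notin> {-N..N}" for z
  proof (rule range)
    have "N < \<bar>z\<bar>" using that by auto
    then have "1 / \<gamma> < of_int \<bar>z\<bar>" unfolding N_def by linarith
    then show "1 < \<gamma> * \<bar>of_int z\<bar>" using \<gamma>_pos by (simp add: field_simps)
  qed
  have cos_pos: "0 \<le> cos (a * of_int y)" if "y \<in> {-L..L}" for y :: int
  proof -
    have "of_int y \<le> real_of_int L" "- real_of_int L \<le> of_int y" using that by auto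
    then have "a * of_int y \<le> a * of_int L" "a * - of_int L \<le> a * of_int y"
      using a by (blast intro: mult_left_mono less_imp_le)+
    then have "- (pi / 2) \<le> a * of_int y" "a * of_int y \<le> pi / 2"
      using aL(1) unfolding mult_minus_right by linarith+
    then show ?thesis by (rule cos_ge_zero)
  qed
  have conv: "(1 - \<theta>\<^sup>2 / 2) * cos (a * of_int x) \<le> h x" if x: "x \<in> {-L..L}" for x
  proof -
    let ?D = "{-(L+N)..L+N}"
    have e1: "(\<Sum>z\<in>{-N..N}. \<kappa> z * sin (a * of_int z)) = 0"
    proof -
      have "(\<Sum>z\<in>{-N..N}. \<kappa> z * sin (a * of_int z)) = (\<Sum>z\<in>{-N..N}. \<kappa> (- z) * sin (a * of_int (- z)))"
        by (rule sum.reindex_bij_witness[of _ uminus uminus]) auto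
      also have "\<dots> = - (\<Sum>z\<in>{-N..N}. \<kappa> z * sin (a * of_int z))" by (simp add: even sum_negf)
      finally show ?thesis by simp
    qed
    \<comment> \<open>The Fourier coefficient of the kernel at a. By the finite range, angles are at
      most \<theta>, where the cosine is at least 1 - \<theta>^2 / 2.\<close>
    have e2: "1 - \<theta>\<^sup>2 / 2 \<le> (\<Sum>z\<in>{-N..N}. \<kappa> z * cos (a * of_int z))"
    proof -
      have "(1 - \<theta>\<^sup>2 / 2) = (\<Sum>z\<in>{-N..N}. \<kappa> z * (1 - \<theta>\<^sup>2 / 2))"
        using total by (simp add: sum_distrib_right[symmetric] N_def)
      also have "\<dots> \<le> (\<Sum>z\<in>{-N..N}. \<kappa> z * cos (a * of_int z))"
      proof (intro sum_mono mult_left_mono nonneg)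
        fix z assume z: "z \<in> {-N..N}"
        have "\<bar>z\<bar> \<le> N" using z by auto
        then have "real_of_int \<bar>z\<bar> \<le> of_int N" by (simp only: of_int_le_iff)
        then have "\<bar>a * of_int z\<bar> \<le> a * of_int N" using a by (simp add: abs_mult)
        then have "\<bar>a * of_int z\<bar> \<le> \<bar>\<theta>\<bar>" using aN th by simp
        then have "(a * of_int z)\<^sup>2 \<le> \<theta>\<^sup>2" by (simp only: abs_le_square_iff)
        then show "1 - \<theta>\<^sup>2 / 2 \<le> cos (a * of_int z)" using cos_ge[of "a * of_int z"] by simp
      qed
      finally show ?thesis .
    qed
    have "(1 - \<theta>\<^sup>2 / 2) * cos (a * of_int x) \<le> (\<Sum>z\<in>{-N..N}. \<kappa> z * cos (a * of_int z)) * cos (a * of_int x)"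
      using e2 cos_pos[OF x] by (rule mult_right_mono)
    also have "\<dots> = cos (a * of_int x) * (\<Sum>z\<in>{-N..N}. \<kappa> z * cos (a * of_int z)) + sin (a * of_int x) * (\<Sum>z\<in>{-N..N}. \<kappa> z * sin (a * of_int z))"
      unfolding e1 by simp
    also have "\<dots> = (\<Sum>z\<in>{-N..N}. \<kappa> z * cos (a * of_int (x - z)))"
      unfolding sum_distrib_left sum.distrib[symmetric]
      by (intro sum.cong refl) (simp add: right_diff_distrib cos_diff algebra_simps)
    also have "\<dots> = (\<Sum>y\<in>{x-N..x+N}. \<kappa> (x - y) * cos (a * of_int y))"
      by (rule sum.reindex_bij_witness[of _ "\<lambda>y. x - y" "\<lambda>z. x - z"]) auto
    also have "\<dots> = (\<Sum>y\<in>?D. \<kappa> (x - y) * cos (a * of_int y))"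
      using x by (intro sum.mono_neutral_left) (auto intro!: zero)
    \<comment> \<open>Outside the interval but within the range, the angle lies between pi / 2 and
      pi / 2 + 1, so the cosine is not positive and dropping these terms increases the sum.\<close>
    also have "\<dots> \<le> (\<Sum>y\<in>?D. if y \<in> {-L..L} then \<kappa> (x - y) * cos (a * of_int y) else 0)"
    proof (rule sum_mono)
      fix y assume y: "y \<in> ?D"
      have "cos (a * of_int y) \<le> 0" if "y \<notin> {-L..L}"
      proof -
        have "L + 1 \<le> \<bar>y\<bar>" "\<bar>y\<bar> \<le> L + N" using that y by auto
        then have "of_int L + 1 \<le> (of_int \<bar>y\<bar> :: real)" "(of_int \<bar>y\<bar> :: real) \<le> of_int L + of_int N" by linarith+
        then have "a * (of_int L + 1) \<le> a * of_int \<bar>y\<bar>" "a * of_int \<bar>y\<bar> \<le> a * (of_int L + of_int N)"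
          using a by (auto intro!: mult_left_mono)
        then have b: "pi / 2 \<le> a * of_int \<bar>y\<bar>" "a * of_int \<bar>y\<bar> \<le> pi / 2 + 1"
          using aL aN th by (auto simp: algebra_simps)
        have "0 \<le> cos (a * of_int \<bar>y\<bar> - pi)" using b pi_gt3 by (intro cos_ge_zero) linarith+
        then have "cos (a * of_int \<bar>y\<bar>) \<le> 0" by (simp add: cos_diff)
        then show ?thesis by (cases "0 \<le> y") auto
      qed
      then show "\<kappa> (x - y) * cos (a * of_int y) \<le> (if y \<in> {-L..L} then \<kappa> (x - y) * cos (a * of_int y) else 0)"
        using nonneg[of "x - y"] by (auto simp: mult_le_0_iff)
    qed
    also have "\<dots> = h x"
      unfolding h_def using N by (subst sum.inter_restrict[symmetric]) (auto intro!: sum.cong)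
    finally show ?thesis .
  qed
  show "h x \<le> 1" for x
  proof -
    have "h x \<le> (\<Sum>y\<in>{-L..L}. \<kappa> (x - y) * 1)" unfolding h_def by (intro sum_mono mult_left_mono nonneg) auto
    then show ?thesis using sum_kernel_le_1[of "{-L..L}" x] by simp
  qed
  show "(1 - \<theta>\<^sup>2 / 2) * h x \<le> (\<Sum>y\<in>{-L..L}. \<kappa> (x - y) * h y)" for x
  proof -
    \<comment> \<open>On the interval h dominates (1 - \<theta>^2 / 2) cos, and h is the kernel
      applied to cos; a second application of the kernel gives the inequality for h.\<close>
    have "(1 - \<theta>\<^sup>2 / 2) * h x = (\<Sum>y\<in>{-L..L}. \<kappa> (x - y) * ((1 - \<theta>\<^sup>2 / 2) * cos (a * of_int y)))"
      unfolding h_def sum_distrib_left by (intro sum.cong refl) simp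
    also have "\<dots> \<le> (\<Sum>y\<in>{-L..L}. \<kappa> (x - y) * h y)" by (intro sum_mono mult_left_mono conv nonneg)
    finally show ?thesis .
  qed
  \<comment> \<open>Steps of length between r / (2 \<gamma>) and r / \<gamma> towards the centre
    land where the angle stays at least \<theta> r / 2 away from the zeros of the cosine. There are
    at least r / (4 \<gamma>) such steps, each with kernel value at least c \<gamma>.\<close>
  have low: "sin (\<theta> * r / 2) * c * r / 4 \<le> h x" if x: "0 \<le> x" "x \<le> L" for x
  proof -
    define m1 where "m1 = \<lceil>r / (2 * \<gamma>)\<rceil>"
    define m2 where "m2 = \<lfloor>r / \<gamma>\<rfloor>"
    have m1: "r / (2 * \<gamma>) \<le> of_int m1" "of_int m1 \<le> r / (2 * \<gamma>) + 1" unfolding m1_def by linarith+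
    have m2: "of_int m2 \<le> r / \<gamma>" "r / \<gamma> < of_int m2 + 1" using floor_correct[of "r / \<gamma>"] by (simp_all add: m2_def)
    have g4: "1 \<le> r / (4 * \<gamma>)" using small \<gamma>_pos by (simp add: field_simps)
    have cnt: "r / (4 * \<gamma>) \<le> of_int (m2 - m1 + 1)"
    proof -
      have "r / \<gamma> = 4 * (r / (4 * \<gamma>))" "r / (2 * \<gamma>) = 2 * (r / (4 * \<gamma>))" using \<gamma>_pos by (simp_all add: field_simps)
      then show ?thesis using m1 m2 g4 unfolding of_int_add of_int_diff of_int_1 by linarith
    qed
    have z: "x - z \<in> {-L..L} \<and> c * \<gamma> \<le> \<kappa> z \<and> sin (\<theta> * r / 2) \<le> cos (a * of_int (x - z))" if z: "z \<in> {m1..m2}" for z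
    proof -
      have "real_of_int m1 \<le> of_int z" "real_of_int z \<le> of_int m2" using z by auto
      then have zb: "r / (2 * \<gamma>) \<le> of_int z" "of_int z \<le> r / \<gamma>" using m1 m2 by linarith+
      have "0 < r / (2 * \<gamma>)" using r_pos \<gamma>_pos by simp
      then have zpos: "0 < z" using zb by (metis of_int_0_less_iff order_less_le_trans)
      have "c * \<gamma> \<le> \<kappa> z" using zpos zb \<gamma>_pos by (intro lower) (auto simp: field_simps)
      moreover have "a * of_int z \<le> \<theta> * r" "\<theta> * r / 2 \<le> a * of_int z"
        using mult_left_mono[OF zb(1), of a] mult_left_mono[OF zb(2), of a] a \<gamma>_pos by (simp_all add: a_def)
      note az = this
      have "\<theta> * r \<le> 1" using th r_pos r_le by (simp add: mult_le_one)
      have aLge: "1 \<le> a * of_int L"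
      proof -
        have "a \<le> 1/2" using th small \<gamma>_pos mult_mono[of \<theta> 1 \<gamma> "1/2"] by (simp add: a_def)
        then show ?thesis using aL(2) pi_gt3 by (simp add: algebra_simps)
      qed
      have ax: "0 \<le> a * of_int x" "a * of_int x \<le> a * of_int L" using x a by auto
      have "- L \<le> x - z"
      proof -
        have "a * of_int z \<le> a * of_int L" using az aLge \<open>\<theta> * r \<le> 1\<close> by linarith
        then have "z \<le> L" using a by simp
        then show ?thesis using x by simp
      qed
      moreover have "x - z \<le> L" using x zpos by simp
      moreover have "sin (\<theta> * r / 2) \<le> cos (a * of_int (x - z))"
      proof -
        have b: "\<bar>a * of_int (x - z)\<bar> \<le> pi / 2 - \<theta> * r / 2"
          using az ax aL pi_gt3 \<open>\<theta> * r \<le> 1\<close> by (simp add: right_diff_distrib abs_le_iff)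
        have "0 \<le> \<theta> * r" using th r_pos by simp
        have "sin (\<theta> * r / 2) = cos (pi / 2 - \<theta> * r / 2)" by (simp add: cos_diff)
        also have "\<dots> \<le> cos \<bar>a * of_int (x - z)\<bar>"
          using b \<open>0 \<le> \<theta> * r\<close> pi_gt_zero by (intro cos_monotone_0_pi_le) linarith+
        also have "\<dots> = cos (a * of_int (x - z))" by (simp add: cos_abs_real)
        finally show ?thesis .
      qed
      ultimately show ?thesis by simp
    qed
    have s0: "0 \<le> sin (\<theta> * r / 2)"
    proof (rule sin_ge_zero)
      have "\<theta> * r \<le> 1" using th r_pos r_le by (simp add: mult_le_one)
      then show "\<theta> * r / 2 \<le> pi" using pi_gt3 by linarith
    qed (use th r_pos in auto)
    have "sin (\<theta> * r / 2) * c * r / 4 = (r / (4 * \<gamma>)) * (c * \<gamma> * sin (\<theta> * r / 2))"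
      using \<gamma>_pos by (simp add: field_simps)
    also have "\<dots> \<le> of_int (m2 - m1 + 1) * (c * \<gamma> * sin (\<theta> * r / 2))"
      using cnt s0 c_pos \<gamma>_pos by (intro mult_right_mono) auto
    also have "\<dots> = (\<Sum>z\<in>{m1..m2}. c * \<gamma> * sin (\<theta> * r / 2))"
      using cnt g4 by (simp add: of_nat_nat)
    also have "\<dots> \<le> (\<Sum>z\<in>{m1..m2}. \<kappa> (x - (x - z)) * cos (a * of_int (x - z)))"
      using z s0 c_pos \<gamma>_pos by (intro sum_mono mult_mono) (auto simp: nonneg)
    also have "\<dots> = (\<Sum>y\<in>(\<lambda>z. x - z) ` {m1..m2}. \<kappa> (x - y) * cos (a * of_int y))"
      by (subst sum.reindex) (auto simp: inj_on_def)
    also have "\<dots> \<le> h x" unfolding h_def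
      using z nonneg cos_pos by (intro sum_mono2) auto
    finally show ?thesis .
  qed
  have hsym: "h (- x) = h x" for x
    unfolding h_def
  proof (rule sum.reindex_bij_witness[of _ uminus uminus])
    fix y
    have "\<kappa> (- x - y) = \<kappa> (x - (- y))" using even[of "x - (- y)"] by (simp add: algebra_simps)
    then show "\<kappa> (x - - y) * cos (a * real_of_int (- y)) = \<kappa> (- x - y) * cos (a * of_int y)" by simp
  qed auto
  show "sin (\<theta> * r / 2) * c * r / 4 \<le> h x" if "x \<in> {-L..L}" for x
    using low[of x] low[of "- x"] hsym[of x] that by (cases "0 \<le> x") auto
qed

end

subsection \<open>Large clusters with positive probability\<close>

text \<open>A seed is confined to one window of one row, so that the seeds of neighbouring blocks
  can face each other within the range of the interaction.\<close>

definition seeded :: "int \<Rightarrow> int \<Rightarrow> int \<Rightarrow> real \<Rightarrow> (int \<times> int) set set \<Rightarrow> bool" where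
  "seeded x0 w i m \<omega> \<longleftrightarrow>
     (\<exists>S \<subseteq> {x0..<x0 + w} \<times> {i}. m \<le> real (card S) \<and> (\<forall>u\<in>S. \<forall>v\<in>S. reach \<omega> u v))"

lemma one_minus_exp_ge:
  assumes "0 \<le> (v::real)" shows "v * (1 - v) \<le> 1 - exp (- v)"
proof -
  have "exp (- v) = 1 / exp v" by (simp add: exp_minus field_simps)
  also have "\<dots> \<le> 1 / (1 + v)" using assms exp_ge_add_one_self[of v] by (intro divide_left_mono) auto
  also have "\<dots> \<le> 1 - v * (1 - v)"
  proof -
    have "0 \<le> v * (v * v)" using assms by simp
    then show ?thesis using assms by (simp add: field_simps)
  qed
  finally show ?thesis by simp
qed

text \<open>First-order gain of one hit column: its vertex and, with probability t, the second
  vertex contribute (1 + t) v with v = \<alpha> h. The second-order terms are at most 3 \<alpha>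
  v.\<close>

lemma offspring_bound:
  fixes h t \<alpha> :: real
  assumes "0 \<le> h" "h \<le> 1" "0 \<le> t" "t \<le> 1" "0 \<le> \<alpha>"
  shows "\<alpha> * h * (1 + t - 3 * \<alpha>) \<le> 1 - exp (- \<alpha> * h) * (1 - t + t * exp (- \<alpha> * h))"
proof -
  define v where "v = \<alpha> * h"
  \<comment> \<open>In terms of u the right side is (1 + t) u - t u^2, to be compared with v through
    v (1 - v) \<le> u \<le> v.\<close>
  define u where "u = 1 - exp (- v)"
  have v: "0 \<le> v" "v \<le> \<alpha>" using mult_nonneg_nonneg[OF assms(5,1)] mult_left_le[OF assms(2,5)] by (simp_all add: v_def)
  have u: "0 \<le> u" "u \<le> v" "v * (1 - v) \<le> u"
    using one_minus_exp_ge[OF v(1)] exp_ge_add_one_self[of "- v"] v by (auto simp: u_def)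
  have uu: "u * u \<le> v * v" using u by (intro mult_mono) auto
  have "v * v * (2 + t) \<le> v * \<alpha> * 3" using v assms by (intro mult_mono) auto
  then have "v * (1 + t - 3 * \<alpha>) \<le> (1 + t) * (v * (1 - v)) - v * v" by (simp add: algebra_simps)
  also have "\<dots> \<le> (1 + t) * u - t * (u * u)"
  proof -
    have "(1 + t) * (v * (1 - v)) \<le> (1 + t) * u" using u assms by (intro mult_left_mono) auto
    moreover have "t * (u * u) \<le> 1 * (v * v)" by (rule mult_mono) (use uu assms v in auto)
    ultimately show ?thesis by simp
  qed
  also have "\<dots> = 1 - exp (- v) * (1 - t + t * exp (- v))" by (simp add: u_def algebra_simps)
  finally show ?thesis by (simp add: v_def)
qed

context kernel
begin

text \<open>Supplies the growth condition of \<open>strip\<close> for the weights exp (- (t/12) h).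
  With \<alpha> = t/12 a hit column gains the factor 1 + t - 3 \<alpha> = 1 + 3 t / 4. The losses
  are 1 - t/16 for the bonds held in reserve and 1 - t/8 for the eigenvalue together with the
  columns already removed. The product of the three factors is at least 1.\<close>

lemma offspring_growth:
  fixes h :: "int \<Rightarrow> real"
  assumes t: "0 < t" "t \<le> 1" and h0: "0 < h0"
    and h: "\<And>x. x \<in> B \<Longrightarrow> h0 \<le> h x" "\<And>x. x \<in> B \<Longrightarrow> h x \<le> 1"
      "\<And>x. x \<in> B \<Longrightarrow> (1 - t / 16) * h x \<le> (\<Sum>y\<in>B. \<kappa> (x - y) * h y)"
    and B: "finite B" "U \<subseteq> B" "x \<in> B" "real (card (B - U)) * (C * \<gamma>) \<le> t * h0 / 16"
  shows "(\<Prod>y\<in>U. ((1 - t/16) * \<kappa> (x - y)) * (exp (- (t/12) * h y) * (1 - t + t * exp (- (t/12) * h y)))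
           + (1 - (1 - t/16) * \<kappa> (x - y))) \<le> exp (- (t/12) * h x)"
proof -
  define \<phi> where "\<phi> y = exp (- (t/12) * h y) * (1 - t + t * exp (- (t/12) * h y))" for y
  have hnn: "0 \<le> h y" if "y \<in> B" for y using h(1)[OF that] h0 by simp
  have \<phi>: "(t/12) * h y * (1 + 3 * t / 4) \<le> 1 - \<phi> y" if "y \<in> B" for y
  proof -
    have eq: "1 + t - 3 * (t/12) = 1 + 3 * t / 4" by simp
    show ?thesis
      using offspring_bound[of "h y" t "t/12", unfolded eq] hnn[OF that] h(2)[OF that] t by (simp only: \<phi>_def)
  qed
  have \<kappa>1: "\<kappa> z \<le> 1" for z using sum_kernel_le_1[of "{0}" z] by simp
  have \<phi>01: "0 \<le> \<phi> y" for y using t by (simp add: \<phi>_def)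
  have finU: "finite U" using B finite_subset by auto
  \<comment> \<open>Of the deficit t/8 one half is the eigenvalue and the other the removed columns,
    whose terms are at most C \<gamma> each while h \<ge> h0.\<close>
  have S: "(1 - t/8) * h x \<le> (\<Sum>y\<in>U. \<kappa> (x - y) * h y)"
  proof -
    have "(\<Sum>y\<in>B. \<kappa> (x - y) * h y) = (\<Sum>y\<in>U. \<kappa> (x - y) * h y) + (\<Sum>y\<in>B - U. \<kappa> (x - y) * h y)"
      using B by (subst sum.subset_diff[of U B]) auto
    moreover have "(\<Sum>y\<in>B - U. \<kappa> (x - y) * h y) \<le> (\<Sum>y\<in>B - U. C * \<gamma> * 1)"
      using upper nonneg hnn h(2) C_pos \<gamma>_pos by (intro sum_mono mult_mono) auto
    moreover have "t * h0 / 16 \<le> t / 16 * h x" using h(1)[OF B(3)] t by simp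
    ultimately show ?thesis using h(3)[OF B(3)] B(4) by (simp add: algebra_simps)
  qed
  have "(\<Prod>y\<in>U. ((1 - t/16) * \<kappa> (x - y)) * \<phi> y + (1 - (1 - t/16) * \<kappa> (x - y)))
     \<le> (\<Prod>y\<in>U. exp (- ((1 - t/16) * \<kappa> (x - y) * (1 - \<phi> y))))"
  proof (rule prod_mono)
    fix y assume "y \<in> U"
    have "0 \<le> (1 - t/16) * \<kappa> (x - y)" "(1 - t/16) * \<kappa> (x - y) \<le> 1" using t nonneg \<kappa>1 by (auto intro!: mult_le_one)
    then have "0 \<le> ((1 - t/16) * \<kappa> (x - y)) * \<phi> y + (1 - (1 - t/16) * \<kappa> (x - y))"
      using \<phi>01[of y] by (metis add_nonneg_nonneg diff_ge_0_iff_ge mult_nonneg_nonneg)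
    moreover have "((1 - t/16) * \<kappa> (x - y)) * \<phi> y + (1 - (1 - t/16) * \<kappa> (x - y)) = 1 + - ((1 - t/16) * \<kappa> (x - y) * (1 - \<phi> y))"
      by algebra
    ultimately show "0 \<le> ((1 - t/16) * \<kappa> (x - y)) * \<phi> y + (1 - (1 - t/16) * \<kappa> (x - y)) \<and>
        ((1 - t/16) * \<kappa> (x - y)) * \<phi> y + (1 - (1 - t/16) * \<kappa> (x - y)) \<le> exp (- ((1 - t/16) * \<kappa> (x - y) * (1 - \<phi> y)))"
      by (metis exp_ge_add_one_self)
  qed
  also have "\<dots> = exp (- (\<Sum>y\<in>U. (1 - t/16) * \<kappa> (x - y) * (1 - \<phi> y)))"
    using finU by (simp add: exp_sum sum_negf[symmetric])
  also have "\<dots> \<le> exp (- ((t/12) * h x))"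
  proof -
    have "h x \<le> (1 - t/16) * (1 + 3 * t / 4) * ((1 - t/8) * h x)"
    proof -
      \<comment> \<open>The first-order part is 3 t / 4 - t / 16 - t / 8 = 9 t / 16, which outweighs
        the quadratic term.\<close>
      have "1 \<le> (1 - t/16) * (1 + 3 * t / 4) * (1 - t/8)"
      proof -
        have tt: "t * t \<le> t" "t * t * t \<le> t * t" "0 \<le> t * t * t" using t by (auto simp: mult_left_le)
        have "(1 - t/16) * (1 + 3 * t / 4) * (1 - t/8) = 1 + 9/16 * t - 17/128 * (t * t) + 3/512 * (t * t * t)"
          by (simp add: field_simps)
        then show ?thesis using tt t by linarith
      qed
      then have "1 * h x \<le> ((1 - t/16) * (1 + 3 * t / 4) * (1 - t/8)) * h x" using hnn[OF B(3)] by (rule mult_right_mono)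
      then show ?thesis by (simp only: mult.assoc mult_1)
    qed
    also have "\<dots> \<le> (1 - t/16) * (1 + 3 * t / 4) * (\<Sum>y\<in>U. \<kappa> (x - y) * h y)"
      using S t by (intro mult_left_mono) auto
    finally have "(t/12) * h x \<le> (t/12) * ((1 - t/16) * (1 + 3 * t / 4) * (\<Sum>y\<in>U. \<kappa> (x - y) * h y))"
      using t by (intro mult_left_mono) auto
    also have "\<dots> = (\<Sum>y\<in>U. (1 - t/16) * \<kappa> (x - y) * ((t/12) * h y * (1 + 3 * t / 4)))"
      unfolding sum_distrib_left by (intro sum.cong refl) algebra
    also have "\<dots> \<le> (\<Sum>y\<in>U. (1 - t/16) * \<kappa> (x - y) * (1 - \<phi> y))"
      using \<phi> B(2) t nonneg by (intro sum_mono mult_left_mono) auto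
    finally show ?thesis by simp
  qed
  finally show ?thesis by (simp add: \<phi>_def)
qed

text \<open>The eigenfunction is taken with \<theta> = t/4, so its eigenvalue bound 1 - t^2 / 32 is
  at least 1 - t/16. The choice \<nu> C = t h0 / 16 allows up to \<nu> / \<gamma> columns to be
  removed before the growth condition fails. K windows in each of two rows cover the strip, and the
  pigeonhole principle is used twice: a large cluster fills one window and row sufficiently, and one
  of these 2 K events has at least 1 / (2 K) of the probability. The selected window and row may
  vary with \<gamma>, hence the existential x0 and i.\<close>

lemma strip_seed:
  fixes t :: real and K :: nat
  defines "h0 \<equiv> sin (t * r / 8) * c * r / 4" and "\<nu> \<equiv> t * (sin (t * r / 8) * c * r / 4) / (16 * C)"
    and "L \<equiv> \<lfloor>pi / (2 * (t/4) * \<gamma>)\<rfloor>" and "w \<equiv> \<lfloor>r / (2 * \<gamma>)\<rfloor>"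
  assumes t: "0 < t" "t \<le> 1" and small: "\<gamma> \<le> 1/2" "\<gamma> \<le> r / 4" "\<gamma> \<le> \<nu> / 2"
    and K: "4 * (4 * pi / t + 1) / r \<le> real K"
    and pr_hor: "\<And>x y i. i \<in> {0, 1} \<Longrightarrow> x \<noteq> y \<Longrightarrow> pr {(x, i), (y, i)} = (1 - t/16) * \<kappa> (x - y)"
    and pr_vert: "\<And>y. pr {(y, 0), (y, 1)} = t"
  shows "0 < h0" "0 < w" "0 \<le> L" "2 * L + 1 \<le> int K * w"
    "\<exists>x0. \<exists>i\<in>{0, 1}. (1 - exp (- (t/12) * h0)) / (2 * real K)
       \<le> bern_ex (strip_edges 0 1 {(0, 0)} ({-L..L} - {0})) pr (\<lambda>\<omega>. of_bool (seeded x0 w i (\<nu> / (4 * real K) / \<gamma>) \<omega>))"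
proof -
  have tr: "t * r \<le> 1" "0 < t * r" using t r_pos r_le by (auto intro: mult_le_one)
  have "0 < sin (t * r / 8)" using tr pi_gt3 by (intro sin_gt_zero) linarith+
  then show h0: "0 < h0" using c_pos r_pos by (simp add: h0_def)
  have \<nu>: "0 < \<nu>" "\<nu> * C = t * h0 / 16" using h0 t C_pos by (simp_all add: \<nu>_def h0_def[symmetric])
  have w: "r / (4 * \<gamma>) \<le> of_int w"
  proof -
    have "r / (2 * \<gamma>) - 1 \<le> of_int w" unfolding w_def by linarith
    moreover have "r / (2 * \<gamma>) = r / (4 * \<gamma>) + r / (4 * \<gamma>)" using \<gamma>_pos by (simp add: field_simps)
    moreover have "1 \<le> r / (4 * \<gamma>)" using small \<gamma>_pos by (simp add: field_simps)
    ultimately show ?thesis by linarith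
  qed
  then have "0 < (of_int w :: real)" using r_pos \<gamma>_pos by (meson divide_pos_pos mult_pos_pos order_less_le_trans zero_less_numeral)
  then show w_pos: "0 < w" by simp
  show L0: "0 \<le> L" unfolding L_def using t \<gamma>_pos by (simp add: le_floor_iff)
  have K_pos: "0 < real K"
  proof -
    have "0 < 4 * (4 * pi / t + 1) / r" using t r_pos pi_gt_zero by (intro divide_pos_pos mult_pos_pos add_pos_pos) auto
    then show ?thesis using K by linarith
  qed
  show cover: "2 * L + 1 \<le> int K * w"
  proof -
    have "of_int L \<le> pi / (2 * (t/4) * \<gamma>)" unfolding L_def by simp
    moreover have "4 * pi / t / \<gamma> = 2 * (pi / (2 * (t/4) * \<gamma>))" by (simp add: field_simps)
    ultimately have "2 * of_int L + 1 \<le> 4 * pi / t / \<gamma> + 1" by linarith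
    also have "\<dots> \<le> 4 * pi / t / \<gamma> + 1 / \<gamma>" using small \<gamma>_pos by simp
    also have "\<dots> = 4 * (4 * pi / t + 1) / r * (r / (4 * \<gamma>))" using r_pos \<gamma>_pos t by (simp add: field_simps)
    also have "\<dots> \<le> real K * of_int w"
      using K w K_pos r_pos \<gamma>_pos by (intro mult_mono) auto
    finally have "real_of_int (2 * L + 1) \<le> real_of_int (int K * w)" by simp
    then show ?thesis by (simp only: of_int_le_iff)
  qed
  let ?B = "{-L..L}"
  obtain h :: "int \<Rightarrow> real" where h: "\<And>x. x \<in> ?B \<Longrightarrow> h0 \<le> h x" "\<And>x. x \<in> ?B \<Longrightarrow> h x \<le> 1"
    "\<And>x. x \<in> ?B \<Longrightarrow> (1 - (t/4)\<^sup>2 / 2) * h x \<le> (\<Sum>y\<in>?B. \<kappa> (x - y) * h y)"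
    using eigenfunction[of "t/4"] t small unfolding h0_def L_def by auto
  have h3: "(1 - t / 16) * h x \<le> (\<Sum>y\<in>?B. \<kappa> (x - y) * h y)" if "x \<in> ?B" for x
  proof -
    have "(t/4)\<^sup>2 / 2 \<le> t / 16" using t by (simp add: power2_eq_square mult_left_le)
    then have "(1 - t / 16) * h x \<le> (1 - (t/4)\<^sup>2 / 2) * h x" using h(1)[OF that] h0 by (intro mult_right_mono) auto
    then show ?thesis using h(3)[OF that] by simp
  qed
  define n where "n = nat \<lfloor>\<nu> / \<gamma>\<rfloor>"
  have "0 \<le> \<nu> / \<gamma>" using \<nu> \<gamma>_pos by simp
  then have n: "real n \<le> \<nu> / \<gamma>" "\<nu> / \<gamma> - 1 \<le> real n" unfolding n_def by linarith+
  have \<kappa>1: "\<kappa> z \<le> 1" for z using sum_kernel_le_1[of "{0}" z] by simp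
  interpret strip 0 1 ?B pr "\<lambda>x y. (1 - t/16) * \<kappa> (x - y)" t "\<lambda>x. exp (- (t/12) * h x)" n
  proof
    fix x U assume *: "x \<in> ?B" "U \<subseteq> ?B" "card (?B - U) \<le> n"
    have "real (card (?B - U)) * (C * \<gamma>) \<le> \<nu> / \<gamma> * (C * \<gamma>)"
      using *(3) n C_pos \<gamma>_pos by (intro mult_right_mono) auto
    also have "\<dots> = t * h0 / 16" using \<nu> \<gamma>_pos by simp
    finally show "(\<Prod>y\<in>U. (1 - t/16) * \<kappa> (x - y) * (exp (- (t/12) * h y) * (1 - t + t * exp (- (t/12) * h y)))
           + (1 - (1 - t/16) * \<kappa> (x - y))) \<le> exp (- (t/12) * h x)"
      using * by (intro offspring_growth[OF t h0 h(1,2) h3]) auto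
  qed (use t nonneg \<kappa>1 pr_hor pr_vert in \<open>auto intro!: mult_le_one\<close>)
  let ?E = "strip_edges 0 1 {(0, 0)} (?B - {0})"
  have pr: "is_prob ?E pr" using L0 by (intro strip_is_prob) auto
  have finE: "finite ?E" by simp
  have "bern_ex ?E pr (\<lambda>\<omega>. of_bool (\<not> big_cluster 0 1 {(0, 0)} (?B - {0}) n \<omega>)) \<le> (\<Prod>a\<in>{(0::int, 0::int)}. exp (- (t/12) * h (fst a)))"
  proof (rule explore)
    \<comment> \<open>The start vertex has used one column and is one active vertex, so the budget
      holds with equality.\<close>
    have "?B - (?B - {0}) = {0}" using L0 by auto
    then show "card (?B - (?B - {0})) + n \<le> n + card {(0::int, 0::int)}" by simp
  qed (use L0 in auto)
  also have "\<dots> \<le> exp (- (t/12) * h0)" using h(1)[of 0] L0 t by simp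
  finally have big: "1 - exp (- (t/12) * h0) \<le> bern_ex ?E pr (\<lambda>\<omega>. of_bool (big_cluster 0 1 {(0, 0)} (?B - {0}) n \<omega>))"
    using finE by (simp add: bern_ex_of_bool_not)
  \<comment> \<open>Half of \<nu> / \<gamma> divided by the 2 K windows: rounding in n costs at most
    1, which is at most \<nu> / (2 \<gamma>).\<close>
  define m where "m = \<nu> / (4 * real K) / \<gamma>"
  let ?I = "{..<K} \<times> {0::int, 1}"
  let ?sd = "\<lambda>(k, i) \<omega>. seeded (- L + int k * w) w i m \<omega>"
  have pigeon: "\<exists>s\<in>?I. ?sd s \<omega>" if bc: "big_cluster 0 1 {(0, 0)} (?B - {0}) n \<omega>" for \<omega>
  proof (rule ccontr)
    assume no: "\<not> (\<exists>s\<in>?I. ?sd s \<omega>)"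
    obtain Cl where Cl: "Cl \<subseteq> {(0, 0)} \<union> (?B - {0}) \<times> {0, 1}" "finite Cl" "n \<le> card Cl" "\<forall>v\<in>Cl. reach \<omega> (0, 0) v"
      using bc unfolding big_cluster_def by auto
    define W where "W s = Cl \<inter> ({- L + int (fst s) * w..<- L + int (fst s) * w + w} \<times> {snd s})" for s :: "nat \<times> int"
    have small_W: "real (card (W s)) < m" if sI: "s \<in> ?I" for s
    proof (rule ccontr)
      assume "\<not> real (card (W s)) < m"
      moreover have "\<forall>u\<in>W s. \<forall>v\<in>W s. reach \<omega> u v"
        using Cl(4) reach_sym reach_trans unfolding W_def by (meson IntD1)
      ultimately have "?sd s \<omega>" unfolding seeded_def W_def by (cases s) (auto intro!: exI[of _ "W s"] simp: W_def)
      with no sI show False by blast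
    qed
    have "Cl \<subseteq> (\<Union>s\<in>?I. W s)"
    proof
      fix v assume v: "v \<in> Cl"
      obtain x i where xi: "v = (x, i)" by (cases v)
      have x: "- L \<le> x" "x \<le> L" "i \<in> {0, 1}" using Cl(1) v xi L0 by auto
      define k where "k = (x + L) div w"
      have "0 \<le> k" using x w_pos by (simp add: k_def pos_imp_zdiv_nonneg_iff)
      moreover have "k * w \<le> x + L" "x + L < k * w + w"
        using pos_mod_bound[OF w_pos, of "x + L"] pos_mod_sign[OF w_pos, of "x + L"] div_mult_mod_eq[of "x + L" w]
        unfolding k_def by linarith+
      ultimately have k: "0 \<le> k" "k * w \<le> x + L" "x + L < k * w + w" .
      have "k * w < int K * w" using k x cover by linarith
      then have "k < int K" using w_pos by simp
      then have "(nat k, i) \<in> ?I" using k x by auto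
      moreover have "v \<in> W (nat k, i)" using k x v xi by (auto simp: W_def)
      ultimately show "v \<in> (\<Union>s\<in>?I. W s)" by blast
    qed
    then have "card Cl \<le> card (\<Union>s\<in>?I. W s)" using Cl(2) by (intro card_mono) (auto simp: W_def)
    also have "\<dots> \<le> (\<Sum>s\<in>?I. card (W s))" by (rule card_UN_le) simp
    finally have "real n \<le> (\<Sum>s\<in>?I. real (card (W s)))"
      using Cl(3) unfolding of_nat_sum[symmetric] of_nat_le_iff by simp
    also have "\<dots> < (\<Sum>s\<in>?I. m)" using small_W K_pos by (intro sum_strict_mono) auto
    also have "\<dots> = \<nu> / \<gamma> / 2" using K_pos by (simp add: m_def card_cartesian_product)
    also have "\<dots> \<le> \<nu> / \<gamma> - 1" using small(3) \<gamma>_pos by (simp add: field_simps)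
    finally show False using n by simp
  qed
  have "bern_ex ?E pr (\<lambda>\<omega>. of_bool (big_cluster 0 1 {(0, 0)} (?B - {0}) n \<omega>))
     \<le> bern_ex ?E pr (\<lambda>\<omega>. \<Sum>s\<in>?I. of_bool (?sd s \<omega>))"
  proof (rule bern_ex_mono[OF pr])
    fix \<omega>
    show "of_bool (big_cluster 0 1 {(0, 0)} (?B - {0}) n \<omega>) \<le> (\<Sum>s\<in>?I. of_bool (?sd s \<omega>) :: real)"
    proof (cases "big_cluster 0 1 {(0, 0)} (?B - {0}) n \<omega>")
      case True
      then obtain s where "s \<in> ?I" "?sd s \<omega>" using pigeon by blast
      then show ?thesis using member_le_sum[of s ?I "\<lambda>s. of_bool (?sd s \<omega>) :: real"] by simp
    qed (simp add: sum_nonneg)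
  qed
  also have "\<dots> = (\<Sum>s\<in>?I. bern_ex ?E pr (\<lambda>\<omega>. of_bool (?sd s \<omega>)))" by (rule bern_ex_sum)
  finally have total_le: "1 - exp (- (t/12) * h0) \<le> (\<Sum>s\<in>?I. bern_ex ?E pr (\<lambda>\<omega>. of_bool (?sd s \<omega>)))" using big by simp
  have "\<exists>s\<in>?I. (1 - exp (- (t/12) * h0)) / (2 * real K) \<le> bern_ex ?E pr (\<lambda>\<omega>. of_bool (?sd s \<omega>))"
  proof (rule ccontr)
    assume "\<not> ?thesis"
    then have lt: "\<forall>s\<in>?I. bern_ex ?E pr (\<lambda>\<omega>. of_bool (?sd s \<omega>)) < (1 - exp (- (t/12) * h0)) / (2 * real K)"
      by (meson not_le)
    then have "(\<Sum>s\<in>?I. bern_ex ?E pr (\<lambda>\<omega>. of_bool (?sd s \<omega>))) < (\<Sum>s\<in>?I. (1 - exp (- (t/12) * h0)) / (2 * real K))"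
    proof (intro sum_strict_mono)
      show "?I \<noteq> {}" using K_pos by auto
    qed (use lt in \<open>blast+\<close>)
    also have "\<dots> = 1 - exp (- (t/12) * h0)" using K_pos by (simp add: card_cartesian_product)
    finally show False using total_le by simp
  qed
  then show "\<exists>x0. \<exists>i\<in>{0, 1}. (1 - exp (- (t/12) * h0)) / (2 * real K)
       \<le> bern_ex ?E pr (\<lambda>\<omega>. of_bool (seeded x0 w i (\<nu> / (4 * real K) / \<gamma>) \<omega>))"
    unfolding m_def by auto
qed

end

subsection \<open>Block construction\<close>

lemma disjoint_family_onI':
  assumes "\<And>i j s. i \<in> I \<Longrightarrow> j \<in> I \<Longrightarrow> s \<in> A i \<Longrightarrow> s \<in> A j \<Longrightarrow> i = j"
  shows "disjoint_family_on A I"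
  unfolding disjoint_family_on_def using assms by blast

lemma goodbox_mono: "goodbox n z Z \<Longrightarrow> Z \<subseteq> Z' \<Longrightarrow> goodbox n z Z'"
proof (induction n arbitrary: z)
  case (Suc n)
  obtain d0 where d0: "d0 \<in> grid3" "\<forall>d\<in>grid3 - {d0}. goodbox n (child z d) Z" using Suc.prems(1) by auto
  then have "\<forall>d\<in>grid3 - {d0}. goodbox n (child z d) Z'" using Suc.IH Suc.prems(2) by blast
  then show ?case using d0(1) unfolding goodbox.simps by blast
qed auto

lemma bern_ex_member:
  assumes "finite E" "e \<in> E"
  shows "bern_ex E p (\<lambda>\<omega>. of_bool (e \<in> \<omega>)) = p e"
proof -
  have "bern_ex E p (\<lambda>\<omega>. of_bool (e \<in> \<omega>)) = bern_ex E p (\<lambda>\<omega>. of_bool (e \<in> \<omega> \<inter> {e}))"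
    by simp
  also have "\<dots> = bern_ex {e} p (\<lambda>\<omega>. of_bool (e \<in> \<omega>))"
    using assms by (intro bern_ex_Int) auto
  finally show ?thesis using bern_ex_insert[of "{}" e p] by simp
qed

text \<open>A bond counts as open as soon as one of its copies is. By the union bound this has
  probability at most the sum over the copies, so any q above that sum dominates.\<close>

lemma bern_ex_copies:
  fixes N :: nat
  assumes fin: "finite E" and pc: "is_prob ({..<N} \<times> E) pc" and q: "is_prob E q"
    and le: "\<And>e. e \<in> E \<Longrightarrow> (\<Sum>k<N. pc (k, e)) \<le> q e"
    and mono: "\<And>W W'. W \<subseteq> W' \<Longrightarrow> W' \<subseteq> E \<Longrightarrow> H W \<le> (H W' :: real)"
  shows "bern_ex ({..<N} \<times> E) pc (\<lambda>\<omega>. H (snd ` \<omega>)) \<le> bern_ex E q H"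
proof -
  let ?F = "\<lambda>e. {..<N} \<times> {e}"
  have U: "{..<N} \<times> E = (\<Union>e\<in>E. ?F e)" by auto
  have "bern_ex ({..<N} \<times> E) pc (\<lambda>\<omega>. H (snd ` \<omega>)) = bern_ex (\<Union>e\<in>E. ?F e) pc (\<lambda>\<omega>. H {e\<in>E. \<omega> \<inter> ?F e \<noteq> {}})"
    unfolding U
  proof (rule bern_ex_cong[OF refl])
    fix \<omega> assume "\<omega> \<subseteq> (\<Union>e\<in>E. ?F e)"
    then have "snd ` \<omega> = {e\<in>E. \<omega> \<inter> ?F e \<noteq> {}}" by force
    then show "H (snd ` \<omega>) = H {e\<in>E. \<omega> \<inter> ?F e \<noteq> {}}" by simp
  qed
  also have "\<dots> = bern_ex E (\<lambda>e. bern_ex (?F e) pc (\<lambda>\<omega>. of_bool (\<omega> \<noteq> {}))) H"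
    by (rule bern_ex_indep_events[where X = "\<lambda>e \<omega>. \<omega> \<noteq> {}"]) (use fin in \<open>auto simp: disjoint_family_on_def\<close>)
  also have "\<dots> \<le> bern_ex E q H"
  proof (rule bern_ex_mono_prob[OF fin _ q])
    have pF: "is_prob (?F e) pc" if "e \<in> E" for e using pc that by (auto simp: is_prob_def)
    then show "is_prob E (\<lambda>e. bern_ex (?F e) pc (\<lambda>\<omega>. of_bool (\<omega> \<noteq> {})))"
      using bern_ex_of_bool_bounds[OF _ pF] unfolding is_prob_def by simp
    fix e assume e: "e \<in> E"
    have "bern_ex (?F e) pc (\<lambda>\<omega>. of_bool (\<omega> \<noteq> {})) \<le> bern_ex (?F e) pc (\<lambda>\<omega>. \<Sum>k<N. of_bool ((k, e) \<in> \<omega>))"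
    proof (rule bern_ex_mono[OF pF[OF e]])
      fix \<omega> assume \<omega>: "\<omega> \<subseteq> ?F e"
      show "of_bool (\<omega> \<noteq> {}) \<le> (\<Sum>k<N. of_bool ((k, e) \<in> \<omega>) :: real)"
      proof (cases "\<omega> = {}")
        case False
        then obtain k where "k < N" "(k, e) \<in> \<omega>" using \<omega> by auto
        then show ?thesis using member_le_sum[of k "{..<N}" "\<lambda>k. of_bool ((k, e) \<in> \<omega>) :: real"] by simp
      qed (simp add: sum_nonneg)
    qed
    also have "\<dots> = (\<Sum>k<N. pc (k, e))" unfolding bern_ex_sum by (intro sum.cong refl bern_ex_member) auto
    also have "\<dots> \<le> q e" by (rule le[OF e])
    finally show "bern_ex (?F e) pc (\<lambda>\<omega>. of_bool (\<omega> \<noteq> {})) \<le> q e" .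
  qed (use mono in auto)
  finally show ?thesis .
qed

lemma reach_image:
  assumes "reach \<omega> u v" shows "reach ((`) f ` \<omega>) (f u) (f v)"
  using assms unfolding reach_def
proof (induction rule: rtrancl_induct)
  case (step y z)
  then have "{y, z} \<in> \<omega>" by simp
  then have "f ` {y, z} \<in> (`) f ` \<omega>" by (rule imageI)
  then have "{f y, f z} \<in> (`) f ` \<omega>" by simp
  then have "(f y, f z) \<in> {(a, b). {a, b} \<in> (`) f ` \<omega>}" by simp
  with step.IH show ?case by (rule rtrancl_into_rtrancl)
qed simp

lemma seeded_shift:
  assumes "seeded x0 w i m \<omega>"
  shows "seeded (x0 + a) w (i + b) m ((`) (\<lambda>(x, j). (x + a, j + b)) ` \<omega>)"
proof -
  let ?f = "\<lambda>(x, j). (x + a, j + b) :: int \<times> int"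
  obtain S where S: "S \<subseteq> {x0..<x0 + w} \<times> {i}" "m \<le> real (card S)" "\<forall>u\<in>S. \<forall>v\<in>S. reach \<omega> u v"
    using assms unfolding seeded_def by auto
  have "inj_on ?f S" by (auto simp: inj_on_def)
  then have "card (?f ` S) = card S" by (rule card_image)
  moreover have "?f ` S \<subseteq> {x0 + a..<x0 + a + w} \<times> {i + b}" using S(1) by auto
  moreover have "\<forall>u\<in>?f ` S. \<forall>v\<in>?f ` S. reach ((`) ?f ` \<omega>) u v"
  proof (intro ballI)
    fix u v assume "u \<in> ?f ` S" "v \<in> ?f ` S"
    then obtain u' v' where "u = ?f u'" "v = ?f v'" "u' \<in> S" "v' \<in> S" by blast
    then show "reach ((`) ?f ` \<omega>) u v" using S(3) reach_image[of \<omega> u' v' ?f] by simp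
  qed
  ultimately show ?thesis unfolding seeded_def using S(2) by metis
qed

text \<open>An unordered pair forgets its orientation; summing over both orders and halving recovers
  a symmetric F without choosing ends.\<close>

definition bond :: "('v \<Rightarrow> 'v \<Rightarrow> real) \<Rightarrow> 'v set \<Rightarrow> real" where
  "bond F e = (\<Sum>u\<in>e. \<Sum>v\<in>e - {u}. F u v) / 2"

lemma bond_doubleton: "u \<noteq> v \<Longrightarrow> F u v = F v u \<Longrightarrow> bond F {u, v} = F u v"
proof -
  assume a: "u \<noteq> v" "F u v = F v u"
  then have "{u, v} - {u} = {v}" "{u, v} - {v} = {u}" by auto
  then show ?thesis using a by (simp add: bond_def)
qed

definition horizontal :: "(int \<times> int) set \<Rightarrow> bool" where
  "horizontal e \<longleftrightarrow> (\<exists>x y i. x \<noteq> y \<and> e = {(x, i), (y, i)})"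

definition vertical :: "(int \<times> int) set \<Rightarrow> bool" where
  "vertical e \<longleftrightarrow> (\<exists>x i. e = {(x, i), (x, i + 1)})"

context kernel
begin

text \<open>Every bond is split into five parallel copies. Copy 0 builds the clusters inside the blocks, the
  copies 1 to 4 are kept for the links between blocks; a horizontal bond has total probability
  \<open>(1 - t/32) \<kappa>\<close>, which leaves room for \<open>tanh \<kappa> < \<kappa>\<close>.\<close>

definition copy_prob :: "real \<Rightarrow> nat \<times> (int \<times> int) set \<Rightarrow> real" where
  "copy_prob t = (\<lambda>(k, e). bond (\<lambda>u v. if snd u = snd v
      then (if k = 0 then 1 - t/16 else t/128) * \<kappa> (fst u - fst v) else t) e)"

lemma \<kappa>_sym: "\<kappa> (x - y) = \<kappa> (y - x)"
  using even[of "x - y"] by simp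

lemma copy_prob_hor: "x \<noteq> y \<Longrightarrow> copy_prob t (k, {(x, i), (y, i)}) = (if k = 0 then 1 - t/16 else t/128) * \<kappa> (x - y)"
  unfolding copy_prob_def using \<kappa>_sym[of x y] by (simp add: bond_doubleton)

lemma copy_prob_vert: "i \<noteq> j \<Longrightarrow> copy_prob t (k, {(x, i), (x, j)}) = t"
  unfolding copy_prob_def by (simp add: bond_doubleton)

lemma copy_prob_01:
  assumes "0 < t" "t \<le> 1" "horizontal e \<or> vertical e"
  shows "0 \<le> copy_prob t (k, e) \<and> copy_prob t (k, e) \<le> 1"
proof -
  have "\<kappa> z \<le> 1" for z using sum_kernel_le_1[of "{0}" z] by simp
  moreover have "0 \<le> (if k = 0 then 1 - t/16 else t/128) \<and> (if k = 0 then 1 - t/16 else t/128) \<le> 1"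
    using assms by simp
  ultimately have "0 \<le> (if k = 0 then 1 - t/16 else t/128) * \<kappa> z \<and> (if k = 0 then 1 - t/16 else t/128) * \<kappa> z \<le> 1" for z
    using nonneg by (metis mult_le_one mult_nonneg_nonneg)
  note * = this
  have hor: "0 \<le> copy_prob t (k, {(x, i), (y, i)}) \<and> copy_prob t (k, {(x, i), (y, i)}) \<le> 1" if "x \<noteq> y" for x y i
    unfolding copy_prob_hor[OF that] by (rule *)
  have "0 \<le> copy_prob t (k, {(x, i), (x, i + 1)}) \<and> copy_prob t (k, {(x, i), (x, i + 1)}) \<le> 1" for x i
    using copy_prob_vert[of i "i + 1"] assms by simp
  then show ?thesis using assms(3) hor unfolding horizontal_def vertical_def by blast
qed

end

text \<open>A block makes M attempts, each yielding a seed of size m with probability at least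
  \<delta>. After K shifts of the window, strips of half-width L no longer overlap. In
  \<open>link\<close>, the power of t pays for a vertical path through two layers of rows, the
  bracket bounds from below the chance of an open reserve bond from a site into a seed of size m,
  and the last factor m counts the trials.\<close>

locale blocks = kernel +
  fixes t \<delta> m :: real and K M :: nat and x0 i0 L w :: int
  assumes t: "0 < t" "t \<le> 1" and w_pos: "0 < w" and L_nonneg: "0 \<le> L"
    and cover: "2 * L + 1 \<le> int K * w" and M_pos: "0 < M"
    and near: "\<gamma> * of_int (2 * w) \<le> r" and i0: "i0 \<in> {0, 1}" and m_pos: "0 < m"
    and seed: "\<delta> \<le> bern_ex (strip_edges 0 1 {(0, 0)} ({-L..L} - {0})) (\<lambda>e. copy_prob t (0, e))
                  (\<lambda>\<omega>. of_bool (seeded x0 w i0 m \<omega>))"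
    and many: "(1 - \<delta>) ^ M \<le> 1/10000"
    and link: "exp (- (t ^ (4 * K * M) * (1 - exp (- (t/128 * c * \<gamma> * m))) * m)) \<le> 1/20000"
begin

abbreviation pc where "pc \<equiv> copy_prob t"

definition R :: int where "R = int (2 * K * M)"

text \<open>The right and the upper neighbour both move the window by one, so every link joins
  adjacent disjoint windows and all links have the same geometry. Distinct blocks with equal windows
  lie in different layers.\<close>

definition win :: "site \<Rightarrow> int" where "win z = fst z + snd z"

definition cols :: "int \<Rightarrow> int set" where "cols n = {x0 + n * w..<x0 + n * w + w}"

text \<open>Blocks whose columns overlap have windows that differ modulo \<open>K\<close>, so they use different pairs of
  rows of their layer of \<open>R = 2 K M\<close> rows.\<close>

definition base :: "site \<Rightarrow> nat \<Rightarrow> int" where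
  "base z k = snd z * R + 2 * ((win z mod int K) * int M + int k)"

definition shift :: "site \<Rightarrow> nat \<Rightarrow> site set \<Rightarrow> site set" where
  "shift z k = (`) (\<lambda>(x, j). (x + win z * w, j + base z k))"

definition E0 :: "site set set" where "E0 = strip_edges 0 1 {(0, 0)} ({-L..L} - {0})"

definition seed_edges :: "site \<Rightarrow> nat \<Rightarrow> (nat \<times> site set) set" where
  "seed_edges z k = (\<lambda>e. (0, shift z k e)) ` E0"

definition block_edges :: "site \<Rightarrow> (nat \<times> site set) set" where
  "block_edges z = (\<Union>k<M. seed_edges z k)"

definition seeded_row :: "site \<Rightarrow> nat \<Rightarrow> (nat \<times> site set) set \<Rightarrow> bool" where
  "seeded_row z k \<omega> \<longleftrightarrow> seeded (x0 + win z * w) w (i0 + base z k) m (snd ` \<omega>)"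

definition good_block :: "site \<Rightarrow> (nat \<times> site set) set \<Rightarrow> bool" where
  "good_block z \<omega> \<longleftrightarrow> (\<exists>k<M. seeded_row z k (\<omega> \<inter> seed_edges z k))"


text \<open>The links leaving a block use rows of its own layer and of the next one; the parity of the layer in
  the tag separates the links that share rows.\<close>

definition tag :: "site \<Rightarrow> nat \<Rightarrow> nat" where "tag z d = 1 + nat (snd z mod 2) + 2 * d"

definition link_edges :: "site \<Rightarrow> nat \<Rightarrow> (nat \<times> site set) set" where
  "link_edges z d = {tag z d} \<times>
     ({{(x, l), (x, l + 1)} | x l. x \<in> cols (win z) \<and> l \<in> {snd z * R..<(snd z + 2) * R}}
    \<union> {{(x, l), (y, l)} | x y l. x \<in> cols (win z) \<and> y \<in> cols (win z + 1) \<and> l \<in> {snd z * R..<(snd z + 2) * R}})"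

lemma K_pos: "0 < K"
  using cover w_pos L_nonneg by (cases K) auto

lemma R_pos: "0 < R"
  using K_pos M_pos by (simp add: R_def)

lemma finite_E0: "finite E0"
  by (simp add: E0_def)

lemma finite_seed_edges [simp]: "finite (seed_edges z k)" and finite_block_edges [simp]: "finite (block_edges z)"
  using finite_E0 by (auto simp: seed_edges_def block_edges_def)

lemma E0_edge:
  assumes "e \<in> E0"
  shows "(horizontal e \<or> vertical e) \<and> e \<noteq> {} \<and> e \<subseteq> {-L..L} \<times> {0, 1}"
  using assms unfolding E0_def
proof (cases rule: strip_edges_cases)
  case (hor x y i)
  then have "x \<noteq> y" by auto
  then show ?thesis using hor L_nonneg by (auto simp: horizontal_def)
next
  case (vert y)
  then have "e = {(y, 0), (y, 0 + 1)}" by simp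
  then have "vertical e" unfolding vertical_def by blast
  then show ?thesis using vert L_nonneg by auto
qed

lemma shift_edge:
  "horizontal e \<Longrightarrow> horizontal (shift z k e) \<and> pc (n, shift z k e) = pc (n, e)"
  "vertical e \<Longrightarrow> vertical (shift z k e) \<and> pc (n, shift z k e) = pc (n, e)"
proof -
  assume "horizontal e"
  then obtain x y i where e: "x \<noteq> y" "e = {(x, i), (y, i)}" by (auto simp: horizontal_def)
  then have s: "shift z k e = {(x + win z * w, i + base z k), (y + win z * w, i + base z k)}" by (simp add: shift_def)
  have ne: "x + win z * w \<noteq> y + win z * w" using e by simp
  then have "horizontal (shift z k e)" unfolding s horizontal_def by blast
  moreover have "pc (n, shift z k e) = pc (n, e)"
    using copy_prob_hor[OF ne] copy_prob_hor[OF e(1)] by (subst s, subst e(2)) simp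
  ultimately show "horizontal (shift z k e) \<and> pc (n, shift z k e) = pc (n, e)" ..
next
  assume "vertical e"
  then obtain x i where e: "e = {(x, i), (x, i + 1)}" by (auto simp: vertical_def)
  then have s: "shift z k e = {(x + win z * w, i + base z k), (x + win z * w, (i + base z k) + 1)}"
    by (simp add: shift_def add_ac)
  then have "vertical (shift z k e)" unfolding vertical_def by blast
  moreover have "pc (n, shift z k e) = pc (n, e)"
    using copy_prob_vert[of "i + base z k" "(i + base z k) + 1"] copy_prob_vert[of i "i + 1"] by (subst s, subst e) simp
  ultimately show "vertical (shift z k e) \<and> pc (n, shift z k e) = pc (n, e)" ..
qed

lemma shift_inj: "inj_on (shift z k) E0"
proof -
  have "inj (\<lambda>(x, j). (x + win z * w, j + base z k))" by (auto simp: inj_def)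
  then have "inj (shift z k)" unfolding shift_def inj_def by (simp add: inj_image_eq_iff inj_def)
  then show ?thesis by (rule inj_on_subset) simp
qed

text \<open>\<open>base\<close> is a mixed-radix code: halving a row index and dividing by M and K
  recovers the attempt, the window modulo K and the layer from any single vertex of an edge.\<close>

lemma seed_edges_rows:
  assumes "(n, e) \<in> seed_edges z k" "v \<in> e" "k < M"
  shows "n = 0" "snd v div 2 div int M div int K = snd z" "snd v div 2 div int M mod int K = win z mod int K"
    "snd v div 2 mod int M = int k" "\<bar>fst v - win z * w\<bar> \<le> L"
proof -
  obtain e0 where e0: "n = 0" "e0 \<in> E0" "e = shift z k e0" using assms(1) by (auto simp: seed_edges_def)
  then obtain x j where v: "(x, j) \<in> e0" "v = (x + win z * w, j + base z k)" using assms(2) by (auto simp: shift_def)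
  have xj: "x \<in> {-L..L}" "j \<in> {0, 1}" using E0_edge[OF e0(2)] v by auto
  have "j + base z k = j + 2 * ((snd z * int K + win z mod int K) * int M + int k)"
    by (simp add: base_def R_def algebra_simps)
  then have "snd v div 2 = (snd z * int K + win z mod int K) * int M + int k"
    using v(2) xj(2) by auto
  then have 1: "snd v div 2 div int M = snd z * int K + win z mod int K" "snd v div 2 mod int M = int k"
    using assms(3) M_pos by auto
  show "n = 0" "\<bar>fst v - win z * w\<bar> \<le> L" using e0 v xj by auto
  show "snd v div 2 mod int M = int k" by (rule 1)
  show "snd v div 2 div int M div int K = snd z" "snd v div 2 div int M mod int K = win z mod int K"
    unfolding 1 using K_pos by (auto simp: div_pos_pos_trivial)
qed

text \<open>The rows leave open only the window modulo K. Different windows congruent modulo K are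
  at least K w > 2 L columns apart, too far for two strips of half-width L to share a
  vertex.\<close>

lemma seed_edges_inj:
  assumes "(n, e) \<in> seed_edges z k" "(n, e) \<in> seed_edges z' k'" "k < M" "k' < M"
  shows "z = z' \<and> k = k'"
proof -
  have "e \<noteq> {}" using assms(1) E0_edge by (auto simp: seed_edges_def shift_def)
  then obtain v where v: "v \<in> e" by auto
  note a = seed_edges_rows[OF assms(1) v assms(3)] and b = seed_edges_rows[OF assms(2) v assms(4)]
  have s: "snd z = snd z'" "k = k'" "win z mod int K = win z' mod int K" using a b by auto
  have "win z = win z'"
  proof (rule ccontr)
    assume ne: "win z \<noteq> win z'"
    have "int K dvd (win z - win z')" using s(3) by (simp add: mod_eq_dvd_iff)
    then have "int K \<le> \<bar>win z - win z'\<bar>" using ne dvd_imp_le_int[of "win z - win z'" "int K"] by simp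
    then have "int K * w \<le> \<bar>win z - win z'\<bar> * w" using w_pos by (intro mult_right_mono) auto
    also have "\<dots> = \<bar>win z * w - win z' * w\<bar>" using w_pos by (simp add: abs_mult left_diff_distrib[symmetric])
    also have "\<dots> \<le> 2 * L" using a(5) b(5) by linarith
    finally show False using cover by simp
  qed
  then show ?thesis using s by (auto simp: win_def prod_eq_iff)
qed

lemma disjoint_seed_edges: "disjoint_family_on (seed_edges z) {..<M}"
proof (rule disjoint_family_onI')
  fix k k' s assume "k \<in> {..<M}" "k' \<in> {..<M}" "s \<in> seed_edges z k" "s \<in> seed_edges z k'"
  then show "k = k'" using seed_edges_inj[of "fst s" "snd s" z k z k'] by simp
qed

lemma disjoint_block_edges: "disjoint_family_on block_edges I"
proof (rule disjoint_family_onI')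
  fix z z' s assume s: "s \<in> block_edges z" "s \<in> block_edges z'"
  obtain k where "k < M" "s \<in> seed_edges z k" using s(1) unfolding block_edges_def by auto
  moreover obtain k' where "k' < M" "s \<in> seed_edges z' k'" using s(2) unfolding block_edges_def by auto
  ultimately show "z = z'" using seed_edges_inj[of "fst s" "snd s" z k z' k'] by simp
qed

lemma block_edges_edge: "(n, e) \<in> block_edges z \<Longrightarrow> n = 0 \<and> (horizontal e \<or> vertical e)"
proof -
  assume "(n, e) \<in> block_edges z"
  then obtain k e0 where *: "n = 0" "e0 \<in> E0" "e = shift z k e0" by (auto simp: block_edges_def seed_edges_def)
  have "horizontal e0 \<or> vertical e0" using E0_edge[OF *(2)] by simp
  then show ?thesis unfolding *(1,3) using shift_edge[of e0 z k 0] by argo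
qed

lemma seeded_row_prob:
  "\<delta> \<le> bern_ex (seed_edges z k) pc (\<lambda>\<omega>. of_bool (seeded_row z k \<omega>))"
proof -
  have E0_prob: "is_prob E0 (\<lambda>e. pc (0, e))" using E0_edge copy_prob_01 t by (auto simp: is_prob_def)
  let ?g = "\<lambda>e. (0::nat, shift z k e)"
  have inj: "inj_on ?g E0" using shift_inj by (auto simp: inj_on_def)
  have "\<delta> \<le> bern_ex E0 (\<lambda>e. pc (0, e)) (\<lambda>\<omega>. of_bool (seeded x0 w i0 m \<omega>))" using seed by (simp add: E0_def)
  also have "\<dots> \<le> bern_ex E0 (\<lambda>e. pc (0, e)) (\<lambda>\<omega>. of_bool (seeded_row z k (?g ` \<omega>)))"
  proof (rule bern_ex_mono[OF E0_prob])
    fix \<omega>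
    have "snd ` ?g ` \<omega> = (`) (\<lambda>(x, j). (x + win z * w, j + base z k)) ` \<omega>" by (simp add: image_image shift_def)
    then have "seeded x0 w i0 m \<omega> \<Longrightarrow> seeded_row z k (?g ` \<omega>)"
      using seeded_shift[of x0 w i0 m \<omega>] by (simp add: seeded_row_def)
    then show "of_bool (seeded x0 w i0 m \<omega>) \<le> (of_bool (seeded_row z k (?g ` \<omega>)) :: real)" by auto
  qed
  also have "\<dots> = bern_ex E0 (\<lambda>e. pc (?g e)) (\<lambda>\<omega>. of_bool (seeded_row z k (?g ` \<omega>)))"
  proof (rule bern_ex_cong)
    fix e assume "e \<in> E0"
    then have "horizontal e \<or> vertical e" using E0_edge[of e] by simp
    then show "pc (0, e) = pc (?g e)" using shift_edge(1)[of e z k 0] shift_edge(2)[of e z k 0] by argo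
  qed simp
  also have "\<dots> = bern_ex (seed_edges z k) pc (\<lambda>\<omega>. of_bool (seeded_row z k \<omega>))"
    unfolding seed_edges_def using finite_E0 inj by (rule bern_ex_reindex[symmetric])
  finally show ?thesis .
qed

lemma block_prob: "is_prob (block_edges z) pc"
  unfolding is_prob_def
proof
  fix s assume "s \<in> block_edges z"
  moreover obtain n e where s: "s = (n, e)" by (cases s)
  ultimately show "0 \<le> pc s \<and> pc s \<le> 1"
    using block_edges_edge[of n e z] copy_prob_01[OF t, of e n] by simp
qed

lemma good_block_prob: "9999/10000 \<le> bern_ex (block_edges z) pc (\<lambda>\<omega>. of_bool (good_block z \<omega>))"
proof -
  let ?P = "\<lambda>k. bern_ex (seed_edges z k) pc (\<lambda>\<omega>. of_bool (seeded_row z k \<omega>))"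
  have le1: "?P k \<le> 1" if "k < M" for k
  proof -
    have "seed_edges z k \<subseteq> block_edges z" using that by (auto simp: block_edges_def)
    then show ?thesis using is_prob_subset[OF block_prob] by (intro bern_ex_of_bool_bounds) auto
  qed
  have "bern_ex (block_edges z) pc (\<lambda>\<omega>. of_bool (\<not> good_block z \<omega>))
     = bern_ex (block_edges z) pc (\<lambda>\<omega>. of_bool (\<forall>k\<in>{..<M}. \<not> seeded_row z k (\<omega> \<inter> seed_edges z k)))"
    by (intro bern_ex_cong refl) (auto simp: good_block_def)
  also have "\<dots> = (\<Prod>k<M. 1 - ?P k)"
    unfolding block_edges_def by (rule bern_ex_none) (auto simp: disjoint_seed_edges)
  also have "\<dots> \<le> (\<Prod>k<M. 1 - \<delta>)"
    using le1 seeded_row_prob by (intro prod_mono) auto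
  also have "\<dots> \<le> 1/10000" using many by simp
  finally show ?thesis by (simp add: bern_ex_of_bool_not)
qed

section \<open>Links between neighbouring blocks\<close>

lemma int_div_eq_iff:
  assumes "0 < (b::int)" shows "a div b = n \<longleftrightarrow> n * b \<le> a \<and> a < n * b + b"
proof
  assume "a div b = n"
  then have "n * b + a mod b = a" using div_mult_mod_eq[of a b] by simp
  then show "n * b \<le> a \<and> a < n * b + b"
    using pos_mod_bound[OF assms, of a] pos_mod_sign[OF assms, of a] by linarith
next
  assume a: "n * b \<le> a \<and> a < n * b + b"
  have "a = b * n + (a - n * b)" by (simp add: mult.commute)
  then show "a div b = n" by (rule int_div_pos_eq) (use a in simp_all)
qed

lemma cols_div: "x \<in> cols n \<longleftrightarrow> (x - x0) div w = n"
  unfolding int_div_eq_iff[OF w_pos] cols_def by auto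

lemma cols_less: "x \<in> cols n \<Longrightarrow> y \<in> cols (n + 1) \<Longrightarrow> x < y \<and> y - x < 2 * w"
proof -
  have "(n + 1) * w = n * w + w" by (simp add: distrib_right)
  then show "x \<in> cols n \<Longrightarrow> y \<in> cols (n + 1) \<Longrightarrow> x < y \<and> y - x < 2 * w"
    unfolding cols_def by auto
qed

lemma link_edges_cases [consumes 1, case_names vert hor]:
  assumes "(n, e) \<in> link_edges z d"
  obtains x l where "n = tag z d" "e = {(x, l), (x, l + 1)}" "x \<in> cols (win z)" "l \<in> {snd z * R..<(snd z + 2) * R}"
    | x y l where "n = tag z d" "e = {(x, l), (y, l)}" "x \<in> cols (win z)" "y \<in> cols (win z + 1)" "l \<in> {snd z * R..<(snd z + 2) * R}"
  using assms unfolding link_edges_def by blast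

text \<open>The leftmost column of a bond gives the window and the lowest row gives the layer up to
  one; the parity stored in the tag decides between the two candidates. Window and layer determine
  the block.\<close>

lemma link_edges_unique:
  assumes "(n, e) \<in> link_edges z d" "(n, e) \<in> link_edges z' d'" "d < 2" "d' < 2"
  shows "z = z'"
proof -
  have *: "(Min (fst ` e) - x0) div w = win z \<and> (Min (snd ` e) div R = snd z \<or> Min (snd ` e) div R = snd z + 1)
     \<and> n = tag z d \<and> finite e" if le: "(n, e) \<in> link_edges z d" for z d
  proof -
    from le have "n = tag z d \<and> (\<exists>x l. Min (fst ` e) = x \<and> Min (snd ` e) = l \<and> x \<in> cols (win z) \<and> l \<in> {snd z * R..<(snd z + 2) * R} \<and> finite e)"
    proof (cases rule: link_edges_cases)
      case (hor x y l)
      then have "Min (fst ` e) = x" "Min (snd ` e) = l" "finite e" using cols_less[OF hor(3,4)] by auto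
      then show ?thesis using hor by blast
    next
      case (vert x l)
      then have "Min (fst ` e) = x" "Min (snd ` e) = l" "finite e" by auto
      then show ?thesis using vert by blast
    qed
    then obtain x l where xl: "Min (fst ` e) = x" "Min (snd ` e) = l" "x \<in> cols (win z)" "l \<in> {snd z * R..<(snd z + 2) * R}" "finite e"
      and n: "n = tag z d" by blast
    have "l div R = snd z \<or> l div R = snd z + 1"
      using xl(4) unfolding int_div_eq_iff[OF R_pos] by (auto simp: algebra_simps)
    then show ?thesis using xl n cols_div by auto
  qed
  have parity: "a = b" if "a < 2" "b < 2" "1 + a + 2 * d = 1 + b + 2 * d'" for a b d d' :: nat
    using that by presburger
  have near: "a = b" if "a mod 2 = b mod 2" "a - b = -1 \<or> a - b = 0 \<or> a - b = 1" for a b :: int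
    using that by presburger
  have tags: "tag z d = tag z' d'" using *[OF assms(1)] *[OF assms(2)] by auto
  have "snd z mod 2 = snd z' mod 2"
  proof -
    have "nat (snd z mod 2) < 2" "nat (snd z' mod 2) < 2" by auto
    then have "nat (snd z mod 2) = nat (snd z' mod 2)" using tags unfolding tag_def by (rule parity)
    then show ?thesis by (simp add: eq_nat_nat_iff)
  qed
  moreover have "snd z - snd z' = -1 \<or> snd z - snd z' = 0 \<or> snd z - snd z' = 1" using *[OF assms(1)] *[OF assms(2)] by linarith
  ultimately have "snd z = snd z'" by (rule near)
  moreover have "win z = win z'" using *[OF assms(1)] *[OF assms(2)] by auto
  ultimately show ?thesis by (auto simp: win_def prod_eq_iff)
qed

definition all_links :: "site \<Rightarrow> (nat \<times> site set) set" where
  "all_links z = link_edges z 0 \<union> link_edges z 1"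

lemma disjoint_all_links: "disjoint_family_on all_links I"
proof (rule disjoint_family_onI')
  fix z z' s assume s: "s \<in> all_links z" "s \<in> all_links z'"
  have ex: "\<exists>d<2. s \<in> link_edges y d" if "s \<in> all_links y" for y
    using that unfolding all_links_def by (elim UnE) (rule exI[of _ 0], simp, rule exI[of _ 1], simp)
  obtain d where "d < 2" "s \<in> link_edges z d" using ex[OF s(1)] by blast
  moreover obtain d' where "d' < 2" "s \<in> link_edges z' d'" using ex[OF s(2)] by blast
  ultimately show "z = z'" using link_edges_unique[of "fst s" "snd s" z d z' d'] by simp
qed

lemma link_edges_edge: "(n, e) \<in> link_edges z d \<Longrightarrow> d < 2 \<Longrightarrow> 1 \<le> n \<and> n < 5 \<and> (horizontal e \<or> vertical e)"
proof -
  assume a: "(n, e) \<in> link_edges z d" "d < 2"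
  have m: "nat (snd z mod 2) < 2" by auto
  have "n = tag z d" using a(1) by (cases rule: link_edges_cases)
  then have n: "1 \<le> n" "n < 5" using m a(2) unfolding tag_def by linarith+
  from a(1) have "horizontal e \<or> vertical e"
  proof (cases rule: link_edges_cases)
    case (vert x l)
    then show ?thesis unfolding vertical_def by blast
  next
    case (hor x y l)
    then have "x \<noteq> y" using cols_less by blast
    then show ?thesis using hor(2) unfolding horizontal_def by blast
  qed
  with n show ?thesis by simp
qed

lemma finite_link_edges [simp]: "finite (link_edges z d)"
proof (rule finite_subset)
  let ?V = "(cols (win z) \<union> cols (win z + 1)) \<times> {snd z * R..(snd z + 2) * R}"
  show "link_edges z d \<subseteq> {tag z d} \<times> Pow ?V"
  proof
    fix s assume "s \<in> link_edges z d"
    then obtain n e where s: "s = (n, e)" "(n, e) \<in> link_edges z d" by (cases s) auto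
    from s(2) show "s \<in> {tag z d} \<times> Pow ?V"
      by (cases rule: link_edges_cases) (auto simp: s(1))
  qed
qed (simp add: cols_def)

lemma link_prob: assumes "d < 2" shows "is_prob (link_edges z d) pc"
  unfolding is_prob_def
proof
  fix s assume "s \<in> link_edges z d"
  moreover obtain n e where s: "s = (n, e)" by (cases s)
  ultimately show "0 \<le> pc s \<and> pc s \<le> 1"
    using link_edges_edge[OF _ assms, of n e z] copy_prob_01[OF t, of e n] by simp
qed

end

lemma reach_column:
  assumes "\<forall>l\<in>{lo..<hi}. {(x, l), (x, l + 1)} \<in> W" "lo \<le> (l::int)" "l \<le> hi"
  shows "reach W (x, lo) (x, l)"
  using assms(2,3)
proof (induction l rule: int_ge_induct)
  case (step l)
  have "{(x, l), (x, l + 1)} \<in> W" using assms(1) step by auto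
  then show ?case using step reach_trans reach_edge by (metis add_increasing2 le_add_same_cancel1 order_trans zero_le_one)
qed simp

context blocks
begin

lemma base_range:
  assumes "k < M" shows "snd z * R \<le> base z k \<and> base z k + 1 < (snd z + 1) * R"
proof -
  let ?a = "win z mod int K"
  have a: "0 \<le> ?a" "?a \<le> int K - 1" using K_pos pos_mod_bound[of "int K" "win z"] by simp_all
  have "?a * int M \<le> (int K - 1) * int M" using a by (intro mult_right_mono) auto
  then have "?a * int M + int k < int K * int M" using assms by (simp add: left_diff_distrib)
  then have "2 * (?a * int M + int k) + 1 < R" by (simp add: R_def)
  then show ?thesis using a by (simp add: base_def distrib_right)
qed

lemma good_block_seed:
  assumes "good_block z \<omega>"
  shows "\<exists>S i. S \<subseteq> cols (win z) \<times> {i} \<and> i \<in> {snd z * R..<(snd z + 1) * R} \<and> m \<le> real (card S)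
           \<and> (\<forall>u\<in>S. \<forall>v\<in>S. reach (snd ` \<omega>) u v)"
proof -
  obtain k where k: "k < M" "seeded_row z k (\<omega> \<inter> seed_edges z k)" using assms by (auto simp: good_block_def)
  then obtain S where S: "S \<subseteq> cols (win z) \<times> {i0 + base z k}" "m \<le> real (card S)"
    "\<forall>u\<in>S. \<forall>v\<in>S. reach (snd ` (\<omega> \<inter> seed_edges z k)) u v"
    unfolding seeded_row_def seeded_def cols_def by auto
  have "i0 + base z k \<in> {snd z * R..<(snd z + 1) * R}" using base_range[OF k(1), of z] i0 by auto
  moreover have "\<forall>u\<in>S. \<forall>v\<in>S. reach (snd ` \<omega>) u v"
  proof (intro ballI)
    fix u v assume "u \<in> S" "v \<in> S"
    then have "reach (snd ` (\<omega> \<inter> seed_edges z k)) u v" using S(3) by blast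
    then show "reach (snd ` \<omega>) u v" by (rule reach_mono) auto
  qed
  ultimately show ?thesis using S by blast
qed

text \<open>Each column of the first seed makes one trial: all its vertical bonds between the rows i
  and i' are open and some horizontal bond of row i' reaches the second seed. The bonds of a trial
  meet the window of z only in that column, so the trials are independent. With at least m trials of
  success probability at least \<pi>, failure has probability at most exp (- \<pi> m).\<close>

lemma seeds_link:
  assumes S: "S \<subseteq> cols (win z) \<times> {i}" "m \<le> real (card S)" "i \<in> {snd z * R..<(snd z + 2) * R}"
    and S': "S' \<subseteq> cols (win z + 1) \<times> {i'}" "m \<le> real (card S')" "i' \<in> {snd z * R..<(snd z + 2) * R}"
    and d: "d < 2"
  shows "bern_ex (link_edges z d) pc (\<lambda>\<omega>. of_bool (\<not> (\<exists>u\<in>S. \<exists>v\<in>S'. reach (snd ` \<omega>) u v))) \<le> 1/20000"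
proof -
  define n where "n = tag z d"
  define T where "T = fst ` S"
  define T' where "T' = fst ` S'"
  define lo where "lo = min i i'"
  define hi where "hi = max i i'"
  define V where "V x = (\<lambda>l. (n, {(x, l), (x, l + 1)})) ` {lo..<hi}" for x :: int
  define Hz where "Hz x = (\<lambda>y. (n, {(x, i'), (y, i')})) ` T'" for x :: int
  define F where "F x = V x \<union> Hz x" for x
  define Y where "Y x \<omega> \<longleftrightarrow> V x \<subseteq> \<omega> \<and> Hz x \<inter> \<omega> \<noteq> {}" for x and \<omega> :: "(nat \<times> site set) set"
  have finc: "finite (cols n)" for n by (simp add: cols_def)
  have SS: "S = T \<times> {i}" "S' = T' \<times> {i'}" using S(1) S'(1) unfolding T_def T'_def by force+
  have T: "T \<subseteq> cols (win z)" "T' \<subseteq> cols (win z + 1)" using S(1) S'(1) by (auto simp: T_def T'_def)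
  have finT: "finite T" "finite T'" using T finc finite_subset by blast+
  have cT: "card T = card S" "card T' = card S'" unfolding SS by (simp_all add: card_cartesian_product)
  have TT': "x \<noteq> y" if "x \<in> T" "y \<in> T'" for x y using cols_less T that by blast
  have finF: "finite (V x)" "finite (Hz x)" "finite (F x)" for x using finT by (auto simp: V_def Hz_def F_def)
  have rows: "{lo..<hi} \<subseteq> {snd z * R..<(snd z + 2) * R}" using S(3) S'(3) by (auto simp: lo_def hi_def)
  have F_sub: "F x \<subseteq> link_edges z d" if "x \<in> T" for x
  proof
    fix s assume "s \<in> F x"
    then consider l where "l \<in> {lo..<hi}" "s = (n, {(x, l), (x, l + 1)})" | y where "y \<in> T'" "s = (n, {(x, i'), (y, i')})"
      by (auto simp: F_def V_def Hz_def)
    then show "s \<in> link_edges z d"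
    proof cases
      case 1
      then show ?thesis using rows that T unfolding link_edges_def n_def by blast
    next
      case 2
      then show ?thesis using S'(3) that T unfolding link_edges_def n_def by blast
    qed
  qed
  have prF: "is_prob (F x) pc" if "x \<in> T" for x using is_prob_subset[OF link_prob[OF d] F_sub[OF that]] .
  have F_cols: "fst ` snd s \<inter> cols (win z) = {x}" if "s \<in> F x" "x \<in> T" for s x
  proof -
    have "y \<notin> cols (win z)" if "y \<in> T'" for y using that T cols_div by auto
    then show ?thesis using that T by (auto simp: F_def V_def Hz_def)
  qed
  have disjF: "disjoint_family_on F T"
    unfolding disjoint_family_on_def
  proof (intro ballI impI)
    fix x y assume xy: "x \<in> T" "y \<in> T" "x \<noteq> y"
    show "F x \<inter> F y = {}"
    proof (rule ccontr)
      assume "F x \<inter> F y \<noteq> {}"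
      then obtain s where "s \<in> F x" "s \<in> F y" by blast
      then have "{x} = {y}" using F_cols xy by metis
      then show False using xy by simp
    qed
  qed
  define \<pi> where "\<pi> = t ^ (4 * K * M) * (1 - exp (- (t/128 * c * \<gamma> * m)))"
  have Yprob: "\<pi> \<le> bern_ex (F x) pc (\<lambda>\<omega>. of_bool (Y x \<omega>))" if x: "x \<in> T" for x
  proof -
    have VH: "V x \<inter> Hz x = {}" by (auto simp: V_def Hz_def doubleton_eq_iff)
    have "bern_ex (F x) pc (\<lambda>\<omega>. of_bool (Y x \<omega>))
       = bern_ex (F x) pc (\<lambda>\<omega>. of_bool (V x \<subseteq> \<omega> \<inter> V x) * of_bool (Hz x \<inter> (\<omega> \<inter> Hz x) \<noteq> {}))"
      by (intro bern_ex_cong refl) (auto simp: Y_def)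
    also have "\<dots> = bern_ex (V x) pc (\<lambda>\<omega>. of_bool (V x \<subseteq> \<omega>)) * bern_ex (Hz x) pc (\<lambda>\<omega>. of_bool (Hz x \<inter> \<omega> \<noteq> {}))"
      using finF VH by (intro bern_ex_indep_mult) (auto simp: F_def)
    also have "bern_ex (V x) pc (\<lambda>\<omega>. of_bool (V x \<subseteq> \<omega>)) = t ^ card (V x)"
    proof -
      have "bern_ex (V x) pc (\<lambda>\<omega>. of_bool (V x \<subseteq> \<omega>)) = bern_ex (V x) pc (\<lambda>\<omega>. \<Prod>e\<in>V x. if e \<in> \<omega> then 1 else 0)"
        using finF by (intro bern_ex_cong refl) (auto simp: prod_zero_iff)
      also have "\<dots> = (\<Prod>e\<in>V x. pc e * 1 + (1 - pc e) * 0)" using finF by (intro bern_ex_prod) auto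
      also have "\<dots> = (\<Prod>e\<in>V x. t)" by (intro prod.cong refl) (auto simp: V_def copy_prob_vert)
      finally show ?thesis by simp
    qed
    also have "bern_ex (Hz x) pc (\<lambda>\<omega>. of_bool (Hz x \<inter> \<omega> \<noteq> {})) = 1 - (\<Prod>e\<in>Hz x. 1 - pc e)"
    proof -
      have "bern_ex (Hz x) pc (\<lambda>\<omega>. of_bool (\<not> (Hz x \<inter> \<omega> \<noteq> {}))) = bern_ex (Hz x) pc (\<lambda>\<omega>. \<Prod>e\<in>Hz x. if e \<in> \<omega> then 0 else 1)"
      proof (rule bern_ex_cong[OF refl])
        fix \<omega> :: "(nat \<times> site set) set"
        show "of_bool (\<not> (Hz x \<inter> \<omega> \<noteq> {})) = (\<Prod>e\<in>Hz x. if e \<in> \<omega> then 0 else 1 :: real)"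
        proof (cases "Hz x \<inter> \<omega> = {}")
          case True
          then have "(\<Prod>e\<in>Hz x. if e \<in> \<omega> then 0 else 1 :: real) = 1" by (intro prod.neutral) auto
          then show ?thesis using True by simp
        next
          case False
          then have "(\<Prod>e\<in>Hz x. if e \<in> \<omega> then 0 else 1 :: real) = 0" using finF by (intro prod_zero) auto
          then show ?thesis using False by simp
        qed
      qed
      also have "\<dots> = (\<Prod>e\<in>Hz x. pc e * 0 + (1 - pc e) * 1)" using finF by (intro bern_ex_prod) auto
      finally show ?thesis using finF by (subst (asm) bern_ex_of_bool_not) auto
    qed
    finally have eq: "bern_ex (F x) pc (\<lambda>\<omega>. of_bool (Y x \<omega>)) = t ^ card (V x) * (1 - (\<Prod>e\<in>Hz x. 1 - pc e))" .
    \<comment> \<open>The vertical path stays inside two layers, hence has at most 2 R = 4 K M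
      bonds.\<close>
    have "card (V x) \<le> card {lo..<hi}" unfolding V_def by (rule card_image_le) simp
    also have "\<dots> \<le> card {snd z * R..<(snd z + 2) * R}" using rows by (intro card_mono) auto
    also have "\<dots> = 4 * K * M" by (simp add: R_def algebra_simps nat_mult_distrib)
    finally have tV: "t ^ (4 * K * M) \<le> t ^ card (V x)" using t by (intro power_decreasing) auto
    have "(\<Prod>e\<in>Hz x. 1 - pc e) \<le> (\<Prod>e\<in>Hz x. exp (- (t/128 * c * \<gamma>)))"
    proof (rule prod_mono)
      fix e assume e: "e \<in> Hz x"
      then obtain y where y: "y \<in> T'" "e = (n, {(x, i'), (y, i')})" by (auto simp: Hz_def)
      have n0: "n \<noteq> 0" by (simp add: n_def tag_def)
      have lt: "x < y" "y - x < 2 * w" using cols_less[of x "win z" y] T x y by auto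
      \<comment> \<open>Sites of adjacent windows are less than 2 w apart, which \<open>near\<close>
        places within the radius r of the lower bound on the kernel.\<close>
      have "\<gamma> * \<bar>of_int (x - y)\<bar> \<le> \<gamma> * of_int (2 * w)"
        using lt \<gamma>_pos by (intro mult_left_mono) linarith+
      then have "c * \<gamma> \<le> \<kappa> (x - y)" using lt near by (intro lower) auto
      then have "t/128 * (c * \<gamma>) \<le> t/128 * \<kappa> (x - y)" using t by (intro mult_left_mono) auto
      then have "t/128 * c * \<gamma> \<le> pc e" unfolding y(2) using copy_prob_hor[of x y t n i'] lt n0 by simp
      moreover have "pc e \<le> 1" using prF[OF x] e by (auto simp: is_prob_def F_def)
      moreover have "1 - t/128 * c * \<gamma> \<le> exp (- (t/128 * c * \<gamma>))" using exp_ge_add_one_self[of "- (t/128 * c * \<gamma>)"] by simp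
      ultimately show "0 \<le> 1 - pc e \<and> 1 - pc e \<le> exp (- (t/128 * c * \<gamma>))" by linarith
    qed
    also have "\<dots> = exp (- (t/128 * c * \<gamma> * real (card (Hz x))))" by (simp add: exp_of_nat_mult[symmetric] mult_ac)
    also have "card (Hz x) = card T'" unfolding Hz_def by (rule card_image) (auto simp: inj_on_def doubleton_eq_iff)
    also have "exp (- (t/128 * c * \<gamma> * real (card T'))) \<le> exp (- (t/128 * c * \<gamma> * m))"
      using t c_pos \<gamma>_pos cT S'(2) by (simp add: mult_left_mono)
    finally have H: "1 - exp (- (t/128 * c * \<gamma> * m)) \<le> 1 - (\<Prod>e\<in>Hz x. 1 - pc e)" by simp
    have "0 \<le> t/128 * c * \<gamma> * m" using t c_pos \<gamma>_pos m_pos by simp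
    then show ?thesis unfolding eq \<pi>_def using tV H t by (intro mult_mono) auto
  qed
  have UF: "(\<Union>x\<in>T. F x) \<subseteq> link_edges z d" using F_sub by blast
  have "bern_ex (link_edges z d) pc (\<lambda>\<omega>. of_bool (\<not> (\<exists>u\<in>S. \<exists>v\<in>S'. reach (snd ` \<omega>) u v)))
     \<le> bern_ex (link_edges z d) pc (\<lambda>\<omega>. of_bool (\<forall>x\<in>T. \<not> Y x ((\<omega> \<inter> (\<Union>x\<in>T. F x)) \<inter> F x)))"
  proof (rule bern_ex_mono[OF link_prob[OF d]])
    fix \<omega>
    have "\<exists>u\<in>S. \<exists>v\<in>S'. reach (snd ` \<omega>) u v" if x: "x \<in> T" and y: "Y x ((\<omega> \<inter> (\<Union>x\<in>T. F x)) \<inter> F x)" for x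
    proof -
      have Vx: "V x \<subseteq> \<omega>" and "Hz x \<inter> \<omega> \<noteq> {}" using y by (auto simp: Y_def)
      then obtain y where y: "y \<in> T'" "(n, {(x, i'), (y, i')}) \<in> \<omega>" by (auto simp: Hz_def)
      have col: "\<forall>l\<in>{lo..<hi}. {(x, l), (x, l + 1)} \<in> snd ` \<omega>" using Vx by (force simp: V_def)
      have "reach (snd ` \<omega>) (x, lo) (x, hi)" using reach_column[OF col, of hi] by (auto simp: lo_def hi_def)
      then have "reach (snd ` \<omega>) (x, i) (x, i')"
        using reach_sym by (cases "i \<le> i'") (auto simp: lo_def hi_def min_def max_def)
      moreover have "reach (snd ` \<omega>) (x, i') (y, i')" using y(2) by (intro reach_edge) force
      ultimately have "reach (snd ` \<omega>) (x, i) (y, i')" by (rule reach_trans)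
      moreover have "(x, i) \<in> S" "(y, i') \<in> S'" using x y SS by auto
      ultimately show ?thesis by blast
    qed
    then show "of_bool (\<not> (\<exists>u\<in>S. \<exists>v\<in>S'. reach (snd ` \<omega>) u v))
      \<le> (of_bool (\<forall>x\<in>T. \<not> Y x ((\<omega> \<inter> (\<Union>x\<in>T. F x)) \<inter> F x)) :: real)" by auto
  qed
  also have "\<dots> = bern_ex (\<Union>x\<in>T. F x) pc (\<lambda>\<omega>. of_bool (\<forall>x\<in>T. \<not> Y x (\<omega> \<inter> F x)))"
    using UF by (intro bern_ex_Int[where f = "\<lambda>\<omega>. of_bool (\<forall>x\<in>T. \<not> Y x (\<omega> \<inter> F x))"]) auto
  also have "\<dots> = (\<Prod>x\<in>T. 1 - bern_ex (F x) pc (\<lambda>\<omega>. of_bool (Y x \<omega>)))"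
    using finT finF disjF by (intro bern_ex_none) auto
  also have "\<dots> \<le> (\<Prod>x\<in>T. exp (- \<pi>))"
  proof (rule prod_mono)
    fix x assume x: "x \<in> T"
    have "bern_ex (F x) pc (\<lambda>\<omega>. of_bool (Y x \<omega>)) \<le> 1" using bern_ex_of_bool_bounds[OF finF(3) prF[OF x]] by simp
    then show "0 \<le> 1 - bern_ex (F x) pc (\<lambda>\<omega>. of_bool (Y x \<omega>)) \<and> 1 - bern_ex (F x) pc (\<lambda>\<omega>. of_bool (Y x \<omega>)) \<le> exp (- \<pi>)"
      using Yprob[OF x] exp_ge_add_one_self[of "- \<pi>"] by linarith
  qed
  also have "\<dots> = exp (- (\<pi> * real (card T)))" by (simp add: exp_of_nat_mult[symmetric] mult_ac)
  also have "\<dots> \<le> exp (- (\<pi> * m))"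
  proof -
    have "0 \<le> t/128 * c * \<gamma> * m" using t c_pos \<gamma>_pos m_pos by simp
    then have "0 \<le> \<pi>" using t by (simp add: \<pi>_def)
    then show ?thesis using S(2) cT by (simp add: mult_left_mono)
  qed
  also have "\<dots> \<le> 1/20000" using link by (simp add: \<pi>_def)
  finally show ?thesis .
qed

section \<open>From good and linked blocks to long clusters\<close>

definition nb :: "site \<Rightarrow> nat \<Rightarrow> site" where
  "nb z d = (if d = 0 then (fst z + 1, snd z) else (fst z, snd z + 1))"

lemma win_nb [simp]: "win (nb z d) = win z + 1"
  by (simp add: win_def nb_def)

text \<open>Vacuous when an end lies outside G. Its probability is thus bounded below for every G
  and every choice of seeds, and the links can be treated as independent of which blocks are
  good.\<close>

definition linked :: "(site \<Rightarrow> site set) \<Rightarrow> site set \<Rightarrow> site \<Rightarrow> (nat \<times> site set) set \<Rightarrow> bool" where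
  "linked S G z \<omega> \<longleftrightarrow> (\<forall>d<2. z \<in> G \<and> nb z d \<in> G \<longrightarrow> (\<exists>u\<in>S z. \<exists>v\<in>S (nb z d). reach (snd ` \<omega>) u v))"

definition seed_family :: "(site \<Rightarrow> site set) \<Rightarrow> site set \<Rightarrow> bool" where
  "seed_family S G \<longleftrightarrow> (\<forall>z\<in>G. \<exists>i. S z \<subseteq> cols (win z) \<times> {i} \<and> i \<in> {snd z * R..<(snd z + 1) * R} \<and> m \<le> real (card (S z)))"

lemma finite_all_links [simp]: "finite (all_links z)"
  by (simp add: all_links_def)

lemma all_links_prob: "is_prob (all_links z) pc"
  using link_prob[of 0 z] link_prob[of 1 z] by (auto simp: all_links_def is_prob_def)

text \<open>The two directions share the failure probability 1/10000 equally.\<close>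

lemma linked_prob:
  assumes "seed_family S G"
  shows "9999/10000 \<le> bern_ex (all_links z) pc (\<lambda>\<omega>. of_bool (linked S G z \<omega>))"
proof -
  let ?N = "\<lambda>d \<omega>. z \<in> G \<and> nb z d \<in> G \<and> \<not> (\<exists>u\<in>S z. \<exists>v\<in>S (nb z d). reach (snd ` \<omega>) u v)"
  have sub: "link_edges z d \<subseteq> all_links z" if "d < 2" for d using that by (auto simp: all_links_def less_2_cases_iff)
  have one: "bern_ex (link_edges z d) pc (\<lambda>\<omega>. of_bool (?N d \<omega>)) \<le> 1/20000" if d: "d < 2" for d
  proof (cases "z \<in> G \<and> nb z d \<in> G")
    case True
    obtain i where i: "S z \<subseteq> cols (win z) \<times> {i}" "i \<in> {snd z * R..<(snd z + 1) * R}" "m \<le> real (card (S z))"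
      using assms True unfolding seed_family_def by blast
    obtain i' where i': "S (nb z d) \<subseteq> cols (win z + 1) \<times> {i'}" "i' \<in> {snd (nb z d) * R..<(snd (nb z d) + 1) * R}" "m \<le> real (card (S (nb z d)))"
      using assms True unfolding seed_family_def by (metis win_nb)
    have "i \<in> {snd z * R..<(snd z + 2) * R}" using i(2) R_pos by (auto simp: distrib_right)
    moreover have "i' \<in> {snd z * R..<(snd z + 2) * R}" using i'(2) R_pos by (auto simp: nb_def distrib_right split: if_splits)
    ultimately show ?thesis using True seeds_link[OF i(1,3) _ i'(1,3) _ d] by simp
  next
    case False
    then have "bern_ex (link_edges z d) pc (\<lambda>\<omega>. of_bool (?N d \<omega>)) = bern_ex (link_edges z d) pc (\<lambda>_. 0)"
      by (intro bern_ex_cong) auto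
    also have "\<dots> = 0" by simp
    finally show ?thesis by linarith
  qed
  have "bern_ex (all_links z) pc (\<lambda>\<omega>. of_bool (\<not> linked S G z \<omega>))
     \<le> bern_ex (all_links z) pc (\<lambda>\<omega>. of_bool (?N 0 (\<omega> \<inter> link_edges z 0)) + of_bool (?N 1 (\<omega> \<inter> link_edges z 1)))"
  proof (rule bern_ex_mono[OF all_links_prob])
    fix \<omega>
    have "?N 0 (\<omega> \<inter> link_edges z 0) \<or> ?N 1 (\<omega> \<inter> link_edges z 1)" if "\<not> linked S G z \<omega>"
    proof -
      obtain d where d: "d < 2" "?N d \<omega>" using \<open>\<not> linked S G z \<omega>\<close> unfolding linked_def by blast
      have "reach (snd ` (\<omega> \<inter> link_edges z d)) u v \<Longrightarrow> reach (snd ` \<omega>) u v" for u v by (erule reach_mono) auto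
      then have "?N d (\<omega> \<inter> link_edges z d)" using d(2) by blast
      then show ?thesis using d(1) by (auto simp: less_2_cases_iff)
    qed
    then show "of_bool (\<not> linked S G z \<omega>) \<le> (of_bool (?N 0 (\<omega> \<inter> link_edges z 0)) + of_bool (?N 1 (\<omega> \<inter> link_edges z 1)) :: real)"
      by (cases "linked S G z \<omega>") auto
  qed
  also have "\<dots> = bern_ex (link_edges z 0) pc (\<lambda>\<omega>. of_bool (?N 0 \<omega>)) + bern_ex (link_edges z 1) pc (\<lambda>\<omega>. of_bool (?N 1 \<omega>))"
    unfolding bern_ex_add
    by (intro arg_cong2[where f = "(+)"] bern_ex_Int finite_all_links sub) simp_all
  also have "\<dots> \<le> 1/10000" using one[of 0] one[of 1] by simp
  finally show ?thesis by (simp add: bern_ex_of_bool_not)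
qed

text \<open>The starting site ranges over a finite set that is the same for all n; it becomes the
  set V over which magnetizations are summed.\<close>

definition long_cluster :: "nat \<Rightarrow> site set set \<Rightarrow> bool" where
  "long_cluster n W \<longleftrightarrow> (\<exists>v\<in>cols 0 \<times> {0..<R}. \<exists>C. finite C \<and> n \<le> card C \<and> (\<forall>u\<in>C. reach W v u))"

lemma long_cluster_mono: "long_cluster n W \<Longrightarrow> W \<subseteq> W' \<Longrightarrow> long_cluster n W'"
  unfolding long_cluster_def by (meson reach_mono)

text \<open>Sites of one seed are connected, so one representative per block suffices and links
  connect the representatives of neighbouring blocks. The cluster of blocks maps injectively to
  representatives, because the window and the layer of a site determine its block.\<close>

lemma long_clusterI:
  assumes fam: "seed_family S G" and Z: "Z = G \<inter> {z. linked S G z \<omega>}"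
    and inner: "\<And>z u v. z \<in> G \<Longrightarrow> u \<in> S z \<Longrightarrow> v \<in> S z \<Longrightarrow> reach (snd ` \<omega>) u v"
    and good: "\<forall>l\<le>n. goodbox l (0, 0) Z"
  shows "long_cluster n (snd ` \<omega>)"
proof -
  let ?W = "snd ` \<omega>"
  have ne: "S z \<noteq> {}" if "z \<in> G" for z
    using fam that m_pos unfolding seed_family_def by force
  define rep where "rep z = (SOME u. u \<in> S z)" for z
  have rep: "rep z \<in> S z" if "z \<in> G" for z unfolding rep_def using ne[OF that] some_in_eq by blast
  have step: "reach ?W (rep z) (rep (nb z d))" if in_Z: "z \<in> Z" "nb z d \<in> Z" "d < 2" for z d
  proof -
    have zG: "z \<in> G" "nb z d \<in> G" using in_Z Z by auto
    obtain u v where uv: "u \<in> S z" "v \<in> S (nb z d)" "reach ?W u v"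
      using in_Z zG unfolding Z linked_def by blast
    have "reach ?W (rep z) u" "reach ?W v (rep (nb z d))" using inner rep zG uv by blast+
    then show ?thesis using uv(3) reach_trans by metis
  qed
  obtain C where C: "(0, 0) \<in> C" "C \<subseteq> Z" "finite C" "n \<le> card C" "\<And>u. u \<in> C \<Longrightarrow> reach ?W (rep (0, 0)) (rep u)"
  proof (rule hierarchical_cluster[where c = "\<lambda>u v. reach ?W (rep u) (rep v)" and Z = Z and n = n])
    show "equivp (\<lambda>u v. reach ?W (rep u) (rep v))"
      by (intro equivpI reflpI sympI transpI) (simp, erule reach_sym, erule (1) reach_trans)
    show "(i, j) \<in> Z \<Longrightarrow> (i + 1, j) \<in> Z \<Longrightarrow> reach ?W (rep (i, j)) (rep (i + 1, j))" for i j
      using step[of "(i, j)" 0] by (simp add: nb_def)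
    show "(i, j) \<in> Z \<Longrightarrow> (i, j + 1) \<in> Z \<Longrightarrow> reach ?W (rep (i, j)) (rep (i, j + 1))" for i j
      using step[of "(i, j)" 1] by (simp add: nb_def)
  qed (use good in auto)
  have place: "(fst (rep z) - x0) div w = win z \<and> snd (rep z) div R = snd z" if zG: "z \<in> G" for z
  proof -
    obtain i where i: "S z \<subseteq> cols (win z) \<times> {i}" "i \<in> {snd z * R..<(snd z + 1) * R}"
      using fam zG unfolding seed_family_def by blast
    have "rep z \<in> cols (win z) \<times> {i}" using rep[OF zG] i(1) by blast
    then have "fst (rep z) \<in> cols (win z)" "snd (rep z) = i" by (simp_all add: mem_Times_iff)
    moreover have "i div R = snd z" unfolding int_div_eq_iff[OF R_pos] using i(2) by (auto simp: distrib_right)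
    ultimately show ?thesis unfolding cols_div by simp
  qed
  have CG: "C \<subseteq> G" using C(2) Z by auto
  have "inj_on rep C"
  proof (rule inj_onI)
    fix z z' assume "z \<in> C" "z' \<in> C" "rep z = rep z'"
    then have "win z = win z'" "snd z = snd z'" using place CG by (metis subsetD)+
    then show "z = z'" by (simp add: win_def prod_eq_iff)
  qed
  then have "card (rep ` C) = card C" by (rule card_image)
  moreover have "rep (0, 0) \<in> cols 0 \<times> {0..<R}"
  proof -
    have "(0, 0) \<in> G" using C(1) CG by auto
    then have a: "(fst (rep (0, 0)) - x0) div w = 0" "snd (rep (0, 0)) div R = 0" using place[of "(0, 0)"] by (auto simp: win_def)
    from a(1) have "fst (rep (0, 0)) \<in> cols 0" unfolding cols_div .
    moreover from a(2) have "snd (rep (0, 0)) \<in> {0..<R}" unfolding int_div_eq_iff[OF R_pos] by simp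
    ultimately show ?thesis by (simp add: mem_Times_iff)
  qed
  moreover have "finite (rep ` C)" "\<forall>u\<in>rep ` C. reach ?W (rep (0, 0)) u" using C(3,5) by auto
  ultimately show ?thesis unfolding long_cluster_def using C(4) by (metis (no_types, lifting))
qed

text \<open>Copy 0 is revealed first and fixes the good blocks and their seeds. Links use only the
  copies 1 to 4, so they are independent of this, with a probability bounded uniformly over all
  possible seeds. Merging the copies extends the bound to every q above the sum of the five copy
  probabilities.\<close>

theorem percolation:
  obtains E where "finite E" "\<And>e. e \<in> E \<Longrightarrow> horizontal e \<or> vertical e"
    "\<And>q. is_prob E q \<Longrightarrow> (\<And>e. e \<in> E \<Longrightarrow> (\<Sum>k<5. pc (k, e)) \<le> q e) \<Longrightarrow>
       1/2 \<le> bern_ex E q (\<lambda>W. of_bool (long_cluster n W))"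
proof
  let ?I = "boxsites n (0, 0)"
  define A where "A = (\<Union>z\<in>?I. block_edges z)"
  define B where "B = (\<Union>z\<in>?I. all_links z)"
  define E where "E = snd ` (A \<union> B)"
  have finA: "finite A" and finB: "finite B" by (auto simp: A_def B_def)
  then show "finite E" by (simp add: E_def)
  have A_edge: "j = 0 \<and> (horizontal e \<or> vertical e)" if "(j, e) \<in> A" for j e
    using that block_edges_edge by (auto simp: A_def)
  have B_edge: "1 \<le> j \<and> j < 5 \<and> (horizontal e \<or> vertical e)" if "(j, e) \<in> B" for j e
    using that link_edges_edge[of j e _ 0] link_edges_edge[of j e _ 1] by (auto simp: B_def all_links_def)
  show edge: "horizontal e \<or> vertical e" if "e \<in> E" for e
  proof -
    have "\<exists>j. (j, e) \<in> A \<or> (j, e) \<in> B" using \<open>e \<in> E\<close> by (force simp: E_def)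
    then show ?thesis using A_edge B_edge by blast
  qed
  have AB: "A \<inter> B = {}" using A_edge B_edge by fastforce
  have sub: "A \<union> B \<subseteq> {..<5} \<times> E"
  proof
    fix s assume s: "s \<in> A \<union> B"
    obtain j e where "s = (j, e)" by (cases s)
    then show "s \<in> {..<5} \<times> E" using s A_edge[of j e] B_edge[of j e] unfolding E_def by force
  qed
  have prE: "is_prob ({..<5} \<times> E) pc" using edge copy_prob_01[OF t] by (auto simp: is_prob_def)
  have prA: "is_prob A pc" and prB: "is_prob B pc" using is_prob_subset[OF prE] sub by auto
  let ?\<rho> = "9999/10000 :: real"
  let ?H = "\<lambda>G. of_bool (\<forall>l\<le>n. goodbox l (0, 0) G) :: real"
  have H_mono: "?H G \<le> ?H G'" if "G \<subseteq> G'" for G G' using goodbox_mono[OF _ that] by auto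
  \<comment> \<open>A lower bound for the probability of success given the set G of good blocks. It
    is monotone in G, so the law of G may be replaced by a Bernoulli set of smaller density.\<close>
  define \<Phi> where "\<Phi> G = bern_ex ?I (\<lambda>_. ?\<rho>) (\<lambda>Lk. ?H (G \<inter> Lk))" for G
  have pr\<rho>: "is_prob X (\<lambda>_. ?\<rho>)" for X :: "site set" by (simp add: is_prob_def)
  have \<Phi>_mono: "\<Phi> G \<le> \<Phi> G'" if "G \<subseteq> G'" for G G'
    unfolding \<Phi>_def using that by (intro bern_ex_mono pr\<rho> H_mono) auto
  have inner_B: "\<Phi> {z\<in>?I. good_block z (\<omega> \<inter> block_edges z)} \<le> bern_ex B pc (\<lambda>\<omega>'. of_bool (long_cluster n (snd ` (\<omega> \<union> \<omega>'))))"
    for \<omega>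
  proof -
    define G where "G = {z\<in>?I. good_block z (\<omega> \<inter> block_edges z)}"
    have "\<forall>z\<in>G. \<exists>S. (\<exists>i. S \<subseteq> cols (win z) \<times> {i} \<and> i \<in> {snd z * R..<(snd z + 1) * R} \<and> m \<le> real (card S))
       \<and> (\<forall>u\<in>S. \<forall>v\<in>S. reach (snd ` (\<omega> \<inter> block_edges z)) u v)"
      unfolding G_def using good_block_seed by blast
    then obtain S where S: "\<forall>z\<in>G. (\<exists>i. S z \<subseteq> cols (win z) \<times> {i} \<and> i \<in> {snd z * R..<(snd z + 1) * R} \<and> m \<le> real (card (S z)))
       \<and> (\<forall>u\<in>S z. \<forall>v\<in>S z. reach (snd ` (\<omega> \<inter> block_edges z)) u v)" by metis
    have fam: "seed_family S G" using S unfolding seed_family_def by blast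
    have "\<Phi> G \<le> bern_ex ?I (\<lambda>z. bern_ex (all_links z) pc (\<lambda>\<omega>'. of_bool (linked S G z \<omega>'))) (\<lambda>Lk. ?H (G \<inter> Lk))"
      unfolding \<Phi>_def
    proof (rule bern_ex_mono_prob[OF _ pr\<rho>])
      show "is_prob ?I (\<lambda>z. bern_ex (all_links z) pc (\<lambda>\<omega>'. of_bool (linked S G z \<omega>')))"
        using bern_ex_of_bool_bounds[OF finite_all_links all_links_prob] by (simp add: is_prob_def)
      show "?\<rho> \<le> bern_ex (all_links z) pc (\<lambda>\<omega>'. of_bool (linked S G z \<omega>'))" for z
        by (rule linked_prob[OF fam])
      show "?H (G \<inter> X) \<le> ?H (G \<inter> Y)" if "X \<subseteq> Y" for X Y
        using that by (intro H_mono) auto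
    qed simp
    also have "\<dots> = bern_ex B pc (\<lambda>\<omega>'. ?H (G \<inter> {z\<in>?I. linked S G z (\<omega>' \<inter> all_links z)}))"
      unfolding B_def
      by (rule bern_ex_indep_events[symmetric, where H = "\<lambda>Lk. ?H (G \<inter> Lk)" and X = "\<lambda>z \<omega>'. linked S G z \<omega>'"])
        (auto simp: disjoint_all_links)
    also have "\<dots> \<le> bern_ex B pc (\<lambda>\<omega>'. of_bool (long_cluster n (snd ` (\<omega> \<union> \<omega>'))))"
    proof (rule bern_ex_mono[OF prB])
      fix \<omega>'
      let ?X = "\<omega> \<union> \<omega>'"
      have "long_cluster n (snd ` ?X)" if g: "\<forall>l\<le>n. goodbox l (0, 0) (G \<inter> {z\<in>?I. linked S G z (\<omega>' \<inter> all_links z)})"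
      proof (rule long_clusterI[OF fam refl])
        have mono_reach: "reach (snd ` (\<omega>' \<inter> all_links z)) u v \<Longrightarrow> reach (snd ` ?X) u v" for u v z
          by (erule reach_mono) auto
        have "G \<inter> {z\<in>?I. linked S G z (\<omega>' \<inter> all_links z)} \<subseteq> G \<inter> {z. linked S G z ?X}"
          unfolding linked_def using mono_reach by blast
        then show "\<forall>l\<le>n. goodbox l (0, 0) (G \<inter> {z. linked S G z ?X})" using g goodbox_mono by blast
        fix z u v assume "z \<in> G" "u \<in> S z" "v \<in> S z"
        then have "reach (snd ` (\<omega> \<inter> block_edges z)) u v" using S by blast
        then show "reach (snd ` ?X) u v" by (rule reach_mono) auto
      qed
      then show "?H (G \<inter> {z\<in>?I. linked S G z (\<omega>' \<inter> all_links z)}) \<le> of_bool (long_cluster n (snd ` ?X))" by auto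
    qed
    finally show ?thesis unfolding G_def .
  qed
  \<comment> \<open>(9999/10000)^2 exceeds the density 999/1000 that
    \<open>all_boxes_good_prob\<close> requires.\<close>
  have "1/2 \<le> bern_ex ?I (\<lambda>_. ?\<rho> * ?\<rho>) ?H"
    by (rule all_boxes_good_prob) simp
  also have "\<dots> = bern_ex ?I (\<lambda>_. ?\<rho>) \<Phi>"
    unfolding \<Phi>_def by (rule bern_ex_thin[symmetric]) simp
  also have "\<dots> \<le> bern_ex ?I (\<lambda>z. bern_ex (block_edges z) pc (\<lambda>\<omega>. of_bool (good_block z \<omega>))) \<Phi>"
  proof (rule bern_ex_mono_prob[OF _ pr\<rho>])
    show "is_prob ?I (\<lambda>z. bern_ex (block_edges z) pc (\<lambda>\<omega>. of_bool (good_block z \<omega>)))"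
      using bern_ex_of_bool_bounds[OF finite_block_edges block_prob] by (simp add: is_prob_def)
  qed (use good_block_prob \<Phi>_mono in auto)
  also have "\<dots> = bern_ex A pc (\<lambda>\<omega>. \<Phi> {z\<in>?I. good_block z (\<omega> \<inter> block_edges z)})"
    unfolding A_def
    by (rule bern_ex_indep_events[symmetric, where X = good_block]) (auto simp: disjoint_block_edges)
  also have "\<dots> \<le> bern_ex A pc (\<lambda>\<omega>. bern_ex B pc (\<lambda>\<omega>'. of_bool (long_cluster n (snd ` (\<omega> \<union> \<omega>')))))"
    by (intro bern_ex_mono prA inner_B)
  also have "\<dots> = bern_ex (A \<union> B) pc (\<lambda>\<omega>. of_bool (long_cluster n (snd ` \<omega>)))"
    using finA finB AB by (rule bern_ex_Un[symmetric])
  also have "\<dots> = bern_ex ({..<5} \<times> E) pc (\<lambda>\<omega>. of_bool (long_cluster n (snd ` (\<omega> \<inter> (A \<union> B)))))"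
    using sub \<open>finite E\<close> by (intro bern_ex_Int[symmetric]) auto
  also have "\<dots> \<le> bern_ex ({..<5} \<times> E) pc (\<lambda>\<omega>. of_bool (long_cluster n (snd ` \<omega>)))"
  proof (rule bern_ex_mono[OF prE])
    fix \<omega>
    have "long_cluster n (snd ` (\<omega> \<inter> (A \<union> B))) \<Longrightarrow> long_cluster n (snd ` \<omega>)"
      by (erule long_cluster_mono) auto
    then show "of_bool (long_cluster n (snd ` (\<omega> \<inter> (A \<union> B)))) \<le> (of_bool (long_cluster n (snd ` \<omega>)) :: real)" by auto
  qed
  finally have main: "1/2 \<le> bern_ex ({..<5} \<times> E) pc (\<lambda>\<omega>. of_bool (long_cluster n (snd ` \<omega>)))" .
  show "1/2 \<le> bern_ex E q (\<lambda>W. of_bool (long_cluster n W))"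
    if q: "is_prob E q" "\<And>e. e \<in> E \<Longrightarrow> (\<Sum>k<5. pc (k, e)) \<le> q e" for q
  proof -
    have "bern_ex ({..<5} \<times> E) pc (\<lambda>\<omega>. of_bool (long_cluster n (snd ` \<omega>))) \<le> bern_ex E q (\<lambda>W. of_bool (long_cluster n W))"
    proof (rule bern_ex_copies[OF \<open>finite E\<close> prE q(1)])
      show "of_bool (long_cluster n W) \<le> (of_bool (long_cluster n W') :: real)" if "W \<subseteq> W'" for W W'
        using long_cluster_mono[OF _ that] by auto
    qed (use q(2) in auto)
    then show ?thesis using main by linarith
  qed
qed

end

subsection \<open>Percolation for small scaling parameter\<close>

text \<open>Everything except \<gamma> is fixed first: K from the number of windows, \<delta> as the
  resulting seed probability, M so that M failures are unlikely, and \<pi> as the success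
  probability of one link trial. Since seeds have size \<nu>' / \<gamma>, a small \<gamma> then
  provides enough trials.\<close>

lemma blocks_exist:
  fixes t C c r :: real
  assumes t: "0 < t" "t \<le> 1" and r: "0 < r" "r \<le> 1" and c: "0 < c" and C: "0 < C"
  shows "\<exists>\<gamma>1>0. \<forall>\<gamma> \<kappa>. 0 < \<gamma> \<and> \<gamma> < \<gamma>1 \<and> kernel \<kappa> \<gamma> C c r \<longrightarrow>
      (\<exists>\<delta> m K M x0 i0 L w. blocks \<kappa> \<gamma> C c r t \<delta> m K M x0 i0 L w)"
proof -
  define h0 where "h0 = sin (t * r / 8) * c * r / 4"
  define \<nu> where "\<nu> = t * (sin (t * r / 8) * c * r / 4) / (16 * C)"
  define K where "K = nat \<lceil>4 * (4 * pi / t + 1) / r\<rceil>"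
  have K: "4 * (4 * pi / t + 1) / r \<le> real K" unfolding K_def by linarith
  have "0 < 4 * (4 * pi / t + 1) / r" using t r pi_gt_zero by (intro divide_pos_pos mult_pos_pos add_pos_pos) auto
  then have K_pos: "0 < real K" using K by linarith
  have tr: "t * r \<le> 1" "0 < t * r" using t r by (auto intro: mult_le_one)
  have "0 < sin (t * r / 8)" using tr pi_gt3 by (intro sin_gt_zero) linarith+
  then have h0: "0 < h0" using c r by (simp add: h0_def)
  have \<nu>: "0 < \<nu>" using h0 t C by (simp add: \<nu>_def h0_def[symmetric])
  define \<nu>' where "\<nu>' = \<nu> / (4 * real K)"
  have \<nu>': "0 < \<nu>'" using \<nu> K_pos by (simp add: \<nu>'_def)
  define \<delta> where "\<delta> = (1 - exp (- (t/12) * h0)) / (2 * real K)"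
  have \<delta>: "0 < \<delta>" "\<delta> < 1"
  proof -
    show "0 < \<delta>" using t h0 K_pos by (simp add: \<delta>_def)
    have "1 \<le> real K" using K_pos by simp
    then have "1 - exp (- (t/12) * h0) < 2 * real K" using exp_gt_zero[of "- (t/12) * h0"] by linarith
    then show "\<delta> < 1" using K_pos by (simp add: \<delta>_def)
  qed
  obtain M0 where "(1 - \<delta>) ^ M0 < 1/10000" using real_arch_pow_inv[of "1/10000" "1 - \<delta>"] \<delta> by auto
  moreover have "(1 - \<delta>) ^ Suc M0 \<le> (1 - \<delta>) ^ M0" using \<delta> by (intro power_decreasing) auto
  ultimately have M: "(1 - \<delta>) ^ Suc M0 \<le> 1/10000" by linarith
  define M where "M = Suc M0"
  define \<pi> where "\<pi> = t ^ (4 * K * M) * (1 - exp (- (t/128 * c * \<nu>')))"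
  have \<pi>: "0 < \<pi>" using t c \<nu>' by (simp add: \<pi>_def)
  \<comment> \<open>The last bound gives \<pi> m \<ge> 20000 for m = \<nu>' / \<gamma>, whence exp
    (- \<pi> m) \<le> 1/20000 by exp x \<ge> 1 + x. The other bounds are those of
    \<open>strip_seed\<close>.\<close>
  define \<gamma>1 where "\<gamma>1 = min (min (1/2) (r / 4)) (min (\<nu> / 2) (\<pi> * \<nu>' / 20000))"
  have "0 < \<gamma>1" using r \<nu> \<pi> \<nu>' by (simp add: \<gamma>1_def)
  moreover have "\<exists>\<delta> m K M x0 i0 L w. blocks \<kappa> \<gamma> C c r t \<delta> m K M x0 i0 L w"
    if \<gamma>: "0 < \<gamma>" "\<gamma> < \<gamma>1" and ker: "kernel \<kappa> \<gamma> C c r" for \<gamma> \<kappa>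
  proof -
    interpret kernel \<kappa> \<gamma> C c r by (rule ker)
    have small: "\<gamma> \<le> 1/2" "\<gamma> \<le> r / 4" "\<gamma> \<le> \<nu> / 2" "\<gamma> \<le> \<pi> * \<nu>' / 20000" using \<gamma> by (auto simp: \<gamma>1_def)
    define L where "L = \<lfloor>pi / (2 * (t/4) * \<gamma>)\<rfloor>"
    define w where "w = \<lfloor>r / (2 * \<gamma>)\<rfloor>"
    define pr where "pr = (\<lambda>e. copy_prob t (0, e))"
    have pr_hor: "pr {(x, i), (y, i)} = (1 - t/16) * \<kappa> (x - y)" if "i \<in> {0, 1}" "x \<noteq> y" for x y i
      using copy_prob_hor[OF that(2), of t 0 i] by (simp add: pr_def)
    have pr_vert: "pr {(y, 0), (y, 1)} = t" for y
      using copy_prob_vert[of 0 1 t 0 y] by (simp add: pr_def)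
    note ss = strip_seed[OF t small(1,2) small(3)[unfolded \<nu>_def] K pr_hor pr_vert,
        folded h0_def \<nu>_def L_def w_def, folded \<nu>'_def \<delta>_def]
    obtain x0 i0 where seed: "i0 \<in> {0, 1}" "\<delta> \<le> bern_ex (strip_edges 0 1 {(0, 0)} ({-L..L} - {0})) pr
        (\<lambda>\<omega>. of_bool (seeded x0 w i0 (\<nu>' / \<gamma>) \<omega>))" using ss(5) by blast
    have "blocks \<kappa> \<gamma> C c r t \<delta> (\<nu>' / \<gamma>) K M x0 i0 L w"
    proof
      show "\<gamma> * of_int (2 * w) \<le> r"
      proof -
        have "of_int w \<le> r / (2 * \<gamma>)" unfolding w_def by simp
        then show ?thesis using \<gamma> by (simp add: field_simps)
      qed
      show "\<delta> \<le> bern_ex (strip_edges 0 1 {(0, 0)} ({-L..L} - {0})) (\<lambda>e. copy_prob t (0, e))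
                  (\<lambda>\<omega>. of_bool (seeded x0 w i0 (\<nu>' / \<gamma>) \<omega>))" using seed(2) by (simp only: pr_def)
      show "(1 - \<delta>) ^ M \<le> 1/10000" using M by (simp add: M_def)
      \<comment> \<open>Seed size times bond strength does not depend on \<gamma>, which is why
        \<pi> could be fixed before \<gamma>.\<close>
      have g2: "t/128 * c * \<gamma> * (\<nu>' / \<gamma>) = t/128 * c * \<nu>'" using \<gamma> by simp
      have "20000 \<le> \<pi> * (\<nu>' / \<gamma>)" using small(4) \<gamma> by (simp add: field_simps)
      then have "20000 \<le> exp (\<pi> * (\<nu>' / \<gamma>))" using exp_ge_add_one_self[of "\<pi> * (\<nu>' / \<gamma>)"] by linarith
      then have "exp (- (\<pi> * (\<nu>' / \<gamma>))) \<le> 1/20000" by (simp add: exp_minus field_simps)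
      then show "exp (- (t ^ (4 * K * M) * (1 - exp (- (t/128 * c * \<gamma> * (\<nu>' / \<gamma>)))) * (\<nu>' / \<gamma>))) \<le> 1/20000"
        unfolding g2 \<pi>_def .
    qed (use t ss(2-4) seed(1) \<nu>' \<gamma> in \<open>auto simp: M_def\<close>)
    then show ?thesis by blast
  qed
  ultimately show ?thesis by blast
qed

text \<open>Hides the block parameters. V comes before n, since one finite set of starting sites has
  to serve all volumes.\<close>

lemma kernel_percolation:
  fixes t C c r :: real
  assumes t: "0 < t" "t \<le> 1" and r: "0 < r" "r \<le> 1" and c: "0 < c" and C: "0 < C"
  shows "\<exists>\<gamma>1>0. \<forall>\<gamma> \<kappa>. 0 < \<gamma> \<and> \<gamma> < \<gamma>1 \<and> kernel \<kappa> \<gamma> C c r \<longrightarrow>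
    (\<exists>V. finite V \<and> (\<forall>n. \<exists>E. finite E \<and> (\<forall>e\<in>E. horizontal e \<or> vertical e) \<and>
       (\<forall>q. is_prob E q \<longrightarrow> (\<forall>x y i. x \<noteq> y \<longrightarrow> (1 - t/32) * \<kappa> (x - y) \<le> q {(x, i), (y, i)}) \<longrightarrow>
         (\<forall>x i. 5 * t \<le> q {(x, i), (x, i + 1)}) \<longrightarrow>
         1/2 \<le> bern_ex E q (\<lambda>W. of_bool (\<exists>v\<in>V. \<exists>C. finite C \<and> n \<le> card C \<and> (\<forall>u\<in>C. reach W v u))))))"
proof -
  obtain \<gamma>1 where \<gamma>1: "0 < \<gamma>1" "\<And>\<gamma> \<kappa>. 0 < \<gamma> \<and> \<gamma> < \<gamma>1 \<and> kernel \<kappa> \<gamma> C c r \<Longrightarrow>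
      \<exists>\<delta> m K M x0 i0 L w. blocks \<kappa> \<gamma> C c r t \<delta> m K M x0 i0 L w"
    using blocks_exist[OF assms] by blast
  show ?thesis
  proof (intro exI[of _ \<gamma>1] conjI \<gamma>1(1) allI impI)
    fix \<gamma> \<kappa> assume "0 < \<gamma> \<and> \<gamma> < \<gamma>1 \<and> kernel \<kappa> \<gamma> C c r"
    from \<gamma>1(2)[OF this] obtain \<delta> m K M x0 i0 L w where "blocks \<kappa> \<gamma> C c r t \<delta> m K M x0 i0 L w" by blast
    then interpret blocks \<kappa> \<gamma> C c r t \<delta> m K M x0 i0 L w .
    show "\<exists>V. finite V \<and> (\<forall>n. \<exists>E. finite E \<and> (\<forall>e\<in>E. horizontal e \<or> vertical e) \<and>
       (\<forall>q. is_prob E q \<longrightarrow> (\<forall>x y i. x \<noteq> y \<longrightarrow> (1 - t/32) * \<kappa> (x - y) \<le> q {(x, i), (y, i)}) \<longrightarrow>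
         (\<forall>x i. 5 * t \<le> q {(x, i), (x, i + 1)}) \<longrightarrow>
         1/2 \<le> bern_ex E q (\<lambda>W. of_bool (\<exists>v\<in>V. \<exists>C. finite C \<and> n \<le> card C \<and> (\<forall>u\<in>C. reach W v u)))))"
    proof (intro exI[of _ "cols 0 \<times> {0..<R}"] conjI allI)
      show "finite (cols 0 \<times> {0..<R})" by (simp add: cols_def)
      fix n
      obtain E where E: "finite E" "\<And>e. e \<in> E \<Longrightarrow> horizontal e \<or> vertical e"
        "\<And>q. is_prob E q \<Longrightarrow> (\<And>e. e \<in> E \<Longrightarrow> (\<Sum>k<5. pc (k, e)) \<le> q e) \<Longrightarrow>
           1/2 \<le> bern_ex E q (\<lambda>W. of_bool (long_cluster n W))"
        using percolation[of n] by blast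
      have sum_le: "(\<Sum>k<5. pc (k, e)) \<le> q e"
        if q: "\<forall>x y i. x \<noteq> y \<longrightarrow> (1 - t/32) * \<kappa> (x - y) \<le> q {(x, i), (y, i)}" "\<forall>x i. 5 * t \<le> q {(x, i), (x, i + 1)}"
          and e: "e \<in> E" for q e
        using E(2)[OF e]
      proof
        assume "horizontal e"
        then obtain x y i where xy: "x \<noteq> y" "e = {(x, i), (y, i)}" by (auto simp: horizontal_def)
        \<comment> \<open>One copy with factor 1 - t/16 and four copies with factor t/128.\<close>
        have "(\<Sum>k<5. pc (k, e)) = (1 - t/32) * \<kappa> (x - y)"
          unfolding xy(2) copy_prob_hor[OF xy(1)] by (simp add: eval_nat_numeral lessThan_Suc algebra_simps)
        then show ?thesis using q(1) xy by simp
      next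
        assume "vertical e"
        then obtain x i where e: "e = {(x, i), (x, i + 1)}" by (auto simp: vertical_def)
        have "pc (k, e) = t" for k unfolding e by (rule copy_prob_vert) simp
        then show ?thesis using q(2) e by simp
      qed
      show "\<exists>E. finite E \<and> (\<forall>e\<in>E. horizontal e \<or> vertical e) \<and>
       (\<forall>q. is_prob E q \<longrightarrow> (\<forall>x y i. x \<noteq> y \<longrightarrow> (1 - t/32) * \<kappa> (x - y) \<le> q {(x, i), (y, i)}) \<longrightarrow>
         (\<forall>x i. 5 * t \<le> q {(x, i), (x, i + 1)}) \<longrightarrow>
         1/2 \<le> bern_ex E q (\<lambda>W. of_bool (\<exists>v\<in>cols 0 \<times> {0..<R}. \<exists>C. finite C \<and> n \<le> card C \<and> (\<forall>u\<in>C. reach W v u))))"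
        unfolding long_cluster_def[symmetric] using E sum_le by (intro exI[of _ E]) blast
    qed
  qed
qed

text \<open>Set to 0 at the origin, in accordance with the normalization over y \<noteq> x.\<close>

definition kac_kernel :: "(real \<Rightarrow> real) \<Rightarrow> real \<Rightarrow> int \<Rightarrow> real" where
  "kac_kernel J \<gamma> z = (if z = 0 then 0 else kac_const J \<gamma> * \<gamma> * J (\<gamma> * of_int z))"

lemma kac_eq: "x \<noteq> y \<Longrightarrow> kac J \<gamma> x y = kac_kernel J \<gamma> (x - y)"
  by (simp add: kac_def kac_kernel_def)

text \<open>S is a Riemann sum of J without the term at 0, and the normalizing constant is 1 / S.
  The crude bounds r b \<le> S \<le> 2 B, uniform in \<gamma>, yield the constants C = B / (r b) and
  c = b / (2 B).\<close>

lemma kac_kernel_is_kernel: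
  fixes J :: "real \<Rightarrow> real"
  assumes J_nonneg: "\<And>x. J x \<ge> 0" and J_symmetric: "\<And>x. J (- x) = J x"
    and J_bound: "\<And>x. J x \<le> B" and J_supp: "\<And>x. 1 < \<bar>x\<bar> \<Longrightarrow> J x = 0"
    and b: "0 < b" and J_low: "\<And>x. \<bar>x\<bar> \<le> r \<Longrightarrow> b \<le> J x" and r: "0 < r" "r \<le> 1"
    and \<gamma>: "0 < \<gamma>" "\<gamma> \<le> r / 2"
  shows "kernel (kac_kernel J \<gamma>) \<gamma> (B / (r * b)) (b / (2 * B)) r"
proof -
  have B: "0 < B" using J_bound[of 0] J_low[of 0] r b by simp
  define N where "N = \<lfloor>1/\<gamma>\<rfloor>"
  have N: "of_int N \<le> 1 / \<gamma>" "0 \<le> N" using \<gamma> by (simp_all add: N_def)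
  have supp: "J (\<gamma> * of_int z) = 0" if "z \<notin> {-N..N}" for z
  proof (rule J_supp)
    have "N < \<bar>z\<bar>" using that by auto
    then have "1 / \<gamma> < of_int \<bar>z\<bar>" unfolding N_def by linarith
    then show "1 < \<bar>\<gamma> * of_int z\<bar>" using \<gamma> by (simp add: field_simps abs_mult)
  qed
  define S where "S = (\<Sum>z\<in>{-N..N} - {0}. \<gamma> * J (\<gamma> * of_int z))"
  have S_up: "S \<le> 2 * B"
  proof -
    have "S \<le> (\<Sum>z\<in>{-N..N} - {0}. \<gamma> * B)" unfolding S_def using J_bound \<gamma> by (intro sum_mono mult_left_mono) auto
    also have "\<dots> = of_int (2 * N) * (\<gamma> * B)" using N by (simp add: card_Diff_singleton)
    also have "\<dots> \<le> (2 * (1 / \<gamma>)) * (\<gamma> * B)" using N \<gamma> B by (intro mult_right_mono) auto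
    also have "\<dots> = 2 * B" using \<gamma> by simp
    finally show ?thesis .
  qed
  have S_low: "r * b \<le> S"
  proof -
    define n where "n = \<lfloor>r / \<gamma>\<rfloor>"
    have n: "of_int n \<le> r / \<gamma>" "r / \<gamma> - 1 \<le> of_int n" unfolding n_def by linarith+
    have n0: "0 \<le> n" using r \<gamma> by (simp add: n_def)
    have "n \<le> N" unfolding n_def N_def using r \<gamma> by (intro floor_mono divide_right_mono) auto
    have "r * b \<le> of_int (2 * n) * (\<gamma> * b)"
    proof -
      \<comment> \<open>The floor loses at most 1, which is at most r / (2 \<gamma>) by \<gamma>
        \<le> r / 2.\<close>
      have "r / \<gamma> \<le> 2 * (r / \<gamma> - 1)" using \<gamma> by (simp add: field_simps)
      then have "r / \<gamma> \<le> of_int (2 * n)" using n by simp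
      then have "(r / \<gamma>) * (\<gamma> * b) \<le> of_int (2 * n) * (\<gamma> * b)" using \<gamma> b by (intro mult_right_mono) auto
      then show ?thesis using \<gamma> by simp
    qed
    also have "\<dots> = (\<Sum>z\<in>{-n..n} - {0}. \<gamma> * b)" using n0 by (simp add: card_Diff_singleton)
    also have "\<dots> \<le> (\<Sum>z\<in>{-n..n} - {0}. \<gamma> * J (\<gamma> * of_int z))"
    proof (intro sum_mono mult_left_mono J_low)
      fix z assume "z \<in> {-n..n} - {0}"
      then have "\<bar>z\<bar> \<le> n" by auto
      then have "real_of_int \<bar>z\<bar> \<le> r / \<gamma>" using n(1) by linarith
      then show "\<bar>\<gamma> * of_int z\<bar> \<le> r" using \<gamma> by (simp add: abs_mult field_simps)
    qed (use \<gamma> in auto)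
    also have "\<dots> \<le> S" unfolding S_def using \<open>n \<le> N\<close> J_nonneg \<gamma> by (intro sum_mono2) auto
    finally show ?thesis .
  qed
  have S_pos: "0 < S" using S_low r b by (meson mult_pos_pos order_less_le_trans)
  have hs: "((\<lambda>y. k * \<gamma> * J (\<gamma> * of_int (x - y))) has_sum k * S) {y. y \<noteq> x}" for k and x :: int
  proof (rule has_sum_finite_neutralI[where B = "(\<lambda>z. x - z) ` ({-N..N} - {0})"])
    have "(\<Sum>y\<in>(\<lambda>z. x - z) ` ({-N..N} - {0}). k * \<gamma> * J (\<gamma> * of_int (x - y))) = (\<Sum>z\<in>{-N..N} - {0}. k * \<gamma> * J (\<gamma> * of_int z))"
      by (subst sum.reindex) (auto simp: inj_on_def)
    then show "k * S = (\<Sum>y\<in>(\<lambda>z. x - z) ` ({-N..N} - {0}). k * \<gamma> * J (\<gamma> * of_int (x - y)))"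
      by (simp add: S_def sum_distrib_left mult.assoc)
    fix y assume y: "y \<in> {y. y \<noteq> x} - (\<lambda>z. x - z) ` ({-N..N} - {0})"
    have "x - y \<notin> {-N..N}"
    proof
      assume "x - y \<in> {-N..N}"
      then have "y \<in> (\<lambda>z. x - z) ` ({-N..N} - {0})" using y by (intro image_eqI[of _ _ "x - y"]) auto
      then show False using y by blast
    qed
    then show "k * \<gamma> * J (\<gamma> * of_int (x - y)) = 0" using supp[OF \<open>x - y \<notin> {-N..N}\<close>] mult_zero_right by metis
  qed auto
  have kc: "kac_const J \<gamma> = 1 / S"
    unfolding kac_const_def
  proof (rule the_equality)
    show "\<forall>x::int. ((\<lambda>y. 1 / S * \<gamma> * J (\<gamma> * of_int (x - y))) has_sum 1) {y. y \<noteq> x}"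
      using hs[of "1 / S"] S_pos by simp
    fix k assume k: "\<forall>x::int. ((\<lambda>y. k * \<gamma> * J (\<gamma> * of_int (x - y))) has_sum 1) {y. y \<noteq> x}"
    have "k * S = 1" using has_sum_unique[OF hs[of k 0] k[rule_format, of 0]] .
    then show "k = 1 / S" using S_pos by (simp add: field_simps)
  qed
  show ?thesis
  proof
    show "0 < B / (r * b)" "0 < b / (2 * B)" using B b r by simp_all
    fix z :: int
    show "kac_kernel J \<gamma> (- z) = kac_kernel J \<gamma> z" using J_symmetric[of "\<gamma> * of_int z"] by (simp add: kac_kernel_def)
    show "0 \<le> kac_kernel J \<gamma> z" using J_nonneg \<gamma> S_pos by (simp add: kac_kernel_def kc)
    show "kac_kernel J \<gamma> z = 0" if "1 < \<gamma> * \<bar>of_int z\<bar>"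
      using J_supp[of "\<gamma> * of_int z"] that \<gamma> by (simp add: kac_kernel_def abs_mult)
    show "kac_kernel J \<gamma> z \<le> B / (r * b) * \<gamma>"
    proof -
      have "1 / S * \<gamma> * J (\<gamma> * of_int z) \<le> 1 / (r * b) * \<gamma> * B"
        using S_low S_pos J_bound J_nonneg \<gamma> r b by (intro mult_mono divide_left_mono) auto
      then show ?thesis using B b r \<gamma> by (simp add: kac_kernel_def kc mult_ac)
    qed
    show "b / (2 * B) * \<gamma> \<le> kac_kernel J \<gamma> z" if "z \<noteq> 0" "\<gamma> * \<bar>of_int z\<bar> \<le> r"
    proof -
      have "b \<le> J (\<gamma> * of_int z)" using that \<gamma> by (intro J_low) (simp add: abs_mult)
      moreover have "1 / (2 * B) \<le> 1 / S" using S_up S_pos B by (intro divide_left_mono) auto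
      ultimately have "1 / (2 * B) * \<gamma> * b \<le> 1 / S * \<gamma> * J (\<gamma> * of_int z)"
        using \<gamma> b B S_pos by (intro mult_mono) auto
      then show ?thesis using that by (simp add: kac_kernel_def kc mult_ac)
    qed
    have "(\<Sum>z\<in>{-N..N}. kac_kernel J \<gamma> z) = (\<Sum>z\<in>{-N..N} - {0}. 1 / S * (\<gamma> * J (\<gamma> * of_int z)))"
      by (rule sum.mono_neutral_cong_right) (auto simp: kac_kernel_def kc)
    also have "\<dots> = 1 / S * (\<Sum>z\<in>{-N..N} - {0}. \<gamma> * J (\<gamma> * of_int z))" by (rule sum_distrib_left[symmetric])
    also have "\<dots> = 1" using S_pos unfolding S_def[symmetric] by simp
    finally show "(\<Sum>z\<in>{-\<lfloor>1/\<gamma>\<rfloor>..\<lfloor>1/\<gamma>\<rfloor>}. kac_kernel J \<gamma> z) = 1" by (simp add: N_def)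
  qed (use r \<gamma> in auto)
qed

subsection \<open>Gibbs measures as ferromagnets\<close>

lemma space_config_space: "space config_space = {\<sigma>. \<forall>p. \<sigma> p \<in> {-1, 1}}"
  by (auto simp: config_space_def space_PiM PiE_def Pi_def extensional_def)

lemma configs_bc_plus: "configs_bc \<Lambda> (\<lambda>_. 1) = spins \<Lambda>"
  by (auto simp: configs_bc_def space_config_space spins_def)

lemma spins_subset_space: "spins \<Lambda> \<subseteq> space config_space"
  by (auto simp: space_config_space spins_def)

lemma integral_gibbs_sum:
  fixes f :: "config \<Rightarrow> real"
  assumes fin: "finite (configs_bc \<Lambda> \<tau>)" and f: "f \<in> borel_measurable config_space"
  shows "integral\<^sup>L (gibbs J \<epsilon> \<gamma> \<Lambda> \<tau>) f
     = (\<Sum>\<sigma>\<in>configs_bc \<Lambda> \<tau>. exp (- hamiltonian J \<epsilon> \<gamma> \<Lambda> \<sigma>) * f \<sigma>) / partition_fun J \<epsilon> \<gamma> \<Lambda> \<tau>"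
proof -
  let ?w = "\<lambda>\<sigma>. exp (- hamiltonian J \<epsilon> \<gamma> \<Lambda> \<sigma>) / partition_fun J \<epsilon> \<gamma> \<Lambda> \<tau>"
  have Zpos: "0 \<le> partition_fun J \<epsilon> \<gamma> \<Lambda> \<tau>" unfolding partition_fun_def by (intro sum_nonneg) simp
  have "configs_bc \<Lambda> \<tau> \<subseteq> space config_space" by (auto simp: configs_bc_def)
  then have meas: "(\<lambda>\<sigma>. \<sigma>) \<in> point_measure (configs_bc \<Lambda> \<tau>) (\<lambda>\<sigma>. ennreal (?w \<sigma>)) \<rightarrow>\<^sub>M config_space"
    by (intro measurableI) (auto simp: space_point_measure sets_point_measure)
  have "integral\<^sup>L (gibbs J \<epsilon> \<gamma> \<Lambda> \<tau>) f = integral\<^sup>L (point_measure (configs_bc \<Lambda> \<tau>) (\<lambda>\<sigma>. ennreal (?w \<sigma>))) f"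
    unfolding gibbs_def by (rule integral_distr[OF meas f])
  also have "\<dots> = (\<Sum>\<sigma>\<in>configs_bc \<Lambda> \<tau>. ?w \<sigma> *\<^sub>R f \<sigma>)"
    using fin Zpos by (intro lebesgue_integral_point_measure_finite) auto
  finally show ?thesis by (simp add: sum_divide_distrib)
qed

text \<open>The orientation x < y makes the indexing of bonds injective; N will be the range of the
  interaction.\<close>

definition hor_edges :: "int \<Rightarrow> site set \<Rightarrow> site set set" where
  "hor_edges N \<Lambda> = (\<lambda>(i, x, y). {(x, i), (y, i)}) ` {(i, x, y). x < y \<and> y - x \<le> N \<and> ((x, i) \<in> \<Lambda> \<or> (y, i) \<in> \<Lambda>)}"

definition vert_edges :: "site set \<Rightarrow> site set set" where
  "vert_edges \<Lambda> = (\<lambda>(x, i). {(x, i), (x, i + 1)}) ` {(x, i). (x, i) \<in> \<Lambda> \<or> (x, i + 1) \<in> \<Lambda>}"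

lemma finite_hor_index:
  assumes "finite (\<Lambda> :: site set)"
  shows "finite {(i, x, y). \<bar>x - y\<bar> \<le> (N::int) \<and> ((x, i) \<in> \<Lambda> \<or> (y, i) \<in> \<Lambda>)}"
proof (rule finite_subset)
  show "{(i, x, y). \<bar>x - y\<bar> \<le> N \<and> ((x, i) \<in> \<Lambda> \<or> (y, i) \<in> \<Lambda>)}
    \<subseteq> (\<lambda>((x, i), d). (i, x, x + d)) ` (\<Lambda> \<times> {-N..N}) \<union> (\<lambda>((y, i), d). (i, y + d, y)) ` (\<Lambda> \<times> {-N..N})"
  proof (clarify, goal_cases)
    case (1 i x y)
    show ?case
    proof (cases "(x, i) \<in> \<Lambda>")
      case True
      then have "(i, x, y) \<in> (\<lambda>((x, i), d). (i, x, x + d)) ` (\<Lambda> \<times> {-N..N})"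
        using 1 by (intro image_eqI[of _ _ "((x, i), y - x)"]) auto
      then show ?thesis using 1 by blast
    next
      case False
      then have "(i, x, y) \<in> (\<lambda>((y, i), d). (i, y + d, y)) ` (\<Lambda> \<times> {-N..N})"
        using 1 by (intro image_eqI[of _ _ "((y, i), x - y)"]) auto
      then show ?thesis using 1 by blast
    qed
  qed
qed (use assms in simp)

lemma finite_vert_index:
  assumes "finite (\<Lambda> :: site set)"
  shows "finite {(x, i). (x, i) \<in> \<Lambda> \<or> (x, i + 1) \<in> \<Lambda>}"
proof (rule finite_subset)
  show "{(x, i). (x, i) \<in> \<Lambda> \<or> (x, i + 1) \<in> \<Lambda>} \<subseteq> \<Lambda> \<union> (\<lambda>(x, i). (x, i - 1)) ` \<Lambda>"
    by force
qed (use assms in simp)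

lemma finite_vol_edges:
  assumes "finite \<Lambda>" shows "finite (hor_edges N \<Lambda>)" "finite (vert_edges \<Lambda>)"
proof -
  have "finite {(i, x, y). x < y \<and> y - x \<le> N \<and> ((x, i) \<in> \<Lambda> \<or> (y, i) \<in> \<Lambda>)}"
    by (rule finite_subset[OF _ finite_hor_index[OF assms, of N]]) auto
  then show "finite (hor_edges N \<Lambda>)" by (simp add: hor_edges_def)
  show "finite (vert_edges \<Lambda>)" using finite_vert_index[OF assms] by (simp add: vert_edges_def)
qed

lemma hor_edges_cases:
  assumes "e \<in> hor_edges N \<Lambda>"
  obtains x y i where "e = {(x, i), (y, i)}" "x < y" "y - x \<le> N" "(x, i) \<in> \<Lambda> \<or> (y, i) \<in> \<Lambda>"
  using assms unfolding hor_edges_def by auto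

lemma vert_edges_cases:
  assumes "e \<in> vert_edges \<Lambda>"
  obtains x i where "e = {(x, i), (x, i + 1)}" "(x, i) \<in> \<Lambda> \<or> (x, i + 1) \<in> \<Lambda>"
  using assms unfolding vert_edges_def by auto

lemma chi_pair: "u \<noteq> v \<Longrightarrow> chi {u, v} \<sigma> = \<sigma> u * \<sigma> v"
  by (simp add: chi_def)

lemma exp_bond: "s = 1 \<or> s = -1 \<Longrightarrow> exp (a * s) = cosh a * (1 + tanh a * (s::real))"
proof -
  have c: "cosh a \<noteq> 0" using cosh_real_pos[of a] by simp
  have "cosh a * (1 + tanh a * s) = cosh a + sinh a * s" using c by (simp add: tanh_def field_simps)
  then show "s = 1 \<or> s = -1 \<Longrightarrow> ?thesis" by (auto simp: cosh_plus_sinh cosh_minus_sinh)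
qed

locale layered = kernel "kac_kernel J \<gamma>" \<gamma> C c r for J \<gamma> C c r +
  fixes \<epsilon> :: real
  assumes \<epsilon>_pos: "0 < \<epsilon>"
begin

definition N :: int where "N = \<lfloor>1/\<gamma>\<rfloor>"

definition strength :: "site set \<Rightarrow> real" where
  "strength = bond (\<lambda>u v. if snd u = snd v then kac_kernel J \<gamma> (fst u - fst v) else \<epsilon>)"

definition vol_edges :: "site set \<Rightarrow> site set set" where
  "vol_edges \<Lambda> = hor_edges N \<Lambda> \<union> vert_edges \<Lambda>"

definition \<tau> :: "site set \<Rightarrow> real" where "\<tau> e = tanh (strength e)"

lemma kernel_sym: "kac_kernel J \<gamma> (x - y) = kac_kernel J \<gamma> (y - x)"
  using even[of "x - y"] by simp

lemma strength_hor: "x \<noteq> y \<Longrightarrow> strength {(x, i), (y, i)} = kac_kernel J \<gamma> (x - y)"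
  unfolding strength_def using kernel_sym[of x y] by (simp add: bond_doubleton)

lemma strength_vert: "strength {(x, i), (x, i + 1)} = \<epsilon>"
  unfolding strength_def by (simp add: bond_doubleton)

lemma far_zero: "N < \<bar>z\<bar> \<Longrightarrow> kac_kernel J \<gamma> z = 0"
proof (rule range)
  assume "N < \<bar>z\<bar>"
  then have "1 / \<gamma> < of_int \<bar>z\<bar>" unfolding N_def by linarith
  then show "1 < \<gamma> * \<bar>of_int z\<bar>" using \<gamma>_pos by (simp add: field_simps)
qed

text \<open>The sum over ordered pairs counts each horizontal bond twice, which cancels the factor
  1/2. Pairs farther apart than N carry no interaction, so the infinite sums reduce to finite
  ones.\<close>

lemma energy_eq:
  assumes fin: "finite \<Lambda>"
  shows "- hamiltonian J \<epsilon> \<gamma> \<Lambda> \<sigma> = (\<Sum>e\<in>vol_edges \<Lambda>. strength e * chi e \<sigma>)"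
proof -
  let ?g = "\<lambda>(i, x, y). kac J \<gamma> x y * \<sigma> (x, i) * \<sigma> (y, i)"
  let ?T = "{(i, x, y). x \<noteq> y \<and> ((x, i) \<in> \<Lambda> \<or> (y, i) \<in> \<Lambda>)}"
  let ?P = "{(i, x, y). x < y \<and> y - x \<le> N \<and> ((x, i) \<in> \<Lambda> \<or> (y, i) \<in> \<Lambda>)}"
  let ?M = "{(i, x, y). y < x \<and> x - y \<le> N \<and> ((x, i) \<in> \<Lambda> \<or> (y, i) \<in> \<Lambda>)}"
  have finP: "finite ?P" and finM: "finite ?M"
    by (rule finite_subset[OF _ finite_hor_index[OF fin, of N]], auto)+
  have "infsum ?g ?T = infsum ?g (?P \<union> ?M)"
  proof (rule infsum_cong_neutral)
    fix s assume s: "s \<in> ?T - (?P \<union> ?M)"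
    obtain i x y where sxy: "s = (i, x, y)" by (cases s)
    have "x \<noteq> y" "N < \<bar>x - y\<bar>" using s sxy by auto
    then have "kac J \<gamma> x y = 0" using far_zero[of "x - y"] kac_eq[of x y J \<gamma>] by simp
    then show "?g s = 0" using sxy by simp
  qed auto
  also have "\<dots> = sum ?g (?P \<union> ?M)" using finP finM by simp
  also have "\<dots> = sum ?g ?P + sum ?g ?M" using finP finM by (intro sum.union_disjoint) auto
  also have "sum ?g ?M = sum ?g ?P"
  proof (rule sum.reindex_bij_witness[of _ "\<lambda>(i, x, y). (i, y, x)" "\<lambda>(i, x, y). (i, y, x)"])
    fix s assume "s \<in> ?M"
    then obtain i x y where "s = (i, x, y)" "y < x" by auto
    then show "?g ((\<lambda>(i, x, y). (i, y, x)) s) = ?g s" using kac_eq[of x y J \<gamma>] kac_eq[of y x J \<gamma>] kernel_sym[of x y] by simp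
  qed auto
  finally have hor: "infsum ?g ?T = 2 * sum ?g ?P" by simp
  have horE: "sum ?g ?P = (\<Sum>e\<in>hor_edges N \<Lambda>. strength e * chi e \<sigma>)"
    unfolding hor_edges_def
  proof (subst sum.reindex)
    show "inj_on (\<lambda>(i, x, y). {(x, i), (y, i)}) ?P"
      by (rule inj_onI) (auto simp: doubleton_eq_iff)
    show "sum ?g ?P = sum ((\<lambda>e. strength e * chi e \<sigma>) \<circ> (\<lambda>(i, x, y). {(x, i), (y, i)})) ?P"
    proof (rule sum.cong[OF refl])
      fix s assume "s \<in> ?P"
      then obtain i x y where "s = (i, x, y)" "x < y" by auto
      then show "?g s = ((\<lambda>e. strength e * chi e \<sigma>) \<circ> (\<lambda>(i, x, y). {(x, i), (y, i)})) s"
        using strength_hor[of x y i] kac_eq[of x y J \<gamma>] chi_pair[of "(x, i)" "(y, i)" \<sigma>] by simp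
    qed
  qed
  let ?V = "{(x, i). (x, i) \<in> \<Lambda> \<or> (x, i + 1) \<in> \<Lambda>}"
  have "\<epsilon> * infsum (\<lambda>(x, i). \<sigma> (x, i) * \<sigma> (x, i + 1)) ?V = (\<Sum>(x, i)\<in>?V. \<epsilon> * (\<sigma> (x, i) * \<sigma> (x, i + 1)))"
    using finite_vert_index[OF fin] by (simp add: sum_distrib_left case_prod_unfold)
  also have "\<dots> = (\<Sum>e\<in>vert_edges \<Lambda>. strength e * chi e \<sigma>)"
    unfolding vert_edges_def
  proof (subst sum.reindex)
    show "inj_on (\<lambda>(x, i). {(x, i), (x, i + 1)}) ?V"
      by (rule inj_onI) (auto simp: doubleton_eq_iff)
    show "(\<Sum>(x, i)\<in>?V. \<epsilon> * (\<sigma> (x, i) * \<sigma> (x, i + 1))) = sum ((\<lambda>e. strength e * chi e \<sigma>) \<circ> (\<lambda>(x, i). {(x, i), (x, i + 1)})) ?V"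
      by (rule sum.cong[OF refl]) (auto simp: strength_vert chi_pair)
  qed
  finally have vert: "\<epsilon> * infsum (\<lambda>(x, i). \<sigma> (x, i) * \<sigma> (x, i + 1)) ?V = (\<Sum>e\<in>vert_edges \<Lambda>. strength e * chi e \<sigma>)" .
  have disj: "hor_edges N \<Lambda> \<inter> vert_edges \<Lambda> = {}"
  proof -
    have False if "e \<in> hor_edges N \<Lambda>" "e \<in> vert_edges \<Lambda>" for e
      using that by (elim hor_edges_cases vert_edges_cases) (auto simp: doubleton_eq_iff)
    then show ?thesis by blast
  qed
  have "(\<Sum>e\<in>vol_edges \<Lambda>. strength e * chi e \<sigma>) = (\<Sum>e\<in>hor_edges N \<Lambda>. strength e * chi e \<sigma>) + (\<Sum>e\<in>vert_edges \<Lambda>. strength e * chi e \<sigma>)"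
    unfolding vol_edges_def using finite_vol_edges[OF fin] disj by (intro sum.union_disjoint) auto
  then show ?thesis unfolding hamiltonian_def hor vert horE by simp
qed

lemma finite_vol [simp]: "finite \<Lambda> \<Longrightarrow> finite (vol_edges \<Lambda>)"
  by (simp add: vol_edges_def finite_vol_edges)

lemma boltzmann_weight:
  assumes "finite \<Lambda>" "\<sigma> \<in> spins \<Lambda>"
  shows "exp (- hamiltonian J \<epsilon> \<gamma> \<Lambda> \<sigma>) = (\<Prod>e\<in>vol_edges \<Lambda>. cosh (strength e)) * weight (vol_edges \<Lambda>) \<tau> \<sigma>"
proof -
  have "exp (- hamiltonian J \<epsilon> \<gamma> \<Lambda> \<sigma>) = (\<Prod>e\<in>vol_edges \<Lambda>. exp (strength e * chi e \<sigma>))"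
    unfolding energy_eq[OF assms(1)] using assms by (intro exp_sum) simp
  also have "\<dots> = (\<Prod>e\<in>vol_edges \<Lambda>. cosh (strength e) * (1 + \<tau> e * chi e \<sigma>))"
    unfolding \<tau>_def using chi_cases[OF assms(2)] by (intro prod.cong refl exp_bond) auto
  finally show ?thesis by (simp add: prod.distrib weight_def)
qed

text \<open>The finite-volume plus state as a quotient of finite sums; \<open>integral_gibbs\<close>
  identifies it with the Gibbs measure on measurable observables.\<close>

definition avg :: "site set \<Rightarrow> (config \<Rightarrow> real) \<Rightarrow> real" where
  "avg \<Lambda> f = isum \<Lambda> (vol_edges \<Lambda>) \<tau> f / isum \<Lambda> (vol_edges \<Lambda>) \<tau> (\<lambda>_. 1)"

lemma integral_gibbs:
  assumes fin: "finite \<Lambda>" and f: "f \<in> borel_measurable config_space"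
  shows "integral\<^sup>L (gibbs J \<epsilon> \<gamma> \<Lambda> (\<lambda>_. 1)) f = avg \<Lambda> f"
proof -
  let ?K = "\<Prod>e\<in>vol_edges \<Lambda>. cosh (strength e)"
  have Z: "partition_fun J \<epsilon> \<gamma> \<Lambda> (\<lambda>_. 1) = ?K * isum \<Lambda> (vol_edges \<Lambda>) \<tau> (\<lambda>_. 1)"
    unfolding partition_fun_def configs_bc_plus isum_def sum_distrib_left
    by (intro sum.cong refl) (simp add: boltzmann_weight[OF fin])
  have K: "0 < ?K" by (intro prod_pos) (simp add: cosh_real_pos)
  have "(\<Sum>\<sigma>\<in>spins \<Lambda>. exp (- hamiltonian J \<epsilon> \<gamma> \<Lambda> \<sigma>) * f \<sigma>) = ?K * isum \<Lambda> (vol_edges \<Lambda>) \<tau> f"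
    unfolding isum_def sum_distrib_left by (intro sum.cong refl) (simp add: boltzmann_weight[OF fin])
  then show ?thesis
    using integral_gibbs_sum[of \<Lambda> "\<lambda>_. 1" f J \<epsilon> \<gamma>] fin f K unfolding configs_bc_plus Z avg_def by simp
qed

lemma strength_nonneg:
  assumes "horizontal e \<or> vertical e" shows "0 \<le> strength e"
  using assms nonneg \<epsilon>_pos by (auto simp: horizontal_def vertical_def strength_hor strength_vert)

lemma \<tau>_prob: "(\<And>e. e \<in> E \<Longrightarrow> horizontal e \<or> vertical e) \<Longrightarrow> is_prob E \<tau>"
  unfolding is_prob_def \<tau>_def using strength_nonneg tanh_real_lt_1 by (auto intro: less_imp_le)

lemma vol_edges_edge:
  assumes "e \<in> vol_edges \<Lambda>"
  shows "(horizontal e \<or> vertical e) \<and> e \<inter> \<Lambda> \<noteq> {} \<and> finite e \<and> card e = 2"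
  using assms unfolding vol_edges_def
proof
  assume "e \<in> hor_edges N \<Lambda>"
  then show ?thesis
  proof (rule hor_edges_cases)
    fix x y i assume *: "e = {(x, i), (y, i)}" "x < y" "(x, i) \<in> \<Lambda> \<or> (y, i) \<in> \<Lambda>"
    then have "horizontal e" unfolding horizontal_def by (metis order_less_irrefl)
    then show ?thesis using * by auto
  qed
next
  assume "e \<in> vert_edges \<Lambda>"
  then show ?thesis
  proof (rule vert_edges_cases)
    fix x i assume *: "e = {(x, i), (x, i + 1)}" "(x, i) \<in> \<Lambda> \<or> (x, i + 1) \<in> \<Lambda>"
    then have "vertical e" unfolding vertical_def by blast
    then show ?thesis using * by auto
  qed
qed

lemma edge_in_vol:
  assumes "horizontal e \<or> vertical e" "e \<inter> \<Lambda> \<noteq> {}" "\<tau> e \<noteq> 0"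
  shows "e \<in> vol_edges \<Lambda>"
  using assms(1)
proof
  assume "horizontal e"
  then obtain x y i where xy: "x \<noteq> y" "e = {(x, i), (y, i)}" by (auto simp: horizontal_def)
  have "strength e \<noteq> 0" using assms(3) by (auto simp: \<tau>_def)
  then have "kac_kernel J \<gamma> (x - y) \<noteq> 0" using strength_hor[OF xy(1)] xy(2) by simp
  then have "\<bar>x - y\<bar> \<le> N" using far_zero[of "x - y"] by linarith
  then have "(i, min x y, max x y) \<in> {(i, x, y). x < y \<and> y - x \<le> N \<and> ((x, i) \<in> \<Lambda> \<or> (y, i) \<in> \<Lambda>)}"
    using xy assms(2) by (auto simp: min_def max_def)
  moreover have "e = (\<lambda>(i, x, y). {(x, i), (y, i)}) (i, min x y, max x y)" using xy by (auto simp: min_def max_def)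
  ultimately have "e \<in> hor_edges N \<Lambda>" unfolding hor_edges_def by (rule image_eqI[rotated])
  then show ?thesis by (simp add: vol_edges_def)
next
  assume "vertical e"
  then obtain x i where e: "e = {(x, i), (x, i + 1)}" by (auto simp: vertical_def)
  then have "e \<in> vert_edges \<Lambda>" unfolding vert_edges_def using assms(2) by (intro image_eqI[of _ _ "(x, i)"]) auto
  then show ?thesis by (simp add: vol_edges_def)
qed

lemma avg_chi: "avg \<Lambda> (chi A) = corr \<Lambda> (vol_edges \<Lambda>) \<tau> A"
  by (simp add: avg_def corr_def)

lemma avg_chi_nonneg:
  assumes "finite \<Lambda>" "finite A" shows "0 \<le> avg \<Lambda> (chi A)"
proof -
  interpret ferromagnet \<Lambda> "vol_edges \<Lambda>" by unfold_locales (use assms vol_edges_edge in auto)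
  show ?thesis unfolding avg_chi using assms vol_edges_edge by (intro corr_nonneg \<tau>_prob) auto
qed

text \<open>Two moves: shrink the volume while keeping all bonds, then drop the bonds that miss the
  small volume or have strength 0.\<close>

lemma avg_chi_antimono:
  assumes "finite \<Lambda>'" "\<Lambda> \<subseteq> \<Lambda>'" "finite A"
  shows "avg \<Lambda>' (chi A) \<le> avg \<Lambda> (chi A)"
proof -
  have fin: "finite \<Lambda>" using assms finite_subset by auto
  have sub: "vol_edges \<Lambda> \<subseteq> vol_edges \<Lambda>'"
    using assms(2) unfolding vol_edges_def hor_edges_def vert_edges_def by (intro Un_mono image_mono) auto
  have pr: "is_prob (vol_edges \<Lambda>') \<tau>" using vol_edges_edge by (intro \<tau>_prob) auto
  have "corr \<Lambda>' (vol_edges \<Lambda>') \<tau> A \<le> corr \<Lambda> (vol_edges \<Lambda>') \<tau> A"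
    using assms vol_edges_edge pr by (intro corr_antimono_volume) auto
  also have "\<dots> = corr \<Lambda> (vol_edges \<Lambda>) \<tau> A"
    using assms fin sub pr
  proof (intro corr_irrelevant_bonds)
    fix e assume e: "e \<in> vol_edges \<Lambda>' - vol_edges \<Lambda>"
    then show "e \<inter> \<Lambda> = {} \<or> \<tau> e = 0" using edge_in_vol[of e \<Lambda>] vol_edges_edge[of e \<Lambda>'] by blast
  qed auto
  finally show ?thesis unfolding avg_chi .
qed

end

subsection \<open>Infinite-volume limits\<close>

lemma spin_update: "\<sigma> \<in> space config_space \<Longrightarrow> x \<in> {-1, 1} \<Longrightarrow> \<sigma>(p := x) \<in> space config_space"
  by (auto simp: space_config_space)

text \<open>Fourier expansion on a finite cube. Splitting off the spin at p leaves the even part f1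
  and the odd part f2, both local on \<Delta>. The expansion reduces convergence of all local
  observables to convergence of the averages of chi A.\<close>

lemma local_fun_walsh_aux:
  assumes "finite \<Delta>"
    and "\<forall>\<sigma>\<in>space config_space. \<forall>\<sigma>'\<in>space config_space. (\<forall>p\<in>\<Delta>. \<sigma> p = \<sigma>' p) \<longrightarrow> f \<sigma> = f \<sigma>'"
  shows "\<exists>a. \<forall>\<sigma>\<in>space config_space. f \<sigma> = (\<Sum>A\<in>Pow \<Delta>. a A * chi A \<sigma>)"
  using assms
proof (induction \<Delta> arbitrary: f rule: finite_induct)
  case empty
  have "(\<lambda>_. 1) \<in> space config_space" by (simp add: space_config_space)
  then have const: "f \<sigma> = f (\<lambda>_. 1)" if "\<sigma> \<in> space config_space" for \<sigma> using that empty by blast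
  have "\<forall>\<sigma>\<in>space config_space. f \<sigma> = (\<Sum>A\<in>Pow {}. f (\<lambda>_. 1) * chi A \<sigma>)"
  proof
    fix \<sigma> assume "\<sigma> \<in> space config_space"
    from const[OF this] show "f \<sigma> = (\<Sum>A\<in>Pow {}. f (\<lambda>_. 1) * chi A \<sigma>)" by simp
  qed
  then show ?case by (rule exI[of _ "\<lambda>_. f (\<lambda>_. 1)"])
next
  case (insert p \<Delta>)
  define f1 where "f1 \<sigma> = (f (\<sigma>(p := 1)) + f (\<sigma>(p := -1))) / 2" for \<sigma>
  define f2 where "f2 \<sigma> = (f (\<sigma>(p := 1)) - f (\<sigma>(p := -1))) / 2" for \<sigma>
  have upd: "f (\<sigma>(p := x)) = f (\<sigma>'(p := x))"
    if "\<sigma> \<in> space config_space" "\<sigma>' \<in> space config_space" "\<forall>q\<in>\<Delta>. \<sigma> q = \<sigma>' q" "x \<in> {-1, 1}" for \<sigma> \<sigma>' x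
  proof -
    have "\<forall>q\<in>insert p \<Delta>. (\<sigma>(p := x)) q = (\<sigma>'(p := x)) q" using that(3) by simp
    then show ?thesis using insert.prems spin_update[OF that(1,4)] spin_update[OF that(2,4)] by blast
  qed
  have loc1: "\<forall>\<sigma>\<in>space config_space. \<forall>\<sigma>'\<in>space config_space. (\<forall>p\<in>\<Delta>. \<sigma> p = \<sigma>' p) \<longrightarrow> f1 \<sigma> = f1 \<sigma>'"
  proof (intro ballI impI)
    fix \<sigma> \<sigma>' assume *: "\<sigma> \<in> space config_space" "\<sigma>' \<in> space config_space" "\<forall>p\<in>\<Delta>. \<sigma> p = \<sigma>' p"
    show "f1 \<sigma> = f1 \<sigma>'" using upd[OF *, of 1] upd[OF *, of "-1"] by (simp add: f1_def)
  qed
  have loc2: "\<forall>\<sigma>\<in>space config_space. \<forall>\<sigma>'\<in>space config_space. (\<forall>p\<in>\<Delta>. \<sigma> p = \<sigma>' p) \<longrightarrow> f2 \<sigma> = f2 \<sigma>'"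
  proof (intro ballI impI)
    fix \<sigma> \<sigma>' assume *: "\<sigma> \<in> space config_space" "\<sigma>' \<in> space config_space" "\<forall>p\<in>\<Delta>. \<sigma> p = \<sigma>' p"
    show "f2 \<sigma> = f2 \<sigma>'" using upd[OF *, of 1] upd[OF *, of "-1"] by (simp add: f2_def)
  qed
  obtain a1 where a1: "\<forall>\<sigma>\<in>space config_space. f1 \<sigma> = (\<Sum>A\<in>Pow \<Delta>. a1 A * chi A \<sigma>)"
    using insert.IH[OF loc1] by blast
  obtain a2 where a2: "\<forall>\<sigma>\<in>space config_space. f2 \<sigma> = (\<Sum>A\<in>Pow \<Delta>. a2 A * chi A \<sigma>)"
    using insert.IH[OF loc2] by blast
  define a where "a A = (if p \<in> A then a2 (A - {p}) else a1 A)" for A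
  have "f \<sigma> = (\<Sum>A\<in>Pow (insert p \<Delta>). a A * chi A \<sigma>)" if \<sigma>: "\<sigma> \<in> space config_space" for \<sigma>
  proof -
    have p1: "\<sigma> p = 1 \<or> \<sigma> p = -1" using \<sigma> unfolding space_config_space by blast
    have "f \<sigma> = f (\<sigma>(p := \<sigma> p))" by simp
    also have "\<dots> = f1 \<sigma> + \<sigma> p * f2 \<sigma>" using p1 by (auto simp: f1_def f2_def field_simps simp del: fun_upd_triv)
    also have "\<dots> = (\<Sum>A\<in>Pow \<Delta>. a1 A * chi A \<sigma>) + (\<Sum>A\<in>Pow \<Delta>. a2 A * (\<sigma> p * chi A \<sigma>))"
      using a1 a2 \<sigma> by (simp add: sum_distrib_left mult_ac)
    also have "(\<Sum>A\<in>Pow \<Delta>. a1 A * chi A \<sigma>) = (\<Sum>A\<in>Pow \<Delta>. a A * chi A \<sigma>)"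
      using insert.hyps by (intro sum.cong refl) (auto simp: a_def)
    also have "(\<Sum>A\<in>Pow \<Delta>. a2 A * (\<sigma> p * chi A \<sigma>)) = (\<Sum>A\<in>insert p ` Pow \<Delta>. a A * chi A \<sigma>)"
    proof (subst sum.reindex)
      show "inj_on (insert p) (Pow \<Delta>)" using insert.hyps by (auto simp: inj_on_def)
      show "(\<Sum>A\<in>Pow \<Delta>. a2 A * (\<sigma> p * chi A \<sigma>)) = sum ((\<lambda>A. a A * chi A \<sigma>) \<circ> insert p) (Pow \<Delta>)"
      proof (rule sum.cong[OF refl])
        fix A assume A: "A \<in> Pow \<Delta>"
        then have "finite A" "p \<notin> A" "insert p A - {p} = A" using insert.hyps finite_subset by auto
        then show "a2 A * (\<sigma> p * chi A \<sigma>) = ((\<lambda>A. a A * chi A \<sigma>) \<circ> insert p) A"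
          by (simp add: a_def chi_def)
      qed
    qed
    also have "(\<Sum>A\<in>Pow \<Delta>. a A * chi A \<sigma>) + (\<Sum>A\<in>insert p ` Pow \<Delta>. a A * chi A \<sigma>) = (\<Sum>A\<in>Pow (insert p \<Delta>). a A * chi A \<sigma>)"
      unfolding Pow_insert using insert.hyps by (intro sum.union_disjoint[symmetric]) auto
    finally show ?thesis .
  qed
  then show ?case by blast
qed

lemma local_fun_walsh:
  assumes "local_fun f"
  shows "\<exists>\<Delta> a. finite \<Delta> \<and> (\<forall>\<sigma>\<in>space config_space. f \<sigma> = (\<Sum>A\<in>Pow \<Delta>. a A * chi A \<sigma>))"
proof -
  obtain \<Delta> where "finite \<Delta>"
    "\<forall>\<sigma>\<in>space config_space. \<forall>\<sigma>'\<in>space config_space. (\<forall>p\<in>\<Delta>. \<sigma> p = \<sigma>' p) \<longrightarrow> f \<sigma> = f \<sigma>'"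
    using assms unfolding local_fun_def by blast
  from local_fun_walsh_aux[OF this] this(1) show ?thesis by blast
qed

lemma measurable_spin [measurable]: "(\<lambda>\<sigma>. \<sigma> p) \<in> borel_measurable config_space"
proof -
  have "(\<lambda>\<sigma>. \<sigma> p) \<in> config_space \<rightarrow>\<^sub>M count_space {-1, 1}"
    unfolding config_space_def by (rule measurable_component_singleton) simp
  then show ?thesis by (rule measurable_compose) simp
qed

lemma local_fun_measurable:
  assumes "local_fun f" shows "f \<in> borel_measurable config_space"
proof -
  obtain \<Delta> a where *: "finite \<Delta>" "\<And>\<sigma>. \<sigma> \<in> space config_space \<Longrightarrow> f \<sigma> = (\<Sum>A\<in>Pow \<Delta>. a A * chi A \<sigma>)"
    using local_fun_walsh[OF assms] by blast
  have "(\<lambda>\<sigma>. \<Sum>A\<in>Pow \<Delta>. a A * chi A \<sigma>) \<in> borel_measurable config_space"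
    unfolding chi_def by measurable
  then show ?thesis using *(2) by (subst measurable_cong) auto
qed

text \<open>A decreasing net that is bounded below tends to its infimum.\<close>

lemma tendsto_finite_subsets_antimono:
  fixes g :: "'a set \<Rightarrow> real"
  assumes "\<And>X. finite X \<Longrightarrow> 0 \<le> g X" "\<And>X Y. finite Y \<Longrightarrow> X \<subseteq> Y \<Longrightarrow> g Y \<le> g X"
  shows "\<exists>l. (g \<longlongrightarrow> l) (finite_subsets_at_top UNIV)"
proof -
  define l where "l = Inf (g ` {X. finite X})"
  have bdd: "bdd_below (g ` {X. finite X})" using assms(1) by (auto intro!: bdd_belowI[of _ 0])
  have low: "l \<le> g X" if "finite X" for X unfolding l_def using that bdd by (intro cInf_lower) auto
  have "(g \<longlongrightarrow> l) (finite_subsets_at_top UNIV)"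
  proof (rule order_tendstoI)
    fix a assume "a < l"
    then show "eventually (\<lambda>X. a < g X) (finite_subsets_at_top UNIV)"
      using low unfolding eventually_finite_subsets_at_top by (intro exI[of _ "{}"]) (auto intro: less_le_trans)
  next
    fix a assume "l < a"
    then obtain X where X: "finite X" "g X < a" using cInf_lessD[of "g ` {X. finite X}" a] unfolding l_def by auto
    then show "eventually (\<lambda>X. g X < a) (finite_subsets_at_top UNIV)"
      unfolding eventually_finite_subsets_at_top using assms(2) by (intro exI[of _ X]) (auto intro: le_less_trans)
  qed
  then show ?thesis ..
qed

lemma space_restrict_ext:
  "\<sigma> \<in> space config_space \<Longrightarrow> restrict \<sigma> \<Delta> \<in> PiE \<Delta> (\<lambda>_. {-1, 1})"
  by (auto simp: space_config_space)

lemma local_fun_cylinder: "finite \<Delta> \<Longrightarrow> local_fun (\<lambda>\<sigma>. of_bool (restrict \<sigma> \<Delta> = s))"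
  unfolding local_fun_def by (intro exI[of _ \<Delta>]) (auto simp: restrict_def fun_eq_iff)

lemma sum_cylinder:
  assumes "finite \<Delta>" "\<sigma> \<in> space config_space"
  shows "(\<Sum>s\<in>PiE \<Delta> (\<lambda>_. {-1, 1}). (b s :: real) * of_bool (restrict \<sigma> \<Delta> = s)) = b (restrict \<sigma> \<Delta>)"
proof -
  have fin: "finite (PiE \<Delta> (\<lambda>_. {-1, 1 :: real}))" using assms by (intro finite_PiE) auto
  have "(\<Sum>s\<in>PiE \<Delta> (\<lambda>_. {-1, 1}). b s * of_bool (restrict \<sigma> \<Delta> = s))
     = (\<Sum>s\<in>PiE \<Delta> (\<lambda>_. {-1, 1}). if s = restrict \<sigma> \<Delta> then b s else 0)"
    by (intro sum.cong) auto
  also have "\<dots> = b (restrict \<sigma> \<Delta>)" using fin space_restrict_ext[OF assms(2)] by (simp add: sum.delta)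
  finally show ?thesis .
qed

text \<open>Kolmogorov extension for a convergent net of finite-volume states: the limits of the
  probabilities of cylinders form a consistent family.\<close>

lemma limit_measure_exists:
  fixes A :: "site set \<Rightarrow> (config \<Rightarrow> real) \<Rightarrow> real"
  assumes A_sum: "\<And>\<Lambda> f b (X :: config set). finite X \<Longrightarrow> A \<Lambda> (\<lambda>\<sigma>. \<Sum>s\<in>X. b s * f s \<sigma>) = (\<Sum>s\<in>X. b s * A \<Lambda> (f s))"
    and A_cong: "\<And>\<Lambda> f g. (\<And>\<sigma>. \<sigma> \<in> space config_space \<Longrightarrow> f \<sigma> = g \<sigma>) \<Longrightarrow> A \<Lambda> f = A \<Lambda> g"
    and A_nonneg: "\<And>\<Lambda> f. finite \<Lambda> \<Longrightarrow> (\<And>\<sigma>. 0 \<le> f \<sigma>) \<Longrightarrow> 0 \<le> A \<Lambda> f"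
    and A_one: "\<And>\<Lambda>. finite \<Lambda> \<Longrightarrow> A \<Lambda> (\<lambda>_. 1) = 1"
    and conv: "\<And>f. local_fun f \<Longrightarrow> \<exists>l. ((\<lambda>\<Lambda>. A \<Lambda> f) \<longlongrightarrow> l) (finite_subsets_at_top UNIV)"
  shows "\<exists>\<mu>. prob_space \<mu> \<and> sets \<mu> = sets config_space \<and>
     (\<forall>f. local_fun f \<longrightarrow> ((\<lambda>\<Lambda>. A \<Lambda> f) \<longlongrightarrow> integral\<^sup>L \<mu> f) (finite_subsets_at_top UNIV))"
proof -
  let ?F = "finite_subsets_at_top (UNIV :: site set)"
  have ev: "eventually finite ?F" by (rule eventually_finite_subsets_at_top_weakI)
  have nb: "?F \<noteq> bot" by simp
  \<comment> \<open>The limit state; by uniqueness of limits it is linear on local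
    functions.\<close>
  define m where "m f = Lim ?F (\<lambda>\<Lambda>. A \<Lambda> f)" for f
  have m: "((\<lambda>\<Lambda>. A \<Lambda> f) \<longlongrightarrow> m f) ?F" if "local_fun f" for f
    using conv[OF that] tendsto_Lim[OF nb] unfolding m_def by blast
  have m_unique: "m f = l" if "((\<lambda>\<Lambda>. A \<Lambda> f) \<longlongrightarrow> l) ?F" for f l
    using that tendsto_Lim[OF nb] unfolding m_def by blast
  have m_sum: "m g = (\<Sum>s\<in>X. b s * m (f s))"
    if "finite X" "\<And>s. s \<in> X \<Longrightarrow> local_fun (f s)" "\<And>\<sigma>. \<sigma> \<in> space config_space \<Longrightarrow> g \<sigma> = (\<Sum>s\<in>X. b s * f s \<sigma>)"
    for g f b and X :: "config set"
  proof (rule m_unique)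
    have "A \<Lambda> g = (\<Sum>s\<in>X. b s * A \<Lambda> (f s))" for \<Lambda> using A_cong[OF that(3)] A_sum[OF that(1)] by simp
    then show "((\<lambda>\<Lambda>. A \<Lambda> g) \<longlongrightarrow> (\<Sum>s\<in>X. b s * m (f s))) ?F" using m that by (auto intro!: tendsto_intros)
  qed
  define XX where "XX \<Delta> = PiE \<Delta> (\<lambda>_. {-1, 1 :: real})" for \<Delta> :: "site set"
  have finXX: "finite (XX \<Delta>)" if "finite \<Delta>" for \<Delta> unfolding XX_def using that by (intro finite_PiE) auto
  define q where "q \<Delta> s = m (\<lambda>\<sigma>. of_bool (restrict \<sigma> \<Delta> = s))" for \<Delta> s
  have q_nonneg: "0 \<le> q \<Delta> s" if "finite \<Delta>" for \<Delta> s
    using m[OF local_fun_cylinder[OF that, of s]] unfolding q_def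
    by (rule tendsto_lowerbound) (use ev A_nonneg in \<open>auto elim: eventually_mono\<close>)
  have q_zero: "q \<Delta> s = 0" if "s \<notin> XX \<Delta>" for \<Delta> s
  proof -
    have "A \<Lambda> (\<lambda>\<sigma>. of_bool (restrict \<sigma> \<Delta> = s)) = A \<Lambda> (\<lambda>\<sigma>. \<Sum>s\<in>({} :: config set). 0 * 0)" for \<Lambda>
    proof (rule A_cong)
      fix \<sigma> assume "\<sigma> \<in> space config_space"
      then have "restrict \<sigma> \<Delta> \<in> XX \<Delta>" unfolding XX_def by (rule space_restrict_ext)
      then have "restrict \<sigma> \<Delta> \<noteq> s" using that by blast
      then show "of_bool (restrict \<sigma> \<Delta> = s) = (\<Sum>s\<in>({} :: config set). 0 * 0 :: real)" by simp
    qed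
    then have "A \<Lambda> (\<lambda>\<sigma>. of_bool (restrict \<sigma> \<Delta> = s)) = 0" for \<Lambda>
      using A_sum[of "{}" \<Lambda> "\<lambda>_. 0" "\<lambda>_ _. 0"] by simp
    then show ?thesis unfolding q_def by (intro m_unique) simp
  qed
  have q_sum: "(\<Sum>s\<in>XX \<Delta>. q \<Delta> s) = 1" if "finite \<Delta>" for \<Delta>
  proof -
    have "m (\<lambda>_. 1) = (\<Sum>s\<in>XX \<Delta>. 1 * m (\<lambda>\<sigma>. of_bool (restrict \<sigma> \<Delta> = s)))"
      using sum_cylinder[OF that, of _ "\<lambda>_. 1"]
      by (intro m_sum finXX that local_fun_cylinder) (simp only: XX_def)
    moreover have "m (\<lambda>_. 1) = 1"
      by (rule m_unique, rule tendsto_eventually) (use ev A_one in \<open>auto elim: eventually_mono\<close>)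
    ultimately show ?thesis by (simp add: q_def)
  qed
  define pJ where "pJ \<Delta> = embed_pmf (q \<Delta>)" for \<Delta>
  have pmf_pJ: "pmf (pJ \<Delta>) s = q \<Delta> s" if "finite \<Delta>" for \<Delta> s
    unfolding pJ_def
  proof (rule pmf_embed_pmf)
    show "0 \<le> q \<Delta> x" for x by (rule q_nonneg[OF that])
    have "(\<integral>\<^sup>+ x. ennreal (q \<Delta> x) \<partial>count_space UNIV) = (\<Sum>x\<in>XX \<Delta>. ennreal (q \<Delta> x))"
      by (rule nn_integral_count_space') (use finXX[OF that] q_zero in auto)
    also have "\<dots> = 1" using q_nonneg[OF that] q_sum[OF that] by (simp add: sum_ennreal)
    finally show "(\<integral>\<^sup>+ x. ennreal (q \<Delta> x) \<partial>count_space UNIV) = 1" .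
  qed
  have set_pJ: "set_pmf (pJ \<Delta>) \<subseteq> XX \<Delta>" if "finite \<Delta>" for \<Delta>
    using q_zero by (auto simp: set_pmf_eq pmf_pJ[OF that])
  have consistent: "map_pmf (\<lambda>f. restrict f \<Delta>) (pJ H) = pJ \<Delta>" if "\<Delta> \<subseteq> H" "finite H" for \<Delta> H
  proof (rule pmf_eqI)
    fix s
    have finD: "finite \<Delta>" using that finite_subset by auto
    let ?Y = "{s' \<in> XX H. restrict s' \<Delta> = s}"
    have "pmf (map_pmf (\<lambda>f. restrict f \<Delta>) (pJ H)) s = measure (pJ H) ((\<lambda>f. restrict f \<Delta>) -` {s})"
      by (simp add: pmf_map)
    also have "\<dots> = measure (pJ H) ?Y"
      using set_pJ[OF that(2)] by (intro measure_pmf.finite_measure_eq_AE) (auto simp: AE_measure_pmf_iff)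
    also have "\<dots> = (\<Sum>s'\<in>?Y. q H s')"
      using finXX[OF that(2)] by (simp add: measure_measure_pmf_finite pmf_pJ[OF that(2)])
    also have "\<dots> = (\<Sum>s'\<in>XX H. of_bool (restrict s' \<Delta> = s) * q H s')"
      using finXX[OF that(2)] by (intro sum.mono_neutral_cong_left) auto
    \<comment> \<open>The cylinder of s over \<Delta> is the disjoint union of the cylinders over H
      that extend s.\<close>
    also have "\<dots> = q \<Delta> s" unfolding q_def[of \<Delta>] unfolding q_def
    proof (rule m_sum[symmetric])
      show "local_fun (\<lambda>\<sigma>. of_bool (restrict \<sigma> H = s'))" for s' by (rule local_fun_cylinder[OF that(2)])
      fix \<sigma> assume \<sigma>: "\<sigma> \<in> space config_space"
      have "restrict (restrict \<sigma> H) \<Delta> = restrict \<sigma> \<Delta>" using that by (auto simp: restrict_def fun_eq_iff)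
      then show "of_bool (restrict \<sigma> \<Delta> = s) = (\<Sum>s'\<in>XX H. of_bool (restrict s' \<Delta> = s) * of_bool (restrict \<sigma> H = s') :: real)"
        unfolding XX_def sum_cylinder[OF that(2) \<sigma>, of "\<lambda>s'. of_bool (restrict s' \<Delta> = s)"] by simp
    qed (use finXX[OF that(2)] in auto)
    finally show "pmf (map_pmf (\<lambda>f. restrict f \<Delta>) (pJ H)) s = pmf (pJ \<Delta>) s" by (simp add: pmf_pJ[OF finD])
  qed
  \<comment> \<open>Kolmogorov's theorem is applied over the reals, a Polish space; the measures are
    concentrated on the values -1 and 1.\<close>
  define P where "P \<Delta> = distr (measure_pmf (pJ \<Delta>)) (PiM \<Delta> (\<lambda>_. borel :: real measure)) (\<lambda>x. restrict x \<Delta>)" for \<Delta>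
  have r_meas: "(\<lambda>x. restrict x \<Delta>) \<in> measure_pmf p \<rightarrow>\<^sub>M PiM \<Delta> (\<lambda>_. borel :: real measure)" for p :: "config pmf" and \<Delta>
    by (intro measurableI) (auto simp: space_PiM)
  have P_consistent: "P \<Delta> = distr (P H) (PiM \<Delta> (\<lambda>_. borel)) (\<lambda>f. restrict f \<Delta>)"
    if H: "\<Delta> \<subseteq> H" "finite H" for \<Delta> H
  proof -
    have "distr (P H) (PiM \<Delta> (\<lambda>_. borel)) (\<lambda>f. restrict f \<Delta>)
       = distr (measure_pmf (pJ H)) (PiM \<Delta> (\<lambda>_. borel)) ((\<lambda>f. restrict f \<Delta>) \<circ> (\<lambda>x. restrict x H))"
      unfolding P_def using H by (intro distr_distr measurable_restrict_subset r_meas)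
    also have "(\<lambda>f :: config. restrict f \<Delta>) \<circ> (\<lambda>x. restrict x H) = (\<lambda>x. restrict x \<Delta>) \<circ> (\<lambda>f. restrict f \<Delta>)"
      using H by (auto simp: fun_eq_iff restrict_def)
    also have "distr (measure_pmf (pJ H)) (PiM \<Delta> (\<lambda>_. borel)) ((\<lambda>x. restrict x \<Delta>) \<circ> (\<lambda>f. restrict f \<Delta>))
       = distr (distr (measure_pmf (pJ H)) (count_space UNIV) (\<lambda>f. restrict f \<Delta>)) (PiM \<Delta> (\<lambda>_. borel)) (\<lambda>x. restrict x \<Delta>)"
      by (rule distr_distr[symmetric]) (auto simp: space_PiM)
    also have "\<dots> = P \<Delta>" unfolding map_pmf_rep_eq[symmetric] consistent[OF H] P_def ..
    finally show ?thesis ..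
  qed
  have P_prob: "prob_space (P \<Delta>)" for \<Delta>
    unfolding P_def by (rule measure_pmf.prob_space_distr[OF r_meas])
  interpret polish_projective UNIV P
    by (intro polish_projective.intro projective_family.intro P_prob P_consistent)
  \<comment> \<open>Brings real-valued configurations back to spins: 1 is kept and every other value
    becomes -1. On the values that carry the mass this is the identity.\<close>
  define g where "g x = (if x = 1 then 1 else -1 :: real)" for x :: real
  have g_meas: "g \<in> borel \<rightarrow>\<^sub>M count_space {-1, 1}"
  proof -
    have "{x. g x = a} \<in> sets borel" for a
    proof -
      have "{x. g x = a} = (if a = 1 then {1} else if a = -1 then - {1} else {})" by (auto simp: g_def)
      then show ?thesis by (simp add: borel_comp)
    qed
    then show ?thesis by (intro measurable_count_space_eq2[THEN iffD2]) (auto simp: g_def vimage_def)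
  qed
  have G_meas: "(\<lambda>\<sigma> p. g (\<sigma> p)) \<in> lim \<rightarrow>\<^sub>M config_space"
    unfolding config_space_def
  proof (rule measurable_PiM_single')
    fix p :: site
    have "(\<lambda>\<sigma>. \<sigma> p) \<in> lim \<rightarrow>\<^sub>M borel"
      using measurable_component_singleton[of p UNIV "\<lambda>_. borel :: real measure"] by (simp cong: measurable_cong_sets)
    then show "(\<lambda>\<sigma>. g (\<sigma> p)) \<in> lim \<rightarrow>\<^sub>M count_space {-1, 1}" using g_meas by (rule measurable_compose)
  qed (auto simp: g_def PiE_def extensional_def)
  define \<mu> where "\<mu> = distr lim config_space (\<lambda>\<sigma> p. g (\<sigma> p))"
  have prob: "prob_space \<mu>" unfolding \<mu>_def by (rule prob_space.prob_space_distr[OF P.prob_space_axioms G_meas])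
  interpret mu: prob_space \<mu> by (rule prob)
  have sets_mu: "sets \<mu> = sets config_space" and space_mu: "space \<mu> = space config_space" by (simp_all add: \<mu>_def)
  have cyl_sets: "{\<sigma> \<in> space config_space. restrict \<sigma> \<Delta> = s} \<in> sets config_space" if "finite \<Delta>" for \<Delta> s
  proof -
    have "(\<lambda>\<sigma>. of_bool (restrict \<sigma> \<Delta> = s) :: real) \<in> borel_measurable config_space"
      by (rule local_fun_measurable[OF local_fun_cylinder[OF that]])
    then have "(\<lambda>\<sigma>. of_bool (restrict \<sigma> \<Delta> = s) :: real) -` {1} \<inter> space config_space \<in> sets config_space"
      by (rule measurable_sets) simp
    also have "(\<lambda>\<sigma>. of_bool (restrict \<sigma> \<Delta> = s) :: real) -` {1} \<inter> space config_space = {\<sigma> \<in> space config_space. restrict \<sigma> \<Delta> = s}"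
      by auto
    finally show ?thesis .
  qed
  have cyl: "measure \<mu> {\<sigma> \<in> space config_space. restrict \<sigma> \<Delta> = s} = q \<Delta> s" if \<Delta>: "finite \<Delta>" and s: "s \<in> XX \<Delta>" for \<Delta> s
  proof -
    let ?Y = "{y \<in> space (PiM \<Delta> (\<lambda>_. borel :: real measure)). \<forall>p\<in>\<Delta>. g (y p) = s p}"
    have Y: "?Y \<in> sets (PiM \<Delta> (\<lambda>_. borel))"
    proof -
      have coord: "(\<lambda>y. g (y p)) \<in> PiM \<Delta> (\<lambda>_. borel) \<rightarrow>\<^sub>M count_space {-1, 1}" if "p \<in> \<Delta>" for p
        by (rule measurable_compose[OF measurable_component_singleton[OF that] g_meas])
      have "{y \<in> space (PiM \<Delta> (\<lambda>_. borel :: real measure)). g (y p) = s p} \<in> sets (PiM \<Delta> (\<lambda>_. borel))" if p: "p \<in> \<Delta>" for p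
      proof -
        have "s p \<in> {-1, 1}" using s p unfolding XX_def by (rule PiE_mem)
        then have "(\<lambda>y. g (y p)) -` {s p} \<inter> space (PiM \<Delta> (\<lambda>_. borel :: real measure)) \<in> sets (PiM \<Delta> (\<lambda>_. borel))"
          by (intro measurable_sets[OF coord[OF p]]) auto
        moreover have "(\<lambda>y. g (y p)) -` {s p} \<inter> space (PiM \<Delta> (\<lambda>_. borel :: real measure))
          = {y \<in> space (PiM \<Delta> (\<lambda>_. borel :: real measure)). g (y p) = s p}" by auto
        ultimately show ?thesis by simp
      qed
      then show ?thesis using \<Delta> by (intro sets.sets_Collect_finite_All) auto
    qed
    have "measure \<mu> {\<sigma> \<in> space config_space. restrict \<sigma> \<Delta> = s}
       = measure lim ((\<lambda>\<sigma> p. g (\<sigma> p)) -` {\<sigma> \<in> space config_space. restrict \<sigma> \<Delta> = s} \<inter> space lim)"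
      unfolding \<mu>_def by (rule measure_distr[OF G_meas cyl_sets[OF \<Delta>]])
    also have "(\<lambda>\<sigma> p. g (\<sigma> p)) -` {\<sigma> \<in> space config_space. restrict \<sigma> \<Delta> = s} \<inter> space lim = prod_emb UNIV (\<lambda>_. borel) \<Delta> ?Y"
    proof -
      have "restrict (\<lambda>p. g (\<sigma> p)) \<Delta> = s \<longleftrightarrow> (\<forall>p\<in>\<Delta>. g (\<sigma> p) = s p)" for \<sigma> :: config
        using s by (auto simp: XX_def fun_eq_iff PiE_def extensional_def)
      then show ?thesis
        by (auto simp: prod_emb_def space_PiM space_config_space g_def)
    qed
    also have "measure lim (prod_emb UNIV (\<lambda>_. borel) \<Delta> ?Y) = measure (P \<Delta>) ?Y"
      by (rule measure_lim_emb) (use \<Delta> Y in auto)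
    also have "\<dots> = measure (pJ \<Delta>) ((\<lambda>x. restrict x \<Delta>) -` ?Y \<inter> space (measure_pmf (pJ \<Delta>)))"
      unfolding P_def by (rule measure_distr[OF r_meas Y])
    also have "\<dots> = measure (pJ \<Delta>) {s}"
    proof (rule measure_pmf.finite_measure_eq_AE)
      have "x \<in> (\<lambda>x. restrict x \<Delta>) -` ?Y \<longleftrightarrow> x = s" if "x \<in> XX \<Delta>" for x
      proof -
        have "g (x p) = x p" if p: "p \<in> \<Delta>" for p
        proof -
          have "x p \<in> {-1, 1}" using \<open>x \<in> XX \<Delta>\<close> p unfolding XX_def by (rule PiE_mem)
          then show ?thesis by (auto simp: g_def)
        qed
        then have "x \<in> (\<lambda>x. restrict x \<Delta>) -` ?Y \<longleftrightarrow> (\<forall>p\<in>\<Delta>. x p = s p)" by (auto simp: space_PiM)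
        also have "\<dots> \<longleftrightarrow> x = s" using that s unfolding XX_def by (auto intro: PiE_ext)
        finally show ?thesis .
      qed
      then show "AE x in measure_pmf (pJ \<Delta>). (x \<in> (\<lambda>x. restrict x \<Delta>) -` ?Y \<inter> space (measure_pmf (pJ \<Delta>))) = (x \<in> {s})"
        using set_pJ[OF \<Delta>] by (auto simp: AE_measure_pmf_iff)
    qed auto
    also have "\<dots> = q \<Delta> s" using pmf_pJ[OF \<Delta>] by (simp add: measure_pmf_single)
    finally show ?thesis .
  qed
  have "((\<lambda>\<Lambda>. A \<Lambda> f) \<longlongrightarrow> integral\<^sup>L \<mu> f) ?F" if f: "local_fun f" for f
  proof -
    obtain \<Delta> where \<Delta>: "finite \<Delta>"
      "\<forall>\<sigma>\<in>space config_space. \<forall>\<sigma>'\<in>space config_space. (\<forall>p\<in>\<Delta>. \<sigma> p = \<sigma>' p) \<longrightarrow> f \<sigma> = f \<sigma>'"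
      using f unfolding local_fun_def by blast
    \<comment> \<open>The value 1 outside \<Delta> only completes s to an admissible configuration,
      since f is determined on \<Delta>.\<close>
    define b where "b s = f (\<lambda>p. if p \<in> \<Delta> then s p else 1)" for s
    have fb: "f \<sigma> = (\<Sum>s\<in>XX \<Delta>. b s * of_bool (restrict \<sigma> \<Delta> = s))" if \<sigma>: "\<sigma> \<in> space config_space" for \<sigma>
    proof -
      define \<sigma>' where "\<sigma>' = (\<lambda>p. if p \<in> \<Delta> then restrict \<sigma> \<Delta> p else 1)"
      have "\<sigma>' p \<in> {-1, 1}" for p
      proof -
        have "\<sigma> p \<in> {-1, 1}" using \<sigma> unfolding space_config_space by blast
        then show ?thesis by (auto simp: \<sigma>'_def)
      qed
      then have "\<sigma>' \<in> space config_space" unfolding space_config_space by blast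
      moreover have "\<forall>p\<in>\<Delta>. \<sigma>' p = \<sigma> p" by (simp add: \<sigma>'_def)
      ultimately have "f \<sigma>' = f \<sigma>" using \<Delta>(2) \<sigma> by blast
      then have "b (restrict \<sigma> \<Delta>) = f \<sigma>" unfolding b_def \<sigma>'_def .
      then show ?thesis using sum_cylinder[OF \<Delta>(1) \<sigma>, of b] by (simp add: XX_def)
    qed
    have "integral\<^sup>L \<mu> f = integral\<^sup>L \<mu> (\<lambda>\<sigma>. \<Sum>s\<in>XX \<Delta>. b s * indicat_real {\<sigma> \<in> space config_space. restrict \<sigma> \<Delta> = s} \<sigma>)"
    proof (rule Bochner_Integration.integral_cong[OF refl])
      fix \<sigma> assume "\<sigma> \<in> space \<mu>"
      then have \<sigma>: "\<sigma> \<in> space config_space" by (simp add: space_mu)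
      then have ind: "indicat_real {\<sigma> \<in> space config_space. restrict \<sigma> \<Delta> = s} \<sigma> = of_bool (restrict \<sigma> \<Delta> = s)" for s
        by (simp add: indicator_def)
      show "f \<sigma> = (\<Sum>s\<in>XX \<Delta>. b s * indicat_real {\<sigma> \<in> space config_space. restrict \<sigma> \<Delta> = s} \<sigma>)"
        unfolding ind by (rule fb[OF \<sigma>])
    qed
    also have "\<dots> = (\<Sum>s\<in>XX \<Delta>. b s * measure \<mu> {\<sigma> \<in> space config_space. restrict \<sigma> \<Delta> = s})"
      using cyl_sets[OF \<Delta>(1)] sets_mu
      by (subst Bochner_Integration.integral_sum) (auto intro!: integrable_mult_right integrable_real_indicator simp: mu.emeasure_eq_measure)
    also have "\<dots> = (\<Sum>s\<in>XX \<Delta>. b s * m (\<lambda>\<sigma>. of_bool (restrict \<sigma> \<Delta> = s)))"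
      using cyl[OF \<Delta>(1)] by (simp add: q_def)
    also have "\<dots> = m f"
      by (rule m_sum[symmetric]) (use fb finXX[OF \<Delta>(1)] local_fun_cylinder[OF \<Delta>(1)] in auto)
    finally show ?thesis using m[OF f] by simp
  qed
  then show ?thesis using prob sets_mu by blast
qed

subsection \<open>Phase transition\<close>

text \<open>tanh x = (1 - u) / (1 + u) with u = exp (- 2 x), where 1 + u \<le> 2 and 1 - u \<ge> 2 x
  (1 - 2 x). This converts small couplings into bond probabilities at the relative cost a.\<close>

lemma tanh_ge:
  assumes "0 \<le> (x::real)" "x \<le> a / 2" shows "(1 - a) * x \<le> tanh x"
proof -
  define u where "u = exp (- 2 * x)"
  have u: "0 < u" "u \<le> 1" using assms by (auto simp: u_def)
  have "2 * x * (1 - 2 * x) \<le> 1 - u" using one_minus_exp_ge[of "2 * x"] assms by (simp add: u_def)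
  moreover have "(1 - a) * x \<le> (1 - 2 * x) * x" using assms by (intro mult_right_mono) auto
  ultimately have "(1 - a) * x \<le> (1 - u) / 2" by (simp add: algebra_simps)
  also have "\<dots> \<le> (1 - u) / (1 + u)" using u by (intro divide_left_mono) auto
  also have "\<dots> = tanh x" by (simp add: tanh_real_altdef u_def)
  finally show ?thesis .
qed

lemma reach_spins_eq:
  assumes "reach W v u" "\<forall>e\<in>W. chi e \<sigma> = 1" "\<sigma> \<in> spins \<Lambda>"
  shows "\<sigma> v = \<sigma> u"
  using assms(1) unfolding reach_def
proof (induction rule: rtrancl_induct)
  case (step a b)
  have "chi {a, b} \<sigma> = 1" using assms(2) step by auto
  then have "\<sigma> a = \<sigma> b"
    using spins_cases[OF assms(3), of a] spins_cases[OF assms(3), of b] by (cases "a = b") (auto simp: chi_def)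
  then show ?case using step by simp
qed simp

section \<open>Spin flip\<close>

definition flip :: "config \<Rightarrow> config" where "flip \<sigma> = (\<lambda>p. - \<sigma> p)"

lemma flip_flip [simp]: "flip (flip \<sigma>) = \<sigma>"
  by (simp add: flip_def)

lemma flip_space: "\<sigma> \<in> space config_space \<Longrightarrow> flip \<sigma> \<in> space config_space"
  by (auto simp: space_config_space flip_def)

lemma measurable_flip: "flip \<in> config_space \<rightarrow>\<^sub>M config_space"
proof -
  have "(\<lambda>\<sigma> p. - \<sigma> p) \<in> config_space \<rightarrow>\<^sub>M PiM (UNIV :: site set) (\<lambda>_. count_space {-1, 1 :: real})"
  proof (rule measurable_PiM_single')
    fix p :: site
    have "(\<lambda>\<sigma>. \<sigma> p) \<in> config_space \<rightarrow>\<^sub>M count_space {-1, 1}"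
      unfolding config_space_def by (rule measurable_component_singleton) simp
    moreover have "uminus \<in> count_space {-1, 1 :: real} \<rightarrow>\<^sub>M count_space {-1, 1}"
      by (intro measurableI) auto
    ultimately show "(\<lambda>\<sigma>. - \<sigma> p) \<in> config_space \<rightarrow>\<^sub>M count_space {-1, 1}"
      by (rule measurable_compose)
  qed (auto simp: space_config_space PiE_def extensional_def Pi_def)
  then show ?thesis by (simp add: flip_def[abs_def] config_space_def)
qed

lemma local_fun_flip: "local_fun f \<Longrightarrow> local_fun (\<lambda>\<sigma>. f (flip \<sigma>))"
proof -
  assume "local_fun f"
  then obtain \<Delta> where \<Delta>: "finite \<Delta>"
    "\<forall>\<sigma>\<in>space config_space. \<forall>\<sigma>'\<in>space config_space. (\<forall>p\<in>\<Delta>. \<sigma> p = \<sigma>' p) \<longrightarrow> f \<sigma> = f \<sigma>'"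
    unfolding local_fun_def by blast
  have "f (flip \<sigma>) = f (flip \<sigma>')"
    if "\<sigma> \<in> space config_space" "\<sigma>' \<in> space config_space" "\<forall>p\<in>\<Delta>. \<sigma> p = \<sigma>' p" for \<sigma> \<sigma>'
  proof -
    have "\<forall>p\<in>\<Delta>. flip \<sigma> p = flip \<sigma>' p" using that(3) by (simp add: flip_def)
    then show ?thesis using \<Delta>(2) flip_space[OF that(1)] flip_space[OF that(2)] by blast
  qed
  then show "local_fun (\<lambda>\<sigma>. f (flip \<sigma>))" unfolding local_fun_def using \<Delta>(1) by blast
qed

lemma hamiltonian_flip: "hamiltonian J \<epsilon> \<gamma> \<Lambda> (flip \<sigma>) = hamiltonian J \<epsilon> \<gamma> \<Lambda> \<sigma>"
  by (simp add: hamiltonian_def flip_def)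

lemma configs_bc_flip: "configs_bc \<Lambda> (\<lambda>_. -1) = flip ` configs_bc \<Lambda> (\<lambda>_. 1)"
proof
  show "configs_bc \<Lambda> (\<lambda>_. -1) \<subseteq> flip ` configs_bc \<Lambda> (\<lambda>_. 1)"
  proof
    fix \<sigma> assume "\<sigma> \<in> configs_bc \<Lambda> (\<lambda>_. -1)"
    then have "flip \<sigma> \<in> configs_bc \<Lambda> (\<lambda>_. 1)" using flip_space[of \<sigma>] by (auto simp: configs_bc_def flip_def)
    then show "\<sigma> \<in> flip ` configs_bc \<Lambda> (\<lambda>_. 1)" by (intro image_eqI[of _ _ "flip \<sigma>"]) auto
  qed
  show "flip ` configs_bc \<Lambda> (\<lambda>_. 1) \<subseteq> configs_bc \<Lambda> (\<lambda>_. -1)"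
  proof
    fix \<sigma> assume "\<sigma> \<in> flip ` configs_bc \<Lambda> (\<lambda>_. 1)"
    then obtain \<sigma>' where "\<sigma> = flip \<sigma>'" "\<sigma>' \<in> configs_bc \<Lambda> (\<lambda>_. 1)" by blast
    then show "\<sigma> \<in> configs_bc \<Lambda> (\<lambda>_. -1)" using flip_space[of \<sigma>'] by (auto simp: configs_bc_def flip_def)
  qed
qed

lemma inj_flip: "inj_on flip X"
  by (rule inj_on_inverseI[of _ flip]) simp

lemma integral_gibbs_minus:
  fixes f :: "config \<Rightarrow> real"
  assumes "finite \<Lambda>" "f \<in> borel_measurable config_space"
  shows "integral\<^sup>L (gibbs J \<epsilon> \<gamma> \<Lambda> (\<lambda>_. -1)) f = integral\<^sup>L (gibbs J \<epsilon> \<gamma> \<Lambda> (\<lambda>_. 1)) (\<lambda>\<sigma>. f (flip \<sigma>))"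
proof -
  have fin: "finite (configs_bc \<Lambda> (\<lambda>_. 1))" using assms by (simp add: configs_bc_plus)
  have fin': "finite (configs_bc \<Lambda> (\<lambda>_. -1))" unfolding configs_bc_flip using fin by simp
  have meas: "(\<lambda>\<sigma>. f (flip \<sigma>)) \<in> borel_measurable config_space" using measurable_compose[OF measurable_flip assms(2)] .
  show ?thesis
    unfolding integral_gibbs_sum[OF fin' assms(2)] integral_gibbs_sum[OF fin meas] partition_fun_def
    unfolding configs_bc_flip by (simp add: sum.reindex[OF inj_flip] hamiltonian_flip o_def)
qed

text \<open>The flip exchanges the two boundary conditions and preserves the energy, so a single
  construction of an infinite-volume measure serves both phases.\<close>

lemma thermodynamic_limit_minus:
  assumes "thermodynamic_limit J \<epsilon> \<gamma> (\<lambda>_. 1) \<mu>"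
  shows "thermodynamic_limit J \<epsilon> \<gamma> (\<lambda>_. -1) (distr \<mu> config_space flip)"
proof -
  have \<mu>: "prob_space \<mu>" "sets \<mu> = sets config_space" using assms by (auto simp: thermodynamic_limit_def)
  have flip_meas: "flip \<in> \<mu> \<rightarrow>\<^sub>M config_space" using measurable_flip measurable_cong_sets[OF \<mu>(2) refl] by blast
  have "((\<lambda>\<Lambda>. integral\<^sup>L (gibbs J \<epsilon> \<gamma> \<Lambda> (\<lambda>_. -1)) f) \<longlongrightarrow> integral\<^sup>L (distr \<mu> config_space flip) f) (finite_subsets_at_top UNIV)"
    if f: "local_fun f" for f
  proof -
    have "integral\<^sup>L (distr \<mu> config_space flip) f = integral\<^sup>L \<mu> (\<lambda>\<sigma>. f (flip \<sigma>))"
      by (rule integral_distr[OF flip_meas local_fun_measurable[OF f]])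
    moreover have "((\<lambda>\<Lambda>. integral\<^sup>L (gibbs J \<epsilon> \<gamma> \<Lambda> (\<lambda>_. 1)) (\<lambda>\<sigma>. f (flip \<sigma>))) \<longlongrightarrow> integral\<^sup>L \<mu> (\<lambda>\<sigma>. f (flip \<sigma>))) (finite_subsets_at_top UNIV)"
      using assms local_fun_flip[OF f] by (auto simp: thermodynamic_limit_def)
    moreover have "eventually (\<lambda>\<Lambda>. integral\<^sup>L (gibbs J \<epsilon> \<gamma> \<Lambda> (\<lambda>_. 1)) (\<lambda>\<sigma>. f (flip \<sigma>)) = integral\<^sup>L (gibbs J \<epsilon> \<gamma> \<Lambda> (\<lambda>_. -1)) f) (finite_subsets_at_top UNIV)"
      by (rule eventually_finite_subsets_at_top_weakI) (simp add: integral_gibbs_minus local_fun_measurable[OF f])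
    ultimately show ?thesis by (simp add: tendsto_cong)
  qed
  then show ?thesis unfolding thermodynamic_limit_def using prob_space.prob_space_distr[OF \<mu>(1) flip_meas] by simp
qed

section \<open>Existence of the plus state and positivity of its magnetization\<close>

context layered
begin

lemma avg_sum: "avg \<Lambda> (\<lambda>\<sigma>. \<Sum>s\<in>X. b s * f s \<sigma>) = (\<Sum>s\<in>X. b s * avg \<Lambda> (f s))"
proof -
  have "isum \<Lambda> E t (\<lambda>\<sigma>. \<Sum>s\<in>X. b s * f s \<sigma>) = (\<Sum>s\<in>X. b s * isum \<Lambda> E t (f s))" for E t
    unfolding isum_def sum_distrib_right sum_distrib_left
    by (subst sum.swap) (simp add: mult.assoc)
  then show ?thesis by (simp add: avg_def sum_divide_distrib)
qed

lemma avg_cong: "(\<And>\<sigma>. \<sigma> \<in> space config_space \<Longrightarrow> f \<sigma> = g \<sigma>) \<Longrightarrow> avg \<Lambda> f = avg \<Lambda> g"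
proof -
  assume "\<And>\<sigma>. \<sigma> \<in> space config_space \<Longrightarrow> f \<sigma> = g \<sigma>"
  then have "f \<sigma> = g \<sigma>" if "\<sigma> \<in> spins \<Lambda>" for \<sigma> using spins_subset_space that by blast
  then show ?thesis by (simp add: avg_def isum_def)
qed

lemma vol_prob: "is_prob (vol_edges \<Lambda>) \<tau>"
  using vol_edges_edge by (intro \<tau>_prob) auto

lemma avg_nonneg:
  assumes "finite \<Lambda>" "\<And>\<sigma>. 0 \<le> f \<sigma>" shows "0 \<le> avg \<Lambda> f"
  unfolding avg_def isum_def
  by (intro divide_nonneg_nonneg sum_nonneg mult_nonneg_nonneg) (use assms weight_nonneg[OF vol_prob] in auto)

lemma avg_one: "finite \<Lambda> \<Longrightarrow> avg \<Lambda> (\<lambda>_. 1) = 1"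
  unfolding avg_def using isum_one_pos[OF _ vol_prob, of \<Lambda> \<Lambda>] by simp

lemma avg_converges:
  assumes "local_fun f"
  shows "\<exists>l. ((\<lambda>\<Lambda>. avg \<Lambda> f) \<longlongrightarrow> l) (finite_subsets_at_top UNIV)"
proof -
  obtain \<Delta> a where *: "finite \<Delta>" "\<forall>\<sigma>\<in>space config_space. f \<sigma> = (\<Sum>A\<in>Pow \<Delta>. a A * chi A \<sigma>)"
    using local_fun_walsh[OF assms] by blast
  have eq: "avg \<Lambda> f = (\<Sum>A\<in>Pow \<Delta>. a A * avg \<Lambda> (chi A))" for \<Lambda>
    using avg_cong[of f "\<lambda>\<sigma>. \<Sum>A\<in>Pow \<Delta>. a A * chi A \<sigma>" \<Lambda>] *(2) avg_sum by simp
  have "\<forall>A\<in>Pow \<Delta>. \<exists>l. ((\<lambda>\<Lambda>. avg \<Lambda> (chi A)) \<longlongrightarrow> l) (finite_subsets_at_top UNIV)"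
  proof
    fix A assume "A \<in> Pow \<Delta>"
    then have "finite A" using *(1) finite_subset by auto
    then show "\<exists>l. ((\<lambda>\<Lambda>. avg \<Lambda> (chi A)) \<longlongrightarrow> l) (finite_subsets_at_top UNIV)"
      by (intro tendsto_finite_subsets_antimono avg_chi_nonneg avg_chi_antimono)
  qed
  then obtain l where "\<forall>A\<in>Pow \<Delta>. ((\<lambda>\<Lambda>. avg \<Lambda> (chi A)) \<longlongrightarrow> l A) (finite_subsets_at_top UNIV)" by metis
  then have "((\<lambda>\<Lambda>. \<Sum>A\<in>Pow \<Delta>. a A * avg \<Lambda> (chi A)) \<longlongrightarrow> (\<Sum>A\<in>Pow \<Delta>. a A * l A)) (finite_subsets_at_top UNIV)"
    by (intro tendsto_intros) auto
  then show ?thesis unfolding eq by blast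
qed

lemma plus_limit_exists:
  obtains \<mu> where "thermodynamic_limit J \<epsilon> \<gamma> (\<lambda>_. 1) \<mu>"
    "\<And>f. local_fun f \<Longrightarrow> ((\<lambda>\<Lambda>. avg \<Lambda> f) \<longlongrightarrow> integral\<^sup>L \<mu> f) (finite_subsets_at_top UNIV)"
proof -
  have "\<exists>\<mu>. prob_space \<mu> \<and> sets \<mu> = sets config_space \<and>
     (\<forall>f. local_fun f \<longrightarrow> ((\<lambda>\<Lambda>. avg \<Lambda> f) \<longlongrightarrow> integral\<^sup>L \<mu> f) (finite_subsets_at_top UNIV))"
  proof (rule limit_measure_exists)
    show "avg \<Lambda> f = avg \<Lambda> g" if "\<And>\<sigma>. \<sigma> \<in> space config_space \<Longrightarrow> f \<sigma> = g \<sigma>" for \<Lambda> f g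
      by (rule avg_cong[OF that])
    show "0 \<le> avg \<Lambda> f" if "finite \<Lambda>" "\<And>\<sigma>. 0 \<le> f \<sigma>" for \<Lambda> f
      by (rule avg_nonneg[OF that])
  qed (rule avg_sum avg_one avg_converges; assumption)+
  then obtain \<mu> where \<mu>: "prob_space \<mu>" "sets \<mu> = sets config_space"
    "\<And>f. local_fun f \<Longrightarrow> ((\<lambda>\<Lambda>. avg \<Lambda> f) \<longlongrightarrow> integral\<^sup>L \<mu> f) (finite_subsets_at_top UNIV)" by blast
  have "((\<lambda>\<Lambda>. integral\<^sup>L (gibbs J \<epsilon> \<gamma> \<Lambda> (\<lambda>_. 1)) f) \<longlongrightarrow> integral\<^sup>L \<mu> f) (finite_subsets_at_top UNIV)" if f: "local_fun f" for f
  proof (rule Lim_transform_eventually[OF \<mu>(3)[OF f]])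
    show "eventually (\<lambda>\<Lambda>. avg \<Lambda> f = integral\<^sup>L (gibbs J \<epsilon> \<gamma> \<Lambda> (\<lambda>_. 1)) f) (finite_subsets_at_top UNIV)"
      by (rule eventually_finite_subsets_at_top_weakI) (simp add: integral_gibbs local_fun_measurable[OF f])
  qed
  then have "thermodynamic_limit J \<epsilon> \<gamma> (\<lambda>_. 1) \<mu>"
    unfolding thermodynamic_limit_def using \<mu>(1,2) by (intro conjI allI impI)
  then show ?thesis using \<mu>(3) by (rule that)
qed

text \<open>A cluster with more than \<open>card \<Lambda>\<close> sites must leave the volume,
  where spins are frozen at plus; its starting site is then plus in every configuration that
  satisfies the open bonds. The sum over V is the union bound over the unknown starting
  site.\<close>

lemma magnetization_ge:
  assumes \<Lambda>: "finite \<Lambda>" and V: "finite V"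
    and E: "finite E" "\<forall>e\<in>E. horizontal e \<or> vertical e"
    and perc: "1/2 \<le> bern_ex E \<tau> (\<lambda>W. of_bool (\<exists>v\<in>V. \<exists>C. finite C \<and> Suc (card \<Lambda>) \<le> card C \<and> (\<forall>u\<in>C. reach W v u)))"
  shows "1/2 \<le> (\<Sum>v\<in>V. avg \<Lambda> (chi {v}))"
proof -
  \<comment> \<open>E and the bonds of the volume need not match. On their union both the
    percolation bound and the Gibbs state are available, because the extra bonds miss \<Lambda> or
    have strength 0.\<close>
  let ?E = "E \<union> vol_edges \<Lambda>"
  have edge: "horizontal e \<or> vertical e" if "e \<in> ?E" for e using that E vol_edges_edge by blast
  have finE: "finite ?E" using E \<Lambda> by simp
  have fin_e: "finite e" if "e \<in> ?E" for e using edge[OF that] by (auto simp: horizontal_def vertical_def)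
  have pr: "is_prob ?E \<tau>" using edge by (rule \<tau>_prob)
  interpret ferromagnet \<Lambda> ?E by unfold_locales (use \<Lambda> finE fin_e in auto)
  let ?pin = "\<lambda>v \<omega>. \<forall>\<sigma>\<in>spins \<Lambda>. (\<forall>e\<in>\<omega>. chi e \<sigma> = 1) \<longrightarrow> chi {v} \<sigma> = 1"
  let ?LC = "\<lambda>W. \<exists>v\<in>V. \<exists>C. finite C \<and> Suc (card \<Lambda>) \<le> card C \<and> (\<forall>u\<in>C. reach W v u)"
  have corr: "avg \<Lambda> (chi {v}) = corr \<Lambda> ?E \<tau> {v}" for v
  proof -
    have "corr \<Lambda> ?E \<tau> {v} = corr \<Lambda> (vol_edges \<Lambda>) \<tau> {v}"
    proof (rule corr_irrelevant_bonds[OF \<Lambda> finE _ pr])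
      fix e assume "e \<in> ?E - vol_edges \<Lambda>"
      then show "e \<inter> \<Lambda> = {} \<or> \<tau> e = 0" using edge_in_vol[of e \<Lambda>] edge[of e] by blast
    qed simp
    then show ?thesis by (simp add: avg_chi)
  qed
  have "1/2 \<le> bern_ex E \<tau> (\<lambda>W. of_bool (?LC W))" by (rule perc)
  also have "\<dots> = bern_ex ?E \<tau> (\<lambda>\<omega>. of_bool (?LC (\<omega> \<inter> E)))" using finE by (intro bern_ex_Int[symmetric]) auto
  also have "\<dots> \<le> bern_ex ?E \<tau> (\<lambda>\<omega>. \<Sum>v\<in>V. of_bool (?pin v \<omega>))"
  proof (rule bern_ex_mono[OF pr])
    fix \<omega>
    have "\<exists>v\<in>V. ?pin v \<omega>" if lc: "?LC (\<omega> \<inter> E)"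
    proof -
      obtain v C where vC: "v \<in> V" "finite C" "Suc (card \<Lambda>) \<le> card C" "\<forall>u\<in>C. reach (\<omega> \<inter> E) v u" using lc by blast
      have "\<not> C \<subseteq> \<Lambda>" using card_mono[OF \<Lambda>, of C] vC(3) by linarith
      then obtain u where u: "u \<in> C" "u \<notin> \<Lambda>" by blast
      have "?pin v \<omega>"
      proof (intro ballI impI)
        fix \<sigma> assume \<sigma>: "\<sigma> \<in> spins \<Lambda>" "\<forall>e\<in>\<omega>. chi e \<sigma> = 1"
        have "reach (\<omega> \<inter> E) v u" using vC(4) u(1) by blast
        then have "\<sigma> v = \<sigma> u" using \<sigma> by (intro reach_spins_eq[of "\<omega> \<inter> E"]) auto
        also have "\<sigma> u = 1" using \<sigma>(1) u(2) unfolding spins_def by blast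
        finally show "chi {v} \<sigma> = 1" by (simp add: chi_def)
      qed
      then show ?thesis using vC(1) by blast
    qed
    then show "of_bool (?LC (\<omega> \<inter> E)) \<le> (\<Sum>v\<in>V. of_bool (?pin v \<omega>) :: real)"
    proof (cases "?LC (\<omega> \<inter> E)")
      case True
      then obtain v where v: "v \<in> V" "?pin v \<omega>" using \<open>?LC (\<omega> \<inter> E) \<Longrightarrow> \<exists>v\<in>V. ?pin v \<omega>\<close> by blast
      have "of_bool (?pin v \<omega>) \<le> (\<Sum>v\<in>V. of_bool (?pin v \<omega>) :: real)"
        using V v(1) by (intro member_le_sum) auto
      moreover have "of_bool (?pin v \<omega>) = (1::real)" unfolding of_bool_eq_1_iff by (rule v(2))
      moreover have "of_bool (?LC (\<omega> \<inter> E)) \<le> (1::real)" by simp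
      ultimately show ?thesis by linarith
    next
      case False
      then have "of_bool (?LC (\<omega> \<inter> E)) = (0::real)" unfolding of_bool_eq_0_iff .
      moreover have "0 \<le> (\<Sum>v\<in>V. of_bool (?pin v \<omega>) :: real)" by (intro sum_nonneg) simp
      ultimately show ?thesis by linarith
    qed
  qed
  also have "\<dots> = (\<Sum>v\<in>V. bern_ex ?E \<tau> (\<lambda>\<omega>. of_bool (?pin v \<omega>)))" by (rule bern_ex_sum)
  also have "\<dots> \<le> (\<Sum>v\<in>V. avg \<Lambda> (chi {v}))"
    unfolding corr by (intro sum_mono corr_ge_percolation pr) simp
  finally show ?thesis .
qed

text \<open>The bound 1/2 is uniform in the volume and survives the limit. If the two limits agreed,
  the state would be invariant under the flip and every magnetization would vanish.\<close>

lemma phases_differ: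
  assumes V: "finite V" and mag: "\<And>\<Lambda>. finite \<Lambda> \<Longrightarrow> 1/2 \<le> (\<Sum>v\<in>V. avg \<Lambda> (chi {v}))"
  shows "\<exists>\<mu>\<^sub>p \<mu>\<^sub>m. thermodynamic_limit J \<epsilon> \<gamma> (\<lambda>_. 1) \<mu>\<^sub>p \<and>
                    thermodynamic_limit J \<epsilon> \<gamma> (\<lambda>_. -1) \<mu>\<^sub>m \<and> \<mu>\<^sub>p \<noteq> \<mu>\<^sub>m"
proof -
  obtain \<mu> where \<mu>: "thermodynamic_limit J \<epsilon> \<gamma> (\<lambda>_. 1) \<mu>"
    "\<And>f. local_fun f \<Longrightarrow> ((\<lambda>\<Lambda>. avg \<Lambda> f) \<longlongrightarrow> integral\<^sup>L \<mu> f) (finite_subsets_at_top UNIV)"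
    using plus_limit_exists by blast
  have loc: "local_fun (chi {v})" for v :: site
    unfolding local_fun_def by (rule exI[of _ "{v}"]) (simp add: chi_def)
  have "((\<lambda>\<Lambda>. \<Sum>v\<in>V. avg \<Lambda> (chi {v})) \<longlongrightarrow> (\<Sum>v\<in>V. integral\<^sup>L \<mu> (chi {v}))) (finite_subsets_at_top UNIV)"
    by (intro tendsto_sum \<mu>(2) loc)
  then have half: "1/2 \<le> (\<Sum>v\<in>V. integral\<^sup>L \<mu> (chi {v}))"
  proof (rule tendsto_lowerbound)
    show "eventually (\<lambda>\<Lambda>. 1/2 \<le> (\<Sum>v\<in>V. avg \<Lambda> (chi {v}))) (finite_subsets_at_top UNIV)"
      by (rule eventually_finite_subsets_at_top_weakI) (rule mag)
  qed simp
  have sets: "sets \<mu> = sets config_space" using \<mu>(1) by (simp add: thermodynamic_limit_def)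
  have flip_meas: "flip \<in> \<mu> \<rightarrow>\<^sub>M config_space" using measurable_flip measurable_cong_sets[OF sets refl] by blast
  have "\<mu> \<noteq> distr \<mu> config_space flip"
  proof
    assume eq: "\<mu> = distr \<mu> config_space flip"
    have "integral\<^sup>L \<mu> (chi {v}) = 0" for v
    proof -
      have "integral\<^sup>L \<mu> (chi {v}) = integral\<^sup>L (distr \<mu> config_space flip) (chi {v})" by (subst eq) simp
      also have "\<dots> = integral\<^sup>L \<mu> (\<lambda>\<sigma>. chi {v} (flip \<sigma>))"
        by (rule integral_distr[OF flip_meas local_fun_measurable[OF loc]])
      also have "\<dots> = integral\<^sup>L \<mu> (\<lambda>\<sigma>. - chi {v} \<sigma>)" by (simp add: chi_def flip_def)
      also have "\<dots> = - integral\<^sup>L \<mu> (chi {v})" by (rule Bochner_Integration.integral_minus)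
      finally show ?thesis by simp
    qed
    then show False using half by simp
  qed
  then show ?thesis using \<mu>(1) thermodynamic_limit_minus[OF \<mu>(1)] by blast
qed

end

theorem theorem1:
  fixes J :: "real \<Rightarrow> real" and \<epsilon> :: real
  assumes J_nonneg: "\<And>x. J x \<ge> 0"
    and J_symmetric: "\<And>x. J (- x) = J x"
    and J_integrable: "integrable lborel J"
    and J_integral: "(LINT x|lborel. J x) = 1"
    and J_C1: "J C1_differentiable_on UNIV"
    and J_support: "closure {x. J x \<noteq> 0} \<subseteq> {-1..1}"
    and J_zero: "J 0 > 0"
    and eps: "\<epsilon> > 0"
  shows "\<exists>\<gamma>\<^sub>0>0. \<forall>\<gamma>. 0 < \<gamma> \<and> \<gamma> < \<gamma>\<^sub>0 \<longrightarrow>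
           (\<exists>\<mu>\<^sub>p \<mu>\<^sub>m. thermodynamic_limit J \<epsilon> \<gamma> (\<lambda>_. 1) \<mu>\<^sub>p \<and>
                    thermodynamic_limit J \<epsilon> \<gamma> (\<lambda>_. -1) \<mu>\<^sub>m \<and>
                    \<mu>\<^sub>p \<noteq> \<mu>\<^sub>m)"
proof -
  have supp: "J x = 0" if "1 < \<bar>x\<bar>" for x
  proof (rule ccontr)
    assume "J x \<noteq> 0"
    then have "x \<in> {-1..1}" using J_support closure_subset[of "{x. J x \<noteq> 0}"] by blast
    then show False using that by auto
  qed
  have cont: "continuous_on UNIV J" using J_C1 by (rule C1_differentiable_imp_continuous_on)
  obtain B where B: "J x \<le> B" for x
  proof -
    have "continuous_on {-1..1} J" using cont continuous_on_subset by blast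
    then obtain y where y: "\<forall>x\<in>{-1..1}. J x \<le> J y" using continuous_attains_sup[of "{-1..1::real}" J] by auto
    have "J x \<le> J y" for x
    proof (cases "x \<in> {-1..1}")
      case False
      then have "J x = 0" by (intro supp) auto
      then show ?thesis using J_nonneg[of y] by simp
    qed (use y in blast)
    then show ?thesis using that by blast
  qed
  \<comment> \<open>By continuity J stays above half of its value at 0 on a neighbourhood of the
    origin.\<close>
  define b where "b = J 0 / 2"
  have b: "0 < b" using J_zero by (simp add: b_def)
  obtain r where r: "0 < r" "r \<le> 1" "\<And>x. \<bar>x\<bar> \<le> r \<Longrightarrow> b \<le> J x"
  proof -
    have "isCont J 0" using cont by (simp add: continuous_on_eq_continuous_at)
    then obtain d where d: "0 < d" "\<And>x. dist x 0 < d \<Longrightarrow> dist (J x) (J 0) < b"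
      using b unfolding continuous_at_eps_delta by blast
    have "b \<le> J x" if "\<bar>x\<bar> \<le> min 1 (d / 2)" for x
    proof -
      have "dist x 0 < d" using that d(1) by (simp add: dist_real_def)
      then have "\<bar>J x - J 0\<bar> < b" using d(2) by (simp add: dist_real_def)
      then show ?thesis unfolding b_def by linarith
    qed
    then show ?thesis using that[of "min 1 (d / 2)"] d(1) by simp
  qed
  have B_pos: "0 < B" using B[of 0] J_zero by linarith
  define C where "C = B / (r * b)"
  define c where "c = b / (2 * B)"
  have Cc: "0 < C" "0 < c" using B_pos b r by (simp_all add: C_def c_def)
  \<comment> \<open>A vertical bond has percolation probability tanh \<epsilon>, to be divided among
    five copies.\<close>
  define t where "t = tanh \<epsilon> / 5"
  have t: "0 < t" "t \<le> 1" using eps tanh_real_lt_1[of \<epsilon>] by (simp_all add: t_def)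
  obtain \<gamma>1 where \<gamma>1: "0 < \<gamma>1" "\<And>\<gamma> \<kappa>. 0 < \<gamma> \<and> \<gamma> < \<gamma>1 \<and> kernel \<kappa> \<gamma> C c r \<Longrightarrow>
    (\<exists>V. finite V \<and> (\<forall>n. \<exists>E. finite E \<and> (\<forall>e\<in>E. horizontal e \<or> vertical e) \<and>
       (\<forall>q. is_prob E q \<longrightarrow> (\<forall>x y i. x \<noteq> y \<longrightarrow> (1 - t/32) * \<kappa> (x - y) \<le> q {(x, i), (y, i)}) \<longrightarrow>
         (\<forall>x i. 5 * t \<le> q {(x, i), (x, i + 1)}) \<longrightarrow>
         1/2 \<le> bern_ex E q (\<lambda>W. of_bool (\<exists>v\<in>V. \<exists>C. finite C \<and> n \<le> card C \<and> (\<forall>u\<in>C. reach W v u))))))"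
    using kernel_percolation[OF t r(1,2) Cc(2,1)] by blast
  \<comment> \<open>The bound t / (64 C) makes every horizontal coupling at most t/64, as
    \<open>tanh_ge\<close> requires for a = t/32.\<close>
  define \<gamma>0 where "\<gamma>0 = min \<gamma>1 (min (r / 2) (t / (64 * C)))"
  have "0 < \<gamma>0" using \<gamma>1(1) r t Cc by (simp add: \<gamma>0_def)
  moreover have "\<exists>\<mu>\<^sub>p \<mu>\<^sub>m. thermodynamic_limit J \<epsilon> \<gamma> (\<lambda>_. 1) \<mu>\<^sub>p \<and>
                    thermodynamic_limit J \<epsilon> \<gamma> (\<lambda>_. -1) \<mu>\<^sub>m \<and> \<mu>\<^sub>p \<noteq> \<mu>\<^sub>m"
    if \<gamma>: "0 < \<gamma>" "\<gamma> < \<gamma>0" for \<gamma>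
  proof -
    have small: "\<gamma> < \<gamma>1" "\<gamma> \<le> r / 2" "\<gamma> \<le> t / (64 * C)" using \<gamma> by (auto simp: \<gamma>0_def)
    have ker: "kernel (kac_kernel J \<gamma>) \<gamma> C c r" unfolding C_def c_def
      by (rule kac_kernel_is_kernel) (use J_nonneg J_symmetric B supp b r \<gamma> small in auto)
    interpret kernel "kac_kernel J \<gamma>" \<gamma> C c r by (rule ker)
    interpret layered J \<gamma> C c r \<epsilon> by unfold_locales (rule eps)
    obtain V where V: "finite V" "\<And>n. \<exists>E. finite E \<and> (\<forall>e\<in>E. horizontal e \<or> vertical e) \<and>
       (\<forall>q. is_prob E q \<longrightarrow> (\<forall>x y i. x \<noteq> y \<longrightarrow> (1 - t/32) * kac_kernel J \<gamma> (x - y) \<le> q {(x, i), (y, i)}) \<longrightarrow>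
         (\<forall>x i. 5 * t \<le> q {(x, i), (x, i + 1)}) \<longrightarrow>
         1/2 \<le> bern_ex E q (\<lambda>W. of_bool (\<exists>v\<in>V. \<exists>C. finite C \<and> n \<le> card C \<and> (\<forall>u\<in>C. reach W v u))))"
      using \<gamma>1(2)[of \<gamma> "kac_kernel J \<gamma>"] \<gamma>(1) small(1) ker by blast
    have hor: "\<forall>x y i. x \<noteq> y \<longrightarrow> (1 - t/32) * kac_kernel J \<gamma> (x - y) \<le> \<tau> {(x, i), (y, i)}"
    proof (intro allI impI)
      fix x y i :: int assume "x \<noteq> y"
      have "C * \<gamma> \<le> t / 32 / 2" using small(3) Cc by (simp add: field_simps)
      then have "kac_kernel J \<gamma> (x - y) \<le> t / 32 / 2" using upper[of "x - y"] by linarith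
      then show "(1 - t/32) * kac_kernel J \<gamma> (x - y) \<le> \<tau> {(x, i), (y, i)}"
        unfolding \<tau>_def strength_hor[OF \<open>x \<noteq> y\<close>] by (intro tanh_ge nonneg)
    qed
    have vert: "\<forall>x i. 5 * t \<le> \<tau> {(x, i), (x, i + 1)}"
      unfolding \<tau>_def strength_vert t_def by simp
    have "1/2 \<le> (\<Sum>v\<in>V. avg \<Lambda> (chi {v}))" if \<Lambda>: "finite \<Lambda>" for \<Lambda>
    proof -
      obtain E where E: "finite E" "\<forall>e\<in>E. horizontal e \<or> vertical e"
        "\<forall>q. is_prob E q \<longrightarrow> (\<forall>x y i. x \<noteq> y \<longrightarrow> (1 - t/32) * kac_kernel J \<gamma> (x - y) \<le> q {(x, i), (y, i)}) \<longrightarrow>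
         (\<forall>x i. 5 * t \<le> q {(x, i), (x, i + 1)}) \<longrightarrow>
         1/2 \<le> bern_ex E q (\<lambda>W. of_bool (\<exists>v\<in>V. \<exists>C. finite C \<and> Suc (card \<Lambda>) \<le> card C \<and> (\<forall>u\<in>C. reach W v u)))"
        using V(2)[of "Suc (card \<Lambda>)"] by blast
      have "is_prob E \<tau>" using E(2) by (intro \<tau>_prob) auto
      then have perc: "1/2 \<le> bern_ex E \<tau> (\<lambda>W. of_bool (\<exists>v\<in>V. \<exists>C. finite C \<and> Suc (card \<Lambda>) \<le> card C \<and> (\<forall>u\<in>C. reach W v u)))"
        using E(3) hor vert by blast
      show ?thesis by (rule magnetization_ge[OF \<Lambda> V(1) E(1,2) perc])
    qed
    then show ?thesis by (rule phases_differ[OF V(1)])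
  qed
  ultimately show ?thesis by blast
qed

end
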